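(* In the setting of the context, suppose that $\tau$ is irrational (with respect to $(X,\mu,f)$) and that $\tau$ satisfies a mixing local limit theorem, i.e. one of the following two alternatives holds: (i) $\tau$ is aperiodic, and there are an algebra $\mathcal X$ of measurable subsets of $X$, a constant $\bar c>0$ and a bounded continuous probability density $\rho$ on $[0,\infty)$ such that for all $A,B\in\mathcal X$, all $l>0$ and all $\varepsilon>0$, $$\mathcal R(k)\,\mu\big(x\in A,\ f^kx\in B,\ \tau_k(x)\in[t-l,t]\big)-\bar c\,\rho\Big(\frac{t}{\mathcal R(k)}\Big)\,l\,\mu(A)\mu(B)\longrightarrow 0\qquad (k\to\infty)$$ uniformly for $0\le t\le \mathcal R(k)/\varepsilon$; (ii) $\tau$ is periodic, $X$ is a topological space, and there are a bounded continuous function $\mathfrak h:X\to\mathbb R$, constants $\mathbf a\in\mathbb R$, $h>0$ with $\mathbf a/h$ irrational, a constant $\bar c>0$ and a bounded continuous probability density $\rho$ on $[0,\infty)$ such that, for every bounded continuous $\phi:X\times X\times\mathbb R\to\mathbb R$ compactly supported in the last coordinate, every $w\ge 0$ and every sequence $w_k\in\mathbf a k+h\mathbb Z$ with $w_k/\mathcal R(k)\to w$, $$\lim_{k\to\infty}\mathcal R(k)\int\phi\, d(\mathcal F_{k,\mathfrak h,w_k})_*\mu=\bar c\,\rho(w)\int\phi\, d(\mu\times\mu\times u),$$ the convergence being uniform for $w<1/\varepsilon$ for every $\varepsilon>0$ (that is, $\sup|\mathcal R(k)\int\phi\, d(\mathcal F_{k,\mathfrak h,w_k})_*\mu-\bar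 c\rho(w_k/\mathcal R(k))\int\phi\, d(\mu\times\mu\times u)|\to0$, the supremum being over $w_k\in(\mathbf a k+h\mathbb Z)\cap[0,\mathcal R(k)/\varepsilon]$). Suppose moreover that there are an integer $r\ge1$ and real numbers $\beta_{1,j},\beta_{2,j},\beta_{3,j}$ ($1\le j\le r$) with $$\beta_{2,j}+\frac{\beta_{3,j}}{\alpha}<1,\qquad \beta_{1,j}+\beta_{2,j}\alpha+\beta_{3,j}=1\qquad(1\le j\le r)$$ such that for every $l>0$ there are constants $C,t_0$ with $$\mu(\tau_k\in[t,t+l])\le\sum_{j=1}^r\frac{C\,l}{\mathcal L(t)^{\beta_{2,j}}\,t^{\beta_{1,j}}\,k^{\beta_{2,j}}\,\mathcal R(k)^{\beta_{3,j}}}\qquad\text{for all integers }k\ge1\text{ and all }t\ge t_0 .$$ Then for all $\mathcal A=A\times[a_1,a_2]\subset\Omega$ and $\mathcal B=B\times[b_1,b_2]\subset\Omega$, where $A,B\in\mathcal X$ in case (i), and $A,B$ are measurable with $\mu(\partial A)=\mu(\partial B)=0$ in case (ii), $$\lim_{t\to\infty}\mathcal L(t)\,t^{1-\alpha}\,\nu(\mathcal A\cap g_{-t}\mathcal B)=\hat c\,\mu(A)\mu(B)(a_2-a_1)(b_2-b_1)=\hat c\,\nu(\mathcal A)\nu(\mathcal B),\qquad \hat c=\bar c\,\alpha\int_0^\infty\frac{\rho(z)}{z^\alpha}\,dz .$$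
   Context: A function $\mathcal L:\mathbb R^+\to\mathbb R^+$ is slowly varying if $\lim_{t\to\infty}\mathcal L(ht)/\mathcal L(t)=1$ for every $h>0$; a function is regularly varying of index $\gamma$ if it is $t^\gamma$ times a slowly varying function. Setting. $f:X\to X$ preserves a probability measure $\mu$ (when $X$ is a topological space, $\mu$ is a Borel measure). $\tau:X\to(0,\infty)$ is a measurable roof function with $\mu(\tau>t)\sim\mathcal L(t)/t^\alpha$ as $t\to\infty$, where $0<\alpha<1$ and $\mathcal L$ is slowly varying. $\tau_k(x)=\sum_{i=0}^{k-1}\tau(f^ix)$. $\mathcal R$ is a regularly varying, eventually monotone positive function of index $1/\alpha$ with $\lim_{t\to\infty} t\,\mathcal L(\mathcal R(t))/\mathcal R(t)^\alpha=1$ (it is unique up to asymptotic equivalence). $g_t:\Omega\to\Omega$ is the suspension flow of $f$ under $\tau$: $\Omega=\{(x,s):x\in X,\ 0\le s\le\tau(x)\}$ with $(x,\tau(x))$ identified with $(f(x),0)$, and the flow moves with unit speed in the $s$ direction. It preserves the infinite measure $d\nu(x,s)=d\mu(x)\,ds$. $g_{-t}\mathcal B$ denotes the preimage of $\mathcal B$ under $g_t$. Definitions. For a dynamical system $(Y,\lambda,T)$, $\varphi:Y\to\mathbb R$ is rational if there are a real number $h$ and measurable $\psi:Y\to\mathbb Z$, $\mathfrak h:Y\to\mathbb R$ with $\varphi=h\psi+\mathfrak h-\mathfrak h\circ T$; otherwise it is irrational. It is periodic if there are real numbers $\mathbf a,h$ and measurable $\psi:Y\to\mathbb Z$, $\mathfrak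 h:Y\to\mathbb R$ with $\varphi=\mathbf a+h\psi+\mathfrak h-\mathfrak h\circ T$; otherwise it is aperiodic. $\mathcal F_{k,\mathfrak h,w_k}:X\to X\times X\times\mathbb R$ is the map $x\mapsto(x,\ f^kx,\ \tau_k(x)-\mathfrak h(x)+\mathfrak h(f^kx)-w_k)$; $u$ is $h$ times the counting measure on $h\mathbb Z$.
   Formalization: In case (ii) it is also assumed that for every open U, μ(U) is the supremum of ∫φ dμ over continuous 0≤φ≤1_U (automatic if X is metrizable); on arbitrary topological spaces the claim fails, since continuous test functions need not separate open sets. *)

theory Defs
  imports "HOL-Probability.Probability" "HOL-Library.Landau_Symbols"
begin

subsection \<open>Regular variation\<close>

text \<open>Functions \<open>\<real>\<^sup>+ \<rightarrow> \<real>\<^sup>+\<close> are total functions on the reals of which only the values on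
  \<open>(0,\<infinity>)\<close> are used.\<close>

definition slowly_varying :: "(real \<Rightarrow> real) \<Rightarrow> bool" where
  "slowly_varying L \<longleftrightarrow>
     (\<forall>t>0. L t > 0) \<and> (\<forall>h>0. ((\<lambda>t. L (h * t) / L t) \<longlongrightarrow> 1) at_top)"

definition regularly_varying :: "real \<Rightarrow> (real \<Rightarrow> real) \<Rightarrow> bool" where
  "regularly_varying \<gamma> R \<longleftrightarrow>
     (\<exists>L. slowly_varying L \<and> (\<forall>t>0. R t = t powr \<gamma> * L t))"

definition eventually_monotone :: "(real \<Rightarrow> real) \<Rightarrow> bool" where
  "eventually_monotone R \<longleftrightarrow> (\<exists>t0. mono_on {t0..} R \<or> antimono_on {t0..} R)"


subsection \<open>Cohomological conditions on an observable\<close>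

definition measure_preserving_map :: "'a measure \<Rightarrow> ('a \<Rightarrow> 'a) \<Rightarrow> bool" where
  "measure_preserving_map M f \<longleftrightarrow> f \<in> M \<rightarrow>\<^sub>M M \<and> distr M M f = M"

text \<open>As usual for measure preserving systems, identities between observables are meant almost
  everywhere.\<close>

definition rational_obs :: "'a measure \<Rightarrow> ('a \<Rightarrow> 'a) \<Rightarrow> ('a \<Rightarrow> real) \<Rightarrow> bool" where
  "rational_obs M f \<phi> \<longleftrightarrow>
     (\<exists>(h::real) (\<psi> :: 'a \<Rightarrow> int) (\<hh> :: 'a \<Rightarrow> real).
        \<psi> \<in> M \<rightarrow>\<^sub>M count_space UNIV \<and> \<hh> \<in> borel_measurable M \<and>
        (AE x in M. \<phi> x = h * of_int (\<psi> x) + \<hh> x - \<hh> (f x)))"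

definition periodic_obs :: "'a measure \<Rightarrow> ('a \<Rightarrow> 'a) \<Rightarrow> ('a \<Rightarrow> real) \<Rightarrow> bool" where
  "periodic_obs M f \<phi> \<longleftrightarrow>
     (\<exists>(a::real) (h::real) (\<psi> :: 'a \<Rightarrow> int) (\<hh> :: 'a \<Rightarrow> real).
        \<psi> \<in> M \<rightarrow>\<^sub>M count_space UNIV \<and> \<hh> \<in> borel_measurable M \<and>
        (AE x in M. \<phi> x = a + h * of_int (\<psi> x) + \<hh> x - \<hh> (f x)))"

abbreviation irrational_obs :: "'a measure \<Rightarrow> ('a \<Rightarrow> 'a) \<Rightarrow> ('a \<Rightarrow> real) \<Rightarrow> bool" where
  "irrational_obs M f \<phi> \<equiv> \<not> rational_obs M f \<phi>"

abbreviation aperiodic_obs :: "'a measure \<Rightarrow> ('a \<Rightarrow> 'a) \<Rightarrow> ('a \<Rightarrow> real) \<Rightarrow> bool" where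
  "aperiodic_obs M f \<phi> \<equiv> \<not> periodic_obs M f \<phi>"

definition birkhoff_sum :: "('a \<Rightarrow> 'a) \<Rightarrow> ('a \<Rightarrow> real) \<Rightarrow> nat \<Rightarrow> 'a \<Rightarrow> real" where
  "birkhoff_sum f \<tau> k x = (\<Sum>i<k. \<tau> ((f ^^ i) x))"


subsection \<open>Mixing local limit theorems\<close>

definition bounded_cont_density :: "(real \<Rightarrow> real) \<Rightarrow> bool" where
  "bounded_cont_density \<rho> \<longleftrightarrow>
     continuous_on {0..} \<rho> \<and> bounded (\<rho> ` {0..}) \<and> (\<forall>z\<ge>0. 0 \<le> \<rho> z) \<and>
     set_integrable lborel {0..} \<rho> \<and> (LBINT z:{0..}. \<rho> z) = 1"

definition mllt_aperiodic ::
  "'a measure \<Rightarrow> ('a \<Rightarrow> 'a) \<Rightarrow> ('a \<Rightarrow> real) \<Rightarrow> (real \<Rightarrow> real) \<Rightarrow>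
   'a set set \<Rightarrow> real \<Rightarrow> (real \<Rightarrow> real) \<Rightarrow> bool" where
  "mllt_aperiodic M f \<tau> R \<X> c \<rho> \<longleftrightarrow>
     aperiodic_obs M f \<tau> \<and> algebra (space M) \<X> \<and> \<X> \<subseteq> sets M \<and>
     c > 0 \<and> bounded_cont_density \<rho> \<and>
     (\<forall>A\<in>\<X>. \<forall>B\<in>\<X>. \<forall>l>0. \<forall>\<epsilon>>0. \<forall>\<delta>>0. \<forall>\<^sub>F k in sequentially.
        \<forall>t. 0 \<le> t \<and> t \<le> R (real k) / \<epsilon> \<longrightarrow>
          \<bar>R (real k) * measure M {x\<in>space M. x \<in> A \<and> (f ^^ k) x \<in> B \<and>
                                       birkhoff_sum f \<tau> k x \<in> {t - l..t}}
            - c * \<rho> (t / R (real k)) * l * measure M A * measure M B\<bar> < \<delta>)"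

definition shifted_lattice :: "real \<Rightarrow> real \<Rightarrow> nat \<Rightarrow> real set" where
  "shifted_lattice a h k = {a * real k + h * of_int n | n :: int. True}"

definition lattice_measure :: "real \<Rightarrow> real measure" where
  "lattice_measure h =
     scale_measure (ennreal h) (distr (count_space (UNIV :: int set)) borel (\<lambda>n. h * of_int n))"

definition llt_map ::
  "('a \<Rightarrow> 'a) \<Rightarrow> ('a \<Rightarrow> real) \<Rightarrow> ('a \<Rightarrow> real) \<Rightarrow> nat \<Rightarrow> real \<Rightarrow> 'a \<Rightarrow> 'a \<times> 'a \<times> real" where
  "llt_map f \<tau> \<hh> k w x =
     (x, (f ^^ k) x, birkhoff_sum f \<tau> k x - \<hh> x + \<hh> ((f ^^ k) x) - w)"

definition llt_measure ::
  "'a measure \<Rightarrow> ('a \<Rightarrow> 'a) \<Rightarrow> ('a \<Rightarrow> real) \<Rightarrow> ('a \<Rightarrow> real) \<Rightarrow> nat \<Rightarrow> real \<Rightarrow> ('a \<times> 'a \<times> real) measure"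
  where "llt_measure M f \<tau> \<hh> k w =
     distr M (M \<Otimes>\<^sub>M (M \<Otimes>\<^sub>M borel)) (llt_map f \<tau> \<hh> k w)"

definition llt_test_function :: "'a topology \<Rightarrow> ('a \<times> 'a \<times> real \<Rightarrow> real) \<Rightarrow> bool" where
  "llt_test_function T \<phi> \<longleftrightarrow>
     continuous_map (prod_topology T (prod_topology T euclideanreal)) euclideanreal \<phi> \<and>
     bounded (\<phi> ` (topspace T \<times> topspace T \<times> UNIV)) \<and>
     (\<exists>K. compact K \<and> (\<forall>x\<in>topspace T. \<forall>y\<in>topspace T. \<forall>s. s \<notin> K \<longrightarrow> \<phi> (x, y, s) = 0))"

definition borel_for :: "'a topology \<Rightarrow> 'a measure \<Rightarrow> bool" where
  "borel_for T M \<longleftrightarrow>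
     space M = topspace T \<and> sets M = sigma_sets (topspace T) {U. openin T U}"

text \<open>The convergence in the periodic case is required both along each sequence
  \<open>w\<^sub>k \<in> a k + h\<int>\<close> with \<open>w\<^sub>k / R k \<rightarrow> w \<ge> 0\<close> (such \<open>w\<^sub>k\<close> may be negative if \<open>w = 0\<close>) and
  uniformly over \<open>w\<^sub>k \<in> (a k + h\<int>) \<inter> [0, R k / \<epsilon>]\<close>.\<close>

definition mllt_periodic ::
  "'a topology \<Rightarrow> 'a measure \<Rightarrow> ('a \<Rightarrow> 'a) \<Rightarrow> ('a \<Rightarrow> real) \<Rightarrow> (real \<Rightarrow> real) \<Rightarrow>
   real \<Rightarrow> (real \<Rightarrow> real) \<Rightarrow> bool" where
  "mllt_periodic T M f \<tau> R c \<rho> \<longleftrightarrow>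
     periodic_obs M f \<tau> \<and> borel_for T M \<and> c > 0 \<and> bounded_cont_density \<rho> \<and>
     (\<exists>(\<hh> :: 'a \<Rightarrow> real) (a::real) (h::real).
        continuous_map T euclideanreal \<hh> \<and> bounded (\<hh> ` topspace T) \<and>
        h > 0 \<and> a / h \<notin> \<rat> \<and>
        (\<forall>\<phi>. llt_test_function T \<phi> \<longrightarrow>
           (let I = integral\<^sup>L (M \<Otimes>\<^sub>M (M \<Otimes>\<^sub>M lattice_measure h)) \<phi> in
            (\<forall>w\<ge>0. \<forall>v :: nat \<Rightarrow> real.
               (\<forall>k. v k \<in> shifted_lattice a h k) \<and> (\<lambda>k. v k / R (real k)) \<longlonglongrightarrow> w \<longrightarrow>
               (\<lambda>k. R (real k) * integral\<^sup>L (llt_measure M f \<tau> \<hh> k (v k)) \<phi>)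
                 \<longlonglongrightarrow> c * \<rho> w * I) \<and>
            (\<forall>\<epsilon>>0. \<forall>\<delta>>0. \<forall>\<^sub>F k in sequentially.
               \<forall>v \<in> shifted_lattice a h k \<inter> {0..R (real k) / \<epsilon>}.
                 \<bar>R (real k) * integral\<^sup>L (llt_measure M f \<tau> \<hh> k v) \<phi>
                   - c * \<rho> (v / R (real k)) * I\<bar> < \<delta>))))"

text \<open>On an arbitrary topological space bounded continuous functions need not see the open sets
  at all (they may all be constant), and then convergence against continuous test functions says
  nothing about sets with null boundary. The following is the regularity of \<open>\<mu>\<close> used for that
  passage. It is automatic on metrizable spaces, as shown below.\<close>

definition cont_inner_regular :: "'a topology \<Rightarrow> 'a measure \<Rightarrow> bool" where
  "cont_inner_regular T M \<longleftrightarrow>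
     (\<forall>U e. openin T U \<and> e > 0 \<longrightarrow>
        (\<exists>\<phi>. continuous_map T euclideanreal \<phi> \<and>
             (\<forall>x\<in>topspace T. 0 \<le> \<phi> x \<and> \<phi> x \<le> indicator U x) \<and>
             integral\<^sup>L M \<phi> > measure M U - e))"

lemma continuous_map_borel_for:
  assumes "borel_for T M" "continuous_map T euclideanreal \<phi>"
  shows "\<phi> \<in> borel_measurable M"
proof (rule borel_measurableI)
  fix S :: "real set"
  assume "open S"
  then have "openin T {x \<in> topspace T. \<phi> x \<in> S}"
    using assms(2) by (simp add: continuous_map_def)
  moreover have "\<phi> -` S \<inter> space M = {x \<in> topspace T. \<phi> x \<in> S}"
    using assms(1) by (auto simp: borel_for_def)
  ultimately show "\<phi> -` S \<inter> space M \<in> sets M"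
    using assms(1) by (auto simp: borel_for_def)
qed

lemma cont_inner_regular_metrizable:
  assumes "metrizable_space T" "borel_for T M" "finite_measure M"
  shows "cont_inner_regular T M"
  unfolding cont_inner_regular_def
proof (intro allI impI, elim conjE)
  fix U and e :: real
  assume U: "openin T U" and e: "e > 0"
  interpret finite_measure M by fact
  have sp: "space M = topspace T" and op: "\<And>V. openin T V \<Longrightarrow> V \<in> sets M"
    using assms(2) by (auto simp: borel_for_def)
  have cl: "V \<in> sets M" if "closedin T V" for V
  proof -
    have "space M - (topspace T - V) \<in> sets M"
      using that op by (intro sets.compl_sets) (auto simp: closedin_def)
    moreover have "space M - (topspace T - V) = V"
      using closedin_subset[OF that] sp by auto
    ultimately show ?thesis by simp
  qed
  obtain C where C: "\<And>n. closedin T (C n)" "\<And>n. C n \<subseteq> C (Suc n)" "\<Union> (range C) = U"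
    using open_imp_fsigma_in[OF assms(1) U] by (auto simp: fsigma_in_ascending)
  have "(\<lambda>n. measure M (C n)) \<longlonglongrightarrow> measure M (\<Union> (range C))"
    using C cl by (intro finite_Lim_measure_incseq) (auto intro: incseq_SucI)
  then have "\<forall>\<^sub>F n in sequentially. measure M (C n) > measure M U - e"
    using C(3) e by (intro order_tendstoD(1)) auto
  then obtain n where n: "measure M (C n) > measure M U - e"
    by (auto simp: eventually_sequentially)
  have cU: "closedin T (topspace T - U)" using U by blast
  have dj: "disjnt (topspace T - U) (C n)" using C(3) by (auto simp: disjnt_def)
  obtain \<phi> where \<phi>: "continuous_map T (top_of_set {0..1::real}) \<phi>"
    "\<phi> ` (topspace T - U) \<subseteq> {0}" "\<phi> ` C n \<subseteq> {1}"
    using Urysohn_lemma[OF metrizable_imp_normal_space[OF assms(1)] cU C(1) dj, of 0 1] by auto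
  have cont: "continuous_map T euclideanreal \<phi>"
    and r: "\<And>x. x \<in> topspace T \<Longrightarrow> 0 \<le> \<phi> x \<and> \<phi> x \<le> 1"
    using \<phi>(1) by (auto simp: continuous_map_in_subtopology)
  have b: "0 \<le> \<phi> x \<and> \<phi> x \<le> indicator U x" if "x \<in> topspace T" for x
    using r[OF that] \<phi>(2) that by (cases "x \<in> U") auto
  have int: "integrable M \<phi>"
    using continuous_map_borel_for[OF assms(2) cont] r sp
    by (intro integrable_const_bound[where B = 1]) auto
  have "measure M (C n) = integral\<^sup>L M (indicator (C n))"
    using sets.sets_into_space[OF cl[OF C(1)[of n]]] by (simp add: inf_absorb1)
  also have "\<dots> \<le> integral\<^sup>L M \<phi>"
  proof (rule integral_mono[OF _ int])
    show "integrable M (indicator (C n) :: 'a \<Rightarrow> real)"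
      using cl[OF C(1)[of n]] by (simp add: emeasure_eq_measure)
    show "indicator (C n) x \<le> \<phi> x" if "x \<in> space M" for x
      using \<phi>(3) r that sp by (auto simp: indicator_def)
  qed
  finally show "\<exists>\<phi>. continuous_map T euclideanreal \<phi> \<and>
      (\<forall>x\<in>topspace T. 0 \<le> \<phi> x \<and> \<phi> x \<le> indicator U x) \<and> measure M U - e < integral\<^sup>L M \<phi>"
    using cont b n by (intro exI[of _ \<phi>]) auto
qed


subsection \<open>The suspension flow\<close>

text \<open>The region under the roof, before the identification of \<open>(x, \<tau> x)\<close> with \<open>(f x, 0)\<close>.\<close>

definition susp_region :: "'a measure \<Rightarrow> ('a \<Rightarrow> real) \<Rightarrow> ('a \<times> real) set" where
  "susp_region M \<tau> = {(x, s). x \<in> space M \<and> 0 \<le> s \<and> s \<le> \<tau> x}"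

text \<open>The quotient is realised by the representatives with \<open>s < \<tau> x\<close>: since \<open>\<tau> > 0\<close>, two points
  of the region are identified iff they have the same image under the quotient map \<open>susp_proj\<close>.\<close>

definition susp_proj :: "('a \<Rightarrow> 'a) \<Rightarrow> ('a \<Rightarrow> real) \<Rightarrow> 'a \<times> real \<Rightarrow> 'a \<times> real" where
  "susp_proj f \<tau> = (\<lambda>(x, s). if s = \<tau> x then (f x, 0) else (x, s))"

definition susp_space :: "'a measure \<Rightarrow> ('a \<Rightarrow> real) \<Rightarrow> ('a \<times> real) set" where
  "susp_space M \<tau> = {(x, s). x \<in> space M \<and> 0 \<le> s \<and> s < \<tau> x}"

lemma susp_proj_image:
  assumes "f \<in> M \<rightarrow>\<^sub>M M" and "\<And>x. x \<in> space M \<Longrightarrow> \<tau> x > 0"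
  shows "susp_proj f \<tau> ` susp_region M \<tau> = susp_space M \<tau>"
proof
  show "susp_proj f \<tau> ` susp_region M \<tau> \<subseteq> susp_space M \<tau>"
    using assms measurable_space[OF assms(1)]
    by (auto simp: susp_proj_def susp_region_def susp_space_def split: if_splits)
  show "susp_space M \<tau> \<subseteq> susp_proj f \<tau> ` susp_region M \<tau>"
  proof
    fix p assume "p \<in> susp_space M \<tau>"
    then have "susp_proj f \<tau> p = p" "p \<in> susp_region M \<tau>"
      by (auto simp: susp_proj_def susp_region_def susp_space_def)
    then show "p \<in> susp_proj f \<tau> ` susp_region M \<tau>" by (metis imageI)
  qed
qed

text \<open>Upward motion for time \<open>t \<ge> 0\<close>; \<open>k\<close> is the number of crossings of the roof. It is
  well-defined except for those \<open>x\<close> with \<open>\<Sum>i. \<tau> (f\<^sup>i x) < \<infinity>\<close>, which form a null set by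
  Poincare recurrence and on which the value is irrelevant. As \<open>f\<close> need not be invertible,
  only \<open>t \<ge> 0\<close> is meaningful.\<close>

definition susp_flow ::
  "('a \<Rightarrow> 'a) \<Rightarrow> ('a \<Rightarrow> real) \<Rightarrow> real \<Rightarrow> 'a \<times> real \<Rightarrow> 'a \<times> real" where
  "susp_flow f \<tau> t = (\<lambda>(x, s).
     let k = (LEAST k. s + t < birkhoff_sum f \<tau> (Suc k) x)
     in ((f ^^ k) x, s + t - birkhoff_sum f \<tau> k x))"

definition susp_preimage ::
  "'a measure \<Rightarrow> ('a \<Rightarrow> 'a) \<Rightarrow> ('a \<Rightarrow> real) \<Rightarrow> real \<Rightarrow> ('a \<times> real) set \<Rightarrow> ('a \<times> real) set" where
  "susp_preimage M f \<tau> t \<B> = {p \<in> susp_space M \<tau>. susp_flow f \<tau> t p \<in> \<B>}"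

text \<open>The completion matters: the projection of a box \<open>A \<times> {a..b}\<close> whose top touches the roof
  contains a set \<open>f ` A' \<times> {0}\<close>, which is null but need not be product measurable.\<close>

definition susp_measure :: "'a measure \<Rightarrow> ('a \<Rightarrow> real) \<Rightarrow> ('a \<times> real) measure" where
  "susp_measure M \<tau> = restrict_space (completion (M \<Otimes>\<^sub>M lborel)) (susp_space M \<tau>)"

end

theory Submission
  imports Defs
begin

text \<open>Up to a null set, the orbit segment of length \<open>t\<close> that starts in \<open>A \<times> [a1,a2]\<close> ends in
  \<open>B \<times> [b1,b2]\<close> after exactly one number \<open>k\<close> of crossings of the roof, so the measure in question is
  \<open>\<Sum>k. P k t\<close> with \<open>P k t = \<integral> 1_A(x) 1_B(f^k x) G(\<tau>_k x - t)\<close> for a trapezoidal function \<open>G\<close>.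
  With \<open>n t = 1 / \<mu>(\<tau> > t)\<close>, the sum times \<open>t / n t\<close> is \<open>\<integral>\<^sub>0\<^sup>\<infinity> t P \<lceil>n t y\<rceil> t dy\<close>. By the local limit theorem
  and \<open>R (n t y) \<sim> t y powr (1/\<alpha>)\<close> the integrand converges to a multiple of
  \<open>\<rho> (y powr (-1/\<alpha>)) y powr (-1/\<alpha>)\<close>. It is dominated by an integrable power of \<open>y\<close>, for \<open>y \<ge> 1\<close> by
  Potter's bounds since \<open>1/\<alpha> > 1\<close>, for \<open>y \<le> 1\<close> by the assumed bound on \<open>\<mu>(\<tau>_k \<in> [t,t+l])\<close>, whose exponents
  make it scale invariant. The substitution \<open>z = y powr (-1/\<alpha>)\<close> gives the constant.

  In the periodic case the local limit carries an additional factor, a function of \<open>t - a k\<close> modulo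
  \<open>h\<close>. As \<open>a / h\<close> is irrational, its averages over long blocks of consecutive \<open>k\<close> are uniformly close to
  its mean.\<close>

text \<open>The local limit theorem speaks only where \<open>t\<close> is at most a multiple of
  \<open>R k\<close>, that is, for \<open>k\<close> at least of order \<open>n t\<close>. Its error
  \<open>o(1 / R k)\<close>, summed over the much smaller \<open>k\<close>, need not be small
  against the target order \<open>n t / t\<close>; there the assumed bound takes over, and the
  strict inequality between its exponents leaves the room that Potter's bounds consume. Both
  alternatives are brought to one form: \<open>R k * P k t - \<rho> (t / R k) * H k t\<close> tends
  to 0 for a bounded factor \<open>H\<close> whose averages over blocks of \<open>k\<close> are
  close to a constant, uniformly in \<open>k\<close> and \<open>t\<close>. In the aperiodic case
  \<open>H\<close> is constant. In the periodic case the integrand need not converge at fixed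
  \<open>y\<close>, and averages over blocks of a fixed length \<open>N\<close> settle only up to a
  tolerance. Dominated convergence is therefore applied to the excess of the error over that
  tolerance, with \<open>N\<close> fixed before \<open>t\<close> tends to infinity.\<close>

subsection \<open>Monotone regularly varying functions\<close>

text \<open>Monotonicity replaces the uniform convergence theorem: \<open>F (v x)\<close> is caught
  between values \<open>F (h * u x)\<close> for fixed \<open>h\<close> slightly below and slightly
  above \<open>y\<close>, and continuity of \<open>h powr \<gamma>\<close> in \<open>h\<close>
  closes the gap.\<close>

lemma mono_rv_ratio:
  fixes F :: "real \<Rightarrow> real"
  assumes mono: "mono_on {x0..} F" and pos: "\<And>x. x \<ge> x0 \<Longrightarrow> F x > 0"
    and rv: "\<And>h. h > 0 \<Longrightarrow> ((\<lambda>x. F (h * x) / F x) \<longlongrightarrow> h powr \<gamma>) at_top"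
    and u: "filterlim u at_top G" and v: "((\<lambda>x. v x / u x) \<longlongrightarrow> y) G" and y: "y > 0"
  shows "((\<lambda>x. F (v x) / F (u x)) \<longlongrightarrow> y powr \<gamma>) G"
proof (rule order_tendstoI)
  have cont: "((\<lambda>h. h powr \<gamma>) \<longlongrightarrow> y powr \<gamma>) (at y)"
    using y by (intro tendsto_powr tendsto_ident_at tendsto_const) auto
  have u0: "\<forall>\<^sub>F x in G. u x \<ge> max x0 1" using u unfolding filterlim_at_top by blast
  have hu: "\<forall>\<^sub>F x in G. h * u x \<ge> x0" if "h > 0" for h
    using u that filterlim_at_top_mult_tendsto_pos[of "\<lambda>_. h" h G u] by (simp add: filterlim_at_top mult.commute)
  {
    fix c assume c: "c < y powr \<gamma>"
    have "\<forall>\<^sub>F h in at_left y. c < h powr \<gamma>"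
      using tendsto_mono[OF _ cont, of "at_left y"] c by (intro order_tendstoD) (auto simp: at_le)
    then have "\<forall>\<^sub>F h in at_left y. c < h powr \<gamma> \<and> 0 < h \<and> h < y"
      using eventually_at_left_real[OF y] by eventually_elim auto
    then obtain h where h: "c < h powr \<gamma>" "0 < h" "h < y"
      using eventually_happens'[OF trivial_limit_at_left_real] by blast
    have "\<forall>\<^sub>F x in G. F (h * u x) / F (u x) > c"
      using filterlim_compose[OF rv[OF h(2)] u] h(1) by (simp add: order_tendstoD)
    moreover have "\<forall>\<^sub>F x in G. v x / u x > h" using order_tendstoD(1)[OF v h(3)] .
    ultimately show "\<forall>\<^sub>F x in G. c < F (v x) / F (u x)"
      using u0 hu[OF h(2)]
    proof eventually_elim
      case (elim x)
      have "h * u x \<le> v x" using elim by (simp add: field_simps)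
      then have "F (h * u x) \<le> F (v x)" using elim by (intro mono_onD[OF mono]) auto
      then have "F (h * u x) / F (u x) \<le> F (v x) / F (u x)"
        using pos[of "u x"] elim by (intro divide_right_mono) auto
      then show ?case using elim by linarith
    qed
  next
    fix c assume c: "y powr \<gamma> < c"
    have "\<forall>\<^sub>F h in at_right y. h powr \<gamma> < c"
      using tendsto_mono[OF _ cont, of "at_right y"] c by (intro order_tendstoD) (auto simp: at_le)
    then have "\<forall>\<^sub>F h in at_right y. h powr \<gamma> < c \<and> y < h"
      using eventually_at_right_less[of y] by eventually_elim auto
    then obtain h where h: "h powr \<gamma> < c" "y < h"
      using eventually_happens'[OF trivial_limit_at_right_real] by blast
    with y have h0: "h > 0" by simp
    have "\<forall>\<^sub>F x in G. F (h * u x) / F (u x) < c"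
      using filterlim_compose[OF rv[OF h0] u] h(1) by (simp add: order_tendstoD)
    moreover have "\<forall>\<^sub>F x in G. v x / u x < h" using order_tendstoD(2)[OF v h(2)] .
    \<comment> \<open>The comparison with \<open>h * u x\<close> bounds \<open>v x\<close> from
      above only. The crude bound \<open>y / 2\<close> keeps \<open>v x\<close> in the range where
      \<open>F\<close> is monotone.\<close>
    moreover have "\<forall>\<^sub>F x in G. v x / u x > y / 2" using y by (intro order_tendstoD(1)[OF v]) simp
    ultimately show "\<forall>\<^sub>F x in G. F (v x) / F (u x) < c"
      using u0 hu[OF half_gt_zero[OF y]]
    proof eventually_elim
      case (elim x)
      have "u x > 0" using elim by simp
      then have "v x \<le> h * u x" "y / 2 * u x \<le> v x"
        using elim by (simp_all only: pos_divide_less_eq pos_less_divide_eq order.strict_implies_order)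
      then have "v x \<le> h * u x" "x0 \<le> v x" using elim by auto
      then have "F (v x) \<le> F (h * u x)" by (intro mono_onD[OF mono]) auto
      then have "F (v x) / F (u x) \<le> F (h * u x) / F (u x)"
        using pos[of "u x"] elim by (intro divide_right_mono) auto
      then show ?case using elim by linarith
    qed
  }
qed

text \<open>Regular variation at the single factor 2, iterated, controls \<open>F\<close> along
  \<open>2 ^ j * y\<close>; monotonicity fills the gaps between consecutive powers of 2.\<close>

lemma potter:
  fixes F :: "real \<Rightarrow> real"
  assumes mono: "mono_on {x0..} F" and pos: "\<And>x. x \<ge> x0 \<Longrightarrow> F x > 0"
    and rv: "((\<lambda>x. F (2 * x) / F x) \<longlongrightarrow> 2 powr \<gamma>) at_top"
    and \<eta>: "0 < \<eta>" "\<eta> < \<gamma>"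
  obtains C K where "C > 0" "K \<ge> x0" "K > 0"
    "\<And>x y. K \<le> y \<Longrightarrow> y \<le> x \<Longrightarrow> C * (x / y) powr (\<gamma> - \<eta>) \<le> F x / F y"
    "\<And>x y. K \<le> y \<Longrightarrow> y \<le> x \<Longrightarrow> F x / F y \<le> (x / y) powr (\<gamma> + \<eta>) / C"
proof -
  have "\<forall>\<^sub>F x in at_top. F (2 * x) / F x > 2 powr (\<gamma> - \<eta>) \<and> F (2 * x) / F x < 2 powr (\<gamma> + \<eta>)"
    using \<eta> by (intro eventually_conj order_tendstoD[OF rv]) auto
  then obtain K0 where K0: "\<And>x. x \<ge> K0 \<Longrightarrow> F (2 * x) / F x > 2 powr (\<gamma> - \<eta>) \<and> F (2 * x) / F x < 2 powr (\<gamma> + \<eta>)"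
    by (auto simp: eventually_at_top_linorder)
  define K where "K = max K0 (max x0 1)"
  \<comment> \<open>The last, incomplete doubling costs \<open>2 powr (\<gamma> - \<eta>)\<close> in
    the lower and \<open>2 powr (\<gamma> + \<eta>)\<close> in the upper bound; the larger factor
    serves both.\<close>
  define C :: real where "C = 1 / 2 powr (\<gamma> + \<eta>)"
  have it: "(2 powr (\<gamma> - \<eta>)) ^ j * F y \<le> F (2 ^ j * y) \<and> F (2 ^ j * y) \<le> (2 powr (\<gamma> + \<eta>)) ^ j * F y"
    if y: "y \<ge> K" for y j
  proof (induction j)
    case (Suc j)
    have "1 * y \<le> 2 ^ j * y" using y by (intro mult_right_mono) (auto simp: K_def)
    then have ge: "2 ^ j * y \<ge> K0" "2 ^ j * y \<ge> x0" using y unfolding K_def by linarith+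
    have Fp: "F (2 ^ j * y) > 0" using pos ge by auto
    have "2 powr (\<gamma> - \<eta>) * F (2 ^ j * y) \<le> F (2 * (2 ^ j * y))" "F (2 * (2 ^ j * y)) \<le> 2 powr (\<gamma> + \<eta>) * F (2 ^ j * y)"
      using K0[OF ge(1)] Fp by (auto simp: field_simps)
    moreover have "2 powr (\<gamma> - \<eta>) * ((2 powr (\<gamma> - \<eta>)) ^ j * F y) \<le> 2 powr (\<gamma> - \<eta>) * F (2 ^ j * y)"
      "2 powr (\<gamma> + \<eta>) * F (2 ^ j * y) \<le> 2 powr (\<gamma> + \<eta>) * ((2 powr (\<gamma> + \<eta>)) ^ j * F y)"
      using Suc by (auto intro!: mult_left_mono)
    ultimately show ?case unfolding power_Suc mult.assoc by (intro conjI; linarith)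
  qed simp
  have main: "C * (x / y) powr (\<gamma> - \<eta>) \<le> F x / F y \<and> F x / F y \<le> (x / y) powr (\<gamma> + \<eta>) / C"
    if y: "K \<le> y" and x: "y \<le> x" for x y
  proof -
    have y0: "y > 0" "y \<ge> x0" using y by (auto simp: K_def)
    have xy: "x / y \<ge> 1" using x y0 by simp
    define j where "j = nat \<lfloor>log 2 (x / y)\<rfloor>"
    have l0: "log 2 (x / y) \<ge> 0" using xy by simp
    have "real j \<le> log 2 (x / y)" "log 2 (x / y) < real (Suc j)"
      using l0 by (simp_all add: j_def) linarith+
    then have "2 powr real j \<le> x / y" "x / y < 2 powr real (Suc j)"
      using xy by (auto simp: le_log_iff log_less_iff)
    then have j: "2 ^ j \<le> x / y" "x / y < 2 ^ Suc j" by (simp_all only: powr_realpow zero_less_numeral)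
    have jx: "2 ^ j * y \<le> x" "x \<le> 2 ^ Suc j * y" using j y0 by (auto simp: field_simps)
    have jy: "x0 \<le> 2 ^ j * y"
    proof -
      have "1 * y \<le> 2 ^ j * y" using y0 by (intro mult_right_mono) auto
      then show ?thesis using y0 by linarith
    qed
    have Fy: "F y > 0" using pos y0 by auto
    have pw: "(2 powr e) ^ i = (2 ^ i) powr e" for e :: real and i :: nat
    proof -
      have "(2 powr e) ^ i = 2 powr (real i * e)" by (simp add: powr_power mult.commute)
      also have "\<dots> = (2 powr real i) powr e" by (simp only: powr_powr)
      also have "\<dots> = (2 ^ i) powr e" by (simp add: powr_realpow)
      finally show ?thesis .
    qed
    have "(x / y) powr (\<gamma> - \<eta>) \<le> (2 ^ Suc j) powr (\<gamma> - \<eta>)"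
      using j \<eta> xy by (intro powr_mono2) auto
    also have "\<dots> = 2 powr (\<gamma> - \<eta>) * (2 powr (\<gamma> - \<eta>)) ^ j" unfolding pw power_Suc by (simp add: powr_mult)
    also have "\<dots> \<le> 2 powr (\<gamma> + \<eta>) * (2 powr (\<gamma> - \<eta>)) ^ j" using \<eta> by (intro mult_right_mono) auto
    finally have "C * (x / y) powr (\<gamma> - \<eta>) \<le> (2 powr (\<gamma> - \<eta>)) ^ j" by (simp add: C_def field_simps)
    moreover have "(2 powr (\<gamma> - \<eta>)) ^ j \<le> F x / F y"
    proof -
      have "F (2 ^ j * y) \<le> F x" using jx jy by (intro mono_onD[OF mono]) auto
      with it[OF y, of j] Fy show ?thesis by (simp add: field_simps)
    qed
    moreover have "F x / F y \<le> (2 powr (\<gamma> + \<eta>)) ^ Suc j"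
    proof -
      have "F x \<le> F (2 ^ Suc j * y)" using jx jy by (intro mono_onD[OF mono]) auto
      with it[OF y, of "Suc j"] have "F x \<le> (2 powr (\<gamma> + \<eta>)) ^ Suc j * F y" by linarith
      with Fy show ?thesis by (simp only: pos_divide_le_eq)
    qed
    moreover have "(2 powr (\<gamma> + \<eta>)) ^ Suc j \<le> (x / y) powr (\<gamma> + \<eta>) / C"
    proof -
      have "(2 ^ j) powr (\<gamma> + \<eta>) \<le> (x / y) powr (\<gamma> + \<eta>)" using j \<eta> by (intro powr_mono2) auto
      then have "2 powr (\<gamma> + \<eta>) * (2 ^ j) powr (\<gamma> + \<eta>) \<le> 2 powr (\<gamma> + \<eta>) * (x / y) powr (\<gamma> + \<eta>)"
        by (rule mult_left_mono) simp
      then show ?thesis by (simp add: C_def power_Suc pw mult.commute del: power_mult_distrib)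
    qed
    ultimately show ?thesis by linarith
  qed
  have "C > 0" "K \<ge> x0" "K > 0" by (auto simp: C_def K_def)
  with main show ?thesis by (intro that[of C K]) blast+
qed

subsection \<open>Renewal sums\<close>

text \<open>As a function of \<open>y\<close>, \<open>nat \<lceil>n * y\<rceil>\<close> is constant
  on intervals of length \<open>1 / n\<close>. An integral over a fixed half line admits dominated
  convergence, although the relevant indices move off with \<open>n\<close>.\<close>

lemma nn_integral_ceiling_sum:
  fixes F :: "nat \<Rightarrow> ennreal" and n :: real
  assumes n: "n > 0"
  shows "(\<integral>\<^sup>+y. F (nat \<lceil>n * y\<rceil>) * indicator {0<..} y \<partial>lborel) = (\<Sum>k. F (Suc k)) / ennreal n"
proof -
  define I where "I k = {real k / n <.. real (Suc k) / n}" for k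
  have I: "y \<in> I k \<longleftrightarrow> nat \<lceil>n * y\<rceil> = Suc k" if "y > 0" for y k
  proof -
    have "y \<in> I k \<longleftrightarrow> real k < n * y \<and> n * y \<le> real (Suc k)"
      using n by (simp add: I_def pos_divide_less_eq pos_le_divide_eq mult.commute del: of_nat_Suc)
    also have "\<dots> \<longleftrightarrow> \<lceil>n * y\<rceil> = int (Suc k)" by (simp add: ceiling_eq_iff)
    also have "\<dots> \<longleftrightarrow> nat \<lceil>n * y\<rceil> = Suc k" using n that by (auto simp: ceiling_less_iff)
    finally show ?thesis .
  qed
  have I0: "y \<notin> I k" if "\<not> y > 0" for y k
  proof -
    have "0 \<le> real k / n" using n by simp
    then show ?thesis using that by (auto simp: I_def)
  qed
  have "(\<integral>\<^sup>+y. F (nat \<lceil>n * y\<rceil>) * indicator {0<..} y \<partial>lborel)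
      = (\<integral>\<^sup>+y. (\<Sum>k. F (Suc k) * indicator (I k) y) \<partial>lborel)"
  proof (rule nn_integral_cong)
    fix y :: real
    show "F (nat \<lceil>n * y\<rceil>) * indicator {0<..} y = (\<Sum>k. F (Suc k) * indicator (I k) y)"
    proof (cases "y > 0")
      case True
      then have "n * y > 0" using n by simp
      then obtain k where k: "nat \<lceil>n * y\<rceil> = Suc k" by (metis not0_implies_Suc zero_less_ceiling zero_less_nat_eq less_not_refl)
      have "(\<Sum>k. F (Suc k) * indicator (I k) y) = (\<Sum>j\<in>{k}. F (Suc j) * indicator (I j) y)"
        using I[OF True] k by (intro suminf_finite) auto
      then show ?thesis using True I[OF True] k by simp
    next
      case False
      then show ?thesis using I0 by simp
    qed
  qed
  also have "\<dots> = (\<Sum>k. \<integral>\<^sup>+y. F (Suc k) * indicator (I k) y \<partial>lborel)"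
    by (intro nn_integral_suminf) (simp add: I_def)
  also have "\<dots> = (\<Sum>k. F (Suc k) * ennreal (1 / n))"
  proof (intro suminf_cong)
    fix k
    have "emeasure lborel (I k) = ennreal (1 / n)"
      using n by (simp add: I_def divide_right_mono field_simps)
    then show "(\<integral>\<^sup>+y. F (Suc k) * indicator (I k) y \<partial>lborel) = F (Suc k) * ennreal (1 / n)"
      by (subst nn_integral_cmult_indicator) (auto simp: I_def)
  qed
  also have "\<dots> = (\<Sum>k. F (Suc k)) * ennreal (1 / n)" by simp
  also have "\<dots> = (\<Sum>k. F (Suc k)) / ennreal n"
    using n by (simp add: divide_ennreal_def inverse_ennreal inverse_eq_divide)
  finally show ?thesis .
qed

lemma integral_ceiling_sum:
  fixes F :: "nat \<Rightarrow> real" and n :: real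
  assumes n: "n > 0" and F: "\<And>k. F k \<ge> 0"
    and D: "set_integrable lborel {0<..} D" "\<And>y. y > 0 \<Longrightarrow> F (nat \<lceil>n * y\<rceil>) \<le> D y"
  shows "summable (\<lambda>k. F (Suc k))"
    and "set_integrable lborel {0<..} (\<lambda>y. F (nat \<lceil>n * y\<rceil>))"
    and "(LBINT y:{0<..}. F (nat \<lceil>n * y\<rceil>)) = (\<Sum>k. F (Suc k)) / n"
proof -
  have m[measurable]: "(\<lambda>y. F (nat \<lceil>n * y\<rceil>)) \<in> borel_measurable borel" by measurable
  show int: "set_integrable lborel {0<..} (\<lambda>y. F (nat \<lceil>n * y\<rceil>))"
    unfolding set_integrable_def
    by (rule Bochner_Integration.integrable_bound[OF D(1)[unfolded set_integrable_def]])
      (use F D(2) in \<open>auto simp: indicator_def intro!: AE_I2 order_trans[OF D(2) abs_ge_self]\<close>)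
  have "ennreal (LBINT y:{0<..}. F (nat \<lceil>n * y\<rceil>)) = (\<integral>\<^sup>+y. ennreal (indicator {0<..} y * F (nat \<lceil>n * y\<rceil>)) \<partial>lborel)"
    using int F unfolding set_integrable_def set_lebesgue_integral_def
    by (subst nn_integral_eq_integral) auto
  also have "\<dots> = (\<integral>\<^sup>+y. ennreal (F (nat \<lceil>n * y\<rceil>)) * indicator {0<..} y \<partial>lborel)"
    by (intro nn_integral_cong) (auto simp: indicator_def)
  also have "\<dots> = (\<Sum>k. ennreal (F (Suc k))) / ennreal n" by (rule nn_integral_ceiling_sum[OF n])
  finally have eq: "ennreal (LBINT y:{0<..}. F (nat \<lceil>n * y\<rceil>)) = (\<Sum>k. ennreal (F (Suc k))) / ennreal n" .
  \<comment> \<open>The left side of \<open>eq\<close> is the image of a real number, so the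
    integrability granted by \<open>D\<close> forces the sum on the right to be finite.\<close>
  have "(\<Sum>k. ennreal (F (Suc k))) \<noteq> \<top>"
  proof
    assume "(\<Sum>k. ennreal (F (Suc k))) = \<top>"
    with eq n show False by (simp add: ennreal_top_divide)
  qed
  then show sm: "summable (\<lambda>k. F (Suc k))" by (intro summable_suminf_not_top) (use F in auto)
  have "(\<Sum>k. ennreal (F (Suc k))) / ennreal n = ennreal ((\<Sum>k. F (Suc k)) / n)"
    using F n sm by (subst suminf_ennreal2) (auto simp: divide_ennreal suminf_nonneg)
  with eq show "(LBINT y:{0<..}. F (nat \<lceil>n * y\<rceil>)) = (\<Sum>k. F (Suc k)) / n"
    using F n sm by (simp add: set_lebesgue_integral_def suminf_nonneg)
qed


text \<open>Averages over \<open>N\<close> consecutive indices occur in the last hypothesis because in the periodic case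
  the single terms oscillate. They leave the sum unchanged up to its first \<open>N\<close> terms.\<close>

lemma renewal_limit:
  fixes P :: "nat \<Rightarrow> real \<Rightarrow> real" and n D g :: "real \<Rightarrow> real" and c0 :: real
  assumes P: "\<And>k t. P k t \<ge> 0"
    and n: "\<And>t. n t > 0" "filterlim n at_top at_top"
    and D: "set_integrable lborel {0<..} D" "antimono_on {0<..} D" "\<And>y. y > 0 \<Longrightarrow> D y \<ge> 0"
      "((\<lambda>x. D (1 / x) / x) \<longlongrightarrow> 0) at_top"
    and dom: "\<forall>\<^sub>F t in at_top. \<forall>k\<ge>1. t * P k t \<le> D (real k / n t)"
    and g: "set_integrable lborel {0<..} g" "\<And>y. y > 0 \<Longrightarrow> g y \<ge> 0"
    and lim: "\<And>\<delta>. \<delta> > 0 \<Longrightarrow> \<exists>N\<ge>1. \<forall>y>0. \<forall>\<eta>>0. \<forall>\<^sub>F t in at_top.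
      \<bar>(\<Sum>i<N. t * P (nat \<lceil>n t * y\<rceil> + i) t) / real N - g y * c0\<bar> \<le> \<delta> * g y + \<eta>"
  shows "\<forall>\<^sub>F t in at_top. summable (\<lambda>k. P (Suc k) t)"
    and "((\<lambda>t. t / n t * (\<Sum>k. P (Suc k) t)) \<longlongrightarrow> c0 * (LBINT y:{0<..}. g y)) at_top"
proof -
  define good where "good t \<longleftrightarrow> t > 0 \<and> (\<forall>k\<ge>1. t * P k t \<le> D (real k / n t))" for t
  have good: "\<forall>\<^sub>F t in at_top. good t"
    using dom eventually_gt_at_top[of 0] by eventually_elim (auto simp: good_def)
  \<comment> \<open>Rounding up and shifting by \<open>i\<close> only increase the index, and
    \<open>D\<close> is antitone, so the single majorant \<open>D y\<close> serves every shift and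
    every good \<open>t\<close>.\<close>
  have bnd: "t * P (nat \<lceil>n t * y\<rceil> + i) t \<le> D y" if "good t" "y > 0" for t y i
  proof -
    have ny: "n t * y > 0" using n(1) that by simp
    then have c1: "nat \<lceil>n t * y\<rceil> \<ge> 1" by linarith
    have "n t * y \<le> real (nat \<lceil>n t * y\<rceil> + i)" using ny by linarith
    then have "y \<le> real (nat \<lceil>n t * y\<rceil> + i) / n t" using n(1)[of t] by (simp add: field_simps)
    then have "D (real (nat \<lceil>n t * y\<rceil> + i) / n t) \<le> D y"
      using that by (intro monotone_onD[OF D(2)]) auto
    moreover have "t * P (nat \<lceil>n t * y\<rceil> + i) t \<le> D (real (nat \<lceil>n t * y\<rceil> + i) / n t)"
      using that(1) c1 unfolding good_def by (meson le_add1 order_trans)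
    ultimately show ?thesis by linarith
  qed
  have S: "summable (\<lambda>k. t * P (Suc k + i) t)"
    "set_integrable lborel {0<..} (\<lambda>y. t * P (nat \<lceil>n t * y\<rceil> + i) t)"
    "(LBINT y:{0<..}. t * P (nat \<lceil>n t * y\<rceil> + i) t) = (\<Sum>k. t * P (Suc k + i) t) / n t"
    if t: "good t" for t i
  proof -
    have "t * P (k + i) t \<ge> 0" for k using P t by (simp add: good_def)
    note * = integral_ceiling_sum[of "n t" "\<lambda>k. t * P (k + i) t", OF n(1) this D(1) bnd[OF t]]
    show "summable (\<lambda>k. t * P (Suc k + i) t)"
      "set_integrable lborel {0<..} (\<lambda>y. t * P (nat \<lceil>n t * y\<rceil> + i) t)"
      "(LBINT y:{0<..}. t * P (nat \<lceil>n t * y\<rceil> + i) t) = (\<Sum>k. t * P (Suc k + i) t) / n t"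
      by (rule *; assumption)+
  qed
  have sm: "summable (\<lambda>k. P (Suc k) t)" if "good t" for t
  proof -
    have "summable (\<lambda>k. t * P (Suc k) t)" using S(1)[OF that, of 0] by simp
    moreover have "t \<noteq> 0" using that unfolding good_def by simp
    ultimately show ?thesis by (simp add: summable_cmult_iff)
  qed
  show "\<forall>\<^sub>F t in at_top. summable (\<lambda>k. P (Suc k) t)"
    using good by eventually_elim (rule sm)
  define Z where "Z t = t / n t * (\<Sum>k. P (Suc k) t)" for t
  define J where "J = (LBINT y:{0<..}. g y)"
  have J0: "J \<ge> 0" unfolding J_def set_lebesgue_integral_def
    using g(2) by (intro integral_nonneg_AE) (auto simp: indicator_def)
  show "((\<lambda>t. t / n t * (\<Sum>k. P (Suc k) t)) \<longlongrightarrow> c0 * J) at_top"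
    unfolding Z_def[symmetric]
  proof (rule tendstoI)
    fix e :: real assume e: "e > 0"
    \<comment> \<open>The tolerance costs \<open>\<delta> * J < e / 2\<close>; the integral of
      \<open>Q\<close> and the error \<open>E\<close> get \<open>e / 4\<close> each. Using
      \<open>J + 1\<close> avoids a division by zero.\<close>
    define \<delta> where "\<delta> = e / (3 * (J + 1))"
    have \<delta>: "\<delta> > 0" "\<delta> * J < e / 2" using e J0 by (auto simp: \<delta>_def field_simps intro: add_nonneg_pos)
    obtain N where N: "N \<ge> 1" and limN: "\<And>y \<eta>. y > 0 \<Longrightarrow> \<eta> > 0 \<Longrightarrow> \<forall>\<^sub>F t in at_top.
      \<bar>(\<Sum>i<N. t * P (nat \<lceil>n t * y\<rceil> + i) t) / real N - g y * c0\<bar> \<le> \<delta> * g y + \<eta>"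
      using lim[OF \<delta>(1)] by blast
    define U where "U t y = (\<Sum>i<N. t * P (nat \<lceil>n t * y\<rceil> + i) t) / real N" for t y
    \<comment> \<open>The block average \<open>U t y\<close> need not converge, since for the chosen
      \<open>N\<close> it is only asymptotically within \<open>\<delta> * g y\<close> of
      \<open>g y * c0\<close>. Its excess over this tolerance does tend to 0.\<close>
    define Q where "Q t y = max 0 (\<bar>U t y - g y * c0\<bar> - \<delta> * g y)" for t y
    have Umeas[measurable]: "U t \<in> borel_measurable borel" for t
      unfolding U_def by measurable
    have gmeas[measurable]: "(\<lambda>y. indicator {0<..} y * g y) \<in> borel_measurable borel"
      using g(1) by (auto simp: set_integrable_def dest: borel_measurable_integrable)
    \<comment> \<open>Only the product of \<open>g\<close> with the indicator is known to be
      measurable, so the indicator has to be pushed inside.\<close>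
    have Qeq: "indicator {0<..} y * Q t y = indicator {0<..} y * max 0 (\<bar>U t y - (indicator {0<..} y * g y) * c0\<bar> - \<delta> * (indicator {0<..} y * g y))" for t y
      by (auto simp: Q_def indicator_def)
    have Qmeas: "(\<lambda>y. indicator {0<..} y * Q t y) \<in> borel_measurable borel" for t
      unfolding Qeq by measurable
    have Ub: "0 \<le> U t y \<and> U t y \<le> D y" if "good t" "y > 0" for t y
    proof
      show "0 \<le> U t y" using that P by (auto simp: U_def good_def intro!: divide_nonneg_nonneg sum_nonneg)
      have "(\<Sum>i<N. t * P (nat \<lceil>n t * y\<rceil> + i) t) \<le> (\<Sum>i<N. D y)" using bnd[OF that] by (intro sum_mono)
      then show "U t y \<le> D y" using N by (simp add: U_def field_simps)
    qed
    have Ui: "set_integrable lborel {0<..} (U t)" if "good t" for t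
      using S(2)[OF that] unfolding U_def set_integrable_def real_scaleR_def
        times_divide_eq_right sum_distrib_left
      by (intro integrable_divide_zero Bochner_Integration.integrable_sum) auto
    have "((\<lambda>t. LBINT y:{0<..}. Q t y) \<longlongrightarrow> integral\<^sup>L lborel (\<lambda>y::real. 0)) at_top"
      unfolding set_lebesgue_integral_def real_scaleR_def
    proof (rule integral_dominated_convergence_at_top[where s = "\<lambda>t y. indicat_real {0<..} y * Q t y"
          and f = "\<lambda>y. 0" and M = lborel and w = "\<lambda>y. indicat_real {0<..} y * (D y + \<bar>c0\<bar> * g y)"])
      show "\<forall>\<^sub>F t in at_top. AE y in lborel. norm (indicator {0<..} y * Q t y) \<le> indicator {0<..} y * (D y + \<bar>c0\<bar> * g y)"
        using good
      proof eventually_elim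
        case (elim t)
        have "Q t y \<le> D y + \<bar>c0\<bar> * g y \<and> 0 \<le> Q t y" if y: "y > 0" for y
        proof -
          have "\<bar>U t y - g y * c0\<bar> \<le> \<bar>U t y\<bar> + \<bar>g y * c0\<bar>" by linarith
          also have "\<dots> \<le> D y + \<bar>c0\<bar> * g y" using Ub[OF elim y] g(2)[OF y] by (auto simp: abs_mult)
          finally have "\<bar>U t y - g y * c0\<bar> \<le> D y + \<bar>c0\<bar> * g y" .
          moreover have "\<delta> * g y \<ge> 0" using \<delta>(1) g(2)[OF y] by simp
          ultimately show ?thesis by (auto simp: Q_def)
        qed
        then show ?case by (auto simp: indicator_def)
      qed
      show "AE y in lborel. ((\<lambda>t. indicator {0<..} y * Q t y) \<longlongrightarrow> 0) at_top"
      proof (intro AE_I2)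
        fix y :: real
        show "((\<lambda>t. indicator {0<..} y * Q t y) \<longlongrightarrow> 0) at_top"
        proof (cases "y > 0")
          case True
          have "((\<lambda>t. Q t y) \<longlongrightarrow> 0) at_top"
          proof (rule tendstoI)
            fix \<eta> :: real assume "\<eta> > 0"
            then have "\<forall>\<^sub>F t in at_top. \<bar>U t y - g y * c0\<bar> \<le> \<delta> * g y + \<eta> / 2"
              unfolding U_def by (intro limN True) auto
            then show "\<forall>\<^sub>F t in at_top. dist (Q t y) 0 < \<eta>"
              by eventually_elim (use \<open>\<eta> > 0\<close> in \<open>auto simp: Q_def\<close>)
          qed
          then show ?thesis by (auto intro: tendsto_eq_intros)
        qed simp
      qed
      show "integrable lborel (\<lambda>y. indicator {0<..} y * (D y + \<bar>c0\<bar> * g y))"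
        using D(1) g(1) by (simp add: set_integrable_def distrib_left mult.left_commute)
      show "(\<lambda>y. indicat_real {0<..} y * Q t y) \<in> borel_measurable lborel" for t using Qmeas by simp
    qed simp_all
    then have Qlim: "((\<lambda>t. LBINT y:{0<..}. Q t y) \<longlongrightarrow> 0) at_top" by simp
    \<comment> \<open>The sum shifted by \<open>i\<close> misses its first \<open>i < N\<close>
      terms, each at most \<open>D (1 / n t)\<close>. After averaging over \<open>i\<close> and
      dividing by \<open>n t\<close> the loss is at most \<open>E t\<close>.\<close>
    define E where "E t = real N * (D (1 / n t) / n t)" for t
    have Elim: "(E \<longlongrightarrow> 0) at_top"
      using tendsto_mult[OF tendsto_const[of "real N"] filterlim_compose[OF D(4) n(2)]]
      unfolding E_def[abs_def] by simp
    have ZU: "\<bar>Z t - (LBINT y:{0<..}. U t y)\<bar> \<le> E t" if t: "good t" for t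
    proof -
      define p where "p k = t * P (Suc k) t" for k
      have ps: "summable p" using S(1)[OF t, of 0] by (simp add: p_def[abs_def])
      have p0: "0 \<le> p k" for k using P t by (simp add: p_def good_def)
      have pD: "p k \<le> D (1 / n t)" for k
      proof -
        have "p k \<le> D (real (Suc k) / n t)" using t unfolding p_def good_def using le_add1[of 1 k] by (metis plus_1_eq_Suc)
        also have "\<dots> \<le> D (1 / n t)" using n(1)[of t] by (intro monotone_onD[OF D(2)]) (auto intro: divide_right_mono)
        finally show ?thesis .
      qed
      have Zp: "Z t = suminf p / n t"
        using sm[OF t] by (simp add: Z_def p_def[abs_def] suminf_mult)
      have "(LBINT y:{0<..}. U t y) = (\<Sum>i<N. (LBINT y:{0<..}. t * P (nat \<lceil>n t * y\<rceil> + i) t)) / real N"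
        using S(2)[OF t] unfolding U_def set_lebesgue_integral_def set_integrable_def real_scaleR_def
          times_divide_eq_right sum_distrib_left
        by (subst Bochner_Integration.integral_divide_zero, subst Bochner_Integration.integral_sum) auto
      also have "\<dots> = (\<Sum>i<N. (\<Sum>k. p (k + i)) / n t) / real N"
        using S(3)[OF t] by (simp add: p_def)
      also have "\<dots> = (\<Sum>i<N. (suminf p - (\<Sum>j<i. p j)) / n t) / real N"
        using suminf_minus_initial_segment[OF ps] by simp
      also have "\<dots> = (real N * suminf p - (\<Sum>i<N. (\<Sum>j<i. p j))) / n t / real N"
        by (simp only: sum_divide_distrib[symmetric] sum_subtractf) simp
      also have "\<dots> = Z t - (\<Sum>i<N. (\<Sum>j<i. p j)) / (n t * real N)"
        using N n(1)[of t] by (simp add: Zp diff_divide_distrib)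
      finally have eq: "Z t - (LBINT y:{0<..}. U t y) = (\<Sum>i<N. (\<Sum>j<i. p j)) / (n t * real N)" by simp
      have D1: "D (1 / n t) \<ge> 0" using D(3) n(1) by simp
      have "(\<Sum>i<N. (\<Sum>j<i. p j)) \<le> (\<Sum>i<N. real N * D (1 / n t))"
      proof (intro sum_mono)
        fix i assume i: "i \<in> {..<N}"
        have "(\<Sum>j<i. p j) \<le> (\<Sum>j<i. D (1 / n t))" by (intro sum_mono pD)
        also have "\<dots> \<le> real N * D (1 / n t)" using i D1 by (auto intro: mult_right_mono)
        finally show "(\<Sum>j<i. p j) \<le> real N * D (1 / n t)" .
      qed
      then have "(\<Sum>i<N. (\<Sum>j<i. p j)) / (n t * real N) \<le> (real N * (real N * D (1 / n t))) / (n t * real N)"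
        using n(1)[of t] by (intro divide_right_mono) auto
      also have "\<dots> = E t" using N by (simp add: E_def)
      finally have "(\<Sum>i<N. (\<Sum>j<i. p j)) / (n t * real N) \<le> E t" .
      moreover have "(\<Sum>i<N. (\<Sum>j<i. p j)) / (n t * real N) \<ge> 0"
        using p0 n(1)[of t] by (intro divide_nonneg_nonneg sum_nonneg mult_nonneg_nonneg) auto
      ultimately show ?thesis using eq by linarith
    qed
    have UJ: "\<bar>(LBINT y:{0<..}. U t y) - c0 * J\<bar> \<le> (LBINT y:{0<..}. Q t y) + \<delta> * J" if t: "good t" for t
    proof -
      have Qi: "set_integrable lborel {0<..} (Q t)"
        unfolding set_integrable_def real_scaleR_def
      proof (rule Bochner_Integration.integrable_bound)
        show "integrable lborel (\<lambda>y. indicator {0<..} y * U t y + \<bar>c0\<bar> * (indicator {0<..} y * g y))"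
          using Ui[OF t] g(1) by (simp add: set_integrable_def)
        show "(\<lambda>y. indicat_real {0<..} y * Q t y) \<in> borel_measurable lborel" using Qmeas by simp
        have "\<bar>Q t y\<bar> \<le> \<bar>U t y + \<bar>c0\<bar> * g y\<bar>" if y: "y > 0" for y
        proof -
          have "\<bar>U t y - g y * c0\<bar> \<le> \<bar>U t y\<bar> + \<bar>g y * c0\<bar>" by linarith
          also have "\<dots> = U t y + \<bar>c0\<bar> * g y" using Ub[OF t y] g(2)[OF y] by (auto simp: abs_mult)
          finally have "\<bar>U t y - g y * c0\<bar> \<le> U t y + \<bar>c0\<bar> * g y" .
          moreover have "\<delta> * g y \<ge> 0" using \<delta>(1) g(2)[OF y] by simp
          ultimately show ?thesis by (auto simp: Q_def)
        qed
        then show "AE y in lborel. norm (indicat_real {0<..} y * Q t y) \<le> norm (indicator {0<..} y * U t y + \<bar>c0\<bar> * (indicator {0<..} y * g y))"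
          by (auto simp: indicator_def)
      qed
      have "(LBINT y:{0<..}. U t y) - c0 * J = (LBINT y:{0<..}. U t y - c0 * g y)"
        using Ui[OF t] g(1) by (simp add: J_def set_integral_diff set_integrable_mult_right)
      also have "\<bar>\<dots>\<bar> \<le> (LBINT y:{0<..}. Q t y + \<delta> * g y)"
      proof -
        have i1: "set_integrable lborel {0<..} (\<lambda>y. U t y - c0 * g y)"
          using Ui[OF t] g(1) by (simp add: set_integral_diff set_integrable_mult_right)
        have i2: "set_integrable lborel {0<..} (\<lambda>y. Q t y + \<delta> * g y)"
          using Qi g(1) by (simp add: set_integral_add set_integrable_mult_right)
        have b: "\<bar>U t y - c0 * g y\<bar> \<le> Q t y + \<delta> * g y" for y
          by (auto simp: Q_def mult.commute)
        have "\<bar>LBINT y:{0<..}. U t y - c0 * g y\<bar> \<le> (LBINT y:{0<..}. \<bar>U t y - c0 * g y\<bar>)"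
          using set_integral_norm_bound[OF i1] by simp
        also have "\<dots> \<le> (LBINT y:{0<..}. Q t y + \<delta> * g y)"
          using set_integrable_abs[OF i1] i2 b by (intro set_integral_mono) auto
        finally show ?thesis .
      qed
      also have "\<dots> = (LBINT y:{0<..}. Q t y) + \<delta> * J"
        using Qi g(1) by (simp add: J_def set_integral_add set_integrable_mult_right)
      finally show ?thesis .
    qed
    have "\<forall>\<^sub>F t in at_top. E t < e / 4" using e by (intro order_tendstoD(2)[OF Elim]) simp
    moreover have "\<forall>\<^sub>F t in at_top. (LBINT y:{0<..}. Q t y) < e / 4"
      using order_tendstoD(2)[OF Qlim, of "e / 4"] e by simp
    ultimately show "\<forall>\<^sub>F t in at_top. dist (Z t) (c0 * J) < e"
      using good
    proof eventually_elim
      case (elim t)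
      then show ?case using ZU[of t] UJ[of t] \<delta>(2) unfolding dist_real_def by linarith
    qed
  qed
qed

section \<open>Integrals of powers and the substitution behind the constant\<close>

lemma set_integrable_lborel_iff:
  fixes f :: "real \<Rightarrow> real"
  assumes "set_borel_measurable borel S f"
  shows "set_integrable lborel S f \<longleftrightarrow> f absolutely_integrable_on S"
  using assms unfolding set_integrable_def set_borel_measurable_def
  by (subst integrable_completion) auto

lemma set_integrable_powr_from_0:
  fixes a :: real
  assumes "a > -1"
  shows "set_integrable lborel {0<..1} (\<lambda>y. y powr a)"
proof -
  have "(\<lambda>y. y powr a) absolutely_integrable_on {0<..1}"
    using assms by (intro nonnegative_absolutely_integrable_1 integrable_on_powr_from_0') auto
  then show ?thesis
    by (subst set_integrable_lborel_iff) (auto simp: set_borel_measurable_def)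
qed

lemma set_integrable_powr_to_inf:
  fixes a :: real
  assumes "a < -1"
  shows "set_integrable lborel {1..} (\<lambda>y. y powr a)"
proof -
  have "(\<lambda>y. y powr a) absolutely_integrable_on {1..}"
    using has_integral_powr_to_inf[OF assms, of 1] by (intro nonnegative_absolutely_integrable_1) (auto simp: integrable_on_def)
  then show ?thesis
    by (subst set_integrable_lborel_iff) (auto simp: set_borel_measurable_def)
qed

text \<open>With \<open>y = z powr (-\<alpha>)\<close> the integrand becomes
  \<open>\<rho> z * z\<close> and the Jacobian is \<open>\<alpha> * z powr (-\<alpha> - 1)\<close>,
  so their product is \<open>\<alpha> * \<rho> z / z powr \<alpha>\<close>. The latter is integrable
  near 0 because \<open>\<rho>\<close> is bounded and \<open>\<alpha> < 1\<close>, and at infinity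
  because \<open>\<rho>\<close> is integrable.\<close>

lemma density_substitution:
  fixes \<rho> :: "real \<Rightarrow> real" and \<alpha> :: real
  assumes \<alpha>: "0 < \<alpha>" "\<alpha> < 1"
    and \<rho>: "continuous_on {0..} \<rho>" "bounded (\<rho> ` {0..})" "set_integrable lborel {0..} \<rho>"
  shows "set_integrable lborel {0<..} (\<lambda>y. \<rho> (y powr (-1/\<alpha>)) * y powr (-1/\<alpha>))"
    and "(LBINT y:{0<..}. \<rho> (y powr (-1/\<alpha>)) * y powr (-1/\<alpha>)) = \<alpha> * (LBINT z:{0<..}. \<rho> z / z powr \<alpha>)"
proof -
  let ?g = "\<lambda>y. \<rho> (y powr (-1/\<alpha>)) * y powr (-1/\<alpha>)"
  let ?F = "\<lambda>z. \<rho> z / z powr \<alpha>"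
  obtain b where b: "\<And>z. z \<ge> 0 \<Longrightarrow> \<bar>\<rho> z\<bar> \<le> b"
    using \<rho>(2) by (auto simp: bounded_iff)
  have b0: "b \<ge> 0" using b[of 0] by auto
  have cF: "continuous_on {0<..} ?F"
    by (intro continuous_intros continuous_on_subset[OF \<rho>(1)]) auto
  have mF: "set_borel_measurable borel {0<..} ?F"
    unfolding set_borel_measurable_def by (intro borel_measurable_continuous_on_indicator cF) auto
  have iF: "set_integrable lborel {0<..} ?F"
  proof -
    have "set_integrable lborel {0<..1} (\<lambda>z. b * z powr (-\<alpha>))"
      using \<alpha> by (intro set_integrable_mult_right set_integrable_powr_from_0) auto
    then have i1: "set_integrable lborel {0<..1} ?F"
    proof (rule set_integrable_bound)
      have "(\<lambda>z. indicat_real {0<..1} z *\<^sub>R ?F z) \<in> borel_measurable borel"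
        by (intro borel_measurable_continuous_on_indicator continuous_on_subset[OF cF]) auto
      then show "set_borel_measurable lborel {0<..1} ?F" by (simp add: set_borel_measurable_def)
      show "AE z in lborel. z \<in> {0<..1} \<longrightarrow> norm (?F z) \<le> norm (b * z powr (-\<alpha>))"
        using b b0 by (auto simp: abs_mult powr_minus_divide intro!: divide_right_mono)
    qed
    have "set_integrable lborel {1..} \<rho>"
      using \<rho>(3) by (rule set_integrable_subset) auto
    then have i2: "set_integrable lborel {1..} ?F"
    proof (rule set_integrable_bound)
      have "(\<lambda>z. indicat_real {1..} z *\<^sub>R ?F z) \<in> borel_measurable borel"
        by (intro borel_measurable_continuous_on_indicator continuous_on_subset[OF cF]) auto
      then show "set_borel_measurable lborel {1..} ?F" by (simp add: set_borel_measurable_def)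
      have "\<bar>\<rho> z\<bar> / z powr \<alpha> \<le> \<bar>\<rho> z\<bar>" if "z \<ge> 1" for z
        using that \<alpha> ge_one_powr_ge_zero[of z \<alpha>] by (simp add: divide_le_eq mult_le_cancel_left1)
      then show "AE z in lborel. z \<in> {1..} \<longrightarrow> norm (?F z) \<le> norm (\<rho> z)" by auto
    qed
    have "{0<..1} \<union> {1..} = {0::real<..}" by auto
    with set_integrable_Un[OF i1 i2] show ?thesis by simp
  qed
  have cg: "continuous_on {0<..} ?g"
    by (intro continuous_intros continuous_on_compose2[OF \<rho>(1)]) auto
  have mg: "set_borel_measurable borel {0<..} ?g"
    unfolding set_borel_measurable_def by (intro borel_measurable_continuous_on_indicator cg) auto
  have img: "(\<lambda>z. z powr (-\<alpha>)) ` {0<..} = {0<..}"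
  proof (intro equalityI subsetI)
    fix y :: real assume "y \<in> {0<..}"
    then have "y = (y powr (-1/\<alpha>)) powr (-\<alpha>)" "y powr (-1/\<alpha>) \<in> {0<..}" using \<alpha> by (auto simp: powr_powr)
    then show "y \<in> (\<lambda>z. z powr (-\<alpha>)) ` {0<..}" by blast
  qed auto
  have "(\<lambda>z. \<bar>- \<alpha> * z powr (-\<alpha> - 1)\<bar> * ?g (z powr (-\<alpha>))) absolutely_integrable_on {0<..} \<and>
      integral {0<..} (\<lambda>z. \<bar>- \<alpha> * z powr (-\<alpha> - 1)\<bar> * ?g (z powr (-\<alpha>))) = \<alpha> * (LBINT z:{0<..}. ?F z)"
  proof -
    have eq: "\<bar>- \<alpha> * z powr (-\<alpha> - 1)\<bar> * ?g (z powr (-\<alpha>)) = \<alpha> * ?F z" if "z \<in> {0<..}" for z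
    proof -
      have "(z powr (-\<alpha>)) powr (-1/\<alpha>) = z" using that \<alpha> by (simp add: powr_powr)
      moreover have "z powr (-\<alpha> - 1) * z = z powr (-\<alpha>)"
        using that powr_mult_base[of z "-\<alpha> - 1"] by (simp add: mult.commute)
      ultimately have "\<bar>- \<alpha> * z powr (-\<alpha> - 1)\<bar> * ?g (z powr (-\<alpha>)) = \<alpha> * \<rho> z * z powr (-\<alpha>)"
        using \<alpha> by (simp add: abs_mult mult_ac)
      then show ?thesis by (simp add: powr_minus_divide)
    qed
    have i: "set_integrable lborel {0<..} (\<lambda>z. \<alpha> * ?F z)" using iF by (rule set_integrable_mult_right)
    have a: "(\<lambda>z. \<alpha> * ?F z) absolutely_integrable_on {0<..}"
      using i set_integrable_lborel_iff[of "{0<..}" "\<lambda>z. \<alpha> * ?F z"]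
      by (simp add: set_integrable_def set_borel_measurable_def)
    have "integral {0<..} (\<lambda>z. \<alpha> * ?F z) = (LBINT z:{0<..}. \<alpha> * ?F z)"
      using set_borel_integral_eq_integral(2)[OF i] by simp
    then have "integral {0<..} (\<lambda>z. \<alpha> * ?F z) = \<alpha> * (LBINT z:{0<..}. ?F z)"
      by (simp only: set_integral_mult_right)
    moreover have "(\<lambda>z. \<bar>- \<alpha> * z powr (-\<alpha> - 1)\<bar> * ?g (z powr (-\<alpha>))) absolutely_integrable_on {0<..}
        \<longleftrightarrow> (\<lambda>z. \<alpha> * ?F z) absolutely_integrable_on {0<..}"
      by (intro set_integrable_cong refl eq)
    moreover have "integral {0<..} (\<lambda>z. \<bar>- \<alpha> * z powr (-\<alpha> - 1)\<bar> * ?g (z powr (-\<alpha>))) = integral {0<..} (\<lambda>z. \<alpha> * ?F z)"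
      by (intro integral_cong eq)
    ultimately show ?thesis using a by presburger
  qed
  \<comment> \<open>The change of variables is read from the \<open>z\<close> side to the
    \<open>y\<close> side, so that it also delivers the integrability of \<open>?g\<close>.\<close>
  then have "?g absolutely_integrable_on ((\<lambda>z. z powr (-\<alpha>)) ` {0<..}) \<and>
      integral ((\<lambda>z. z powr (-\<alpha>)) ` {0<..}) ?g = \<alpha> * (LBINT z:{0<..}. ?F z)"
  proof (rule has_absolute_integral_change_of_variables_1'[THEN iffD1, rotated -1])
    show "((\<lambda>z. z powr (-\<alpha>)) has_real_derivative - \<alpha> * z powr (-\<alpha> - 1)) (at z within {0<..})"
      if "z \<in> {0<..}" for z
      using that by (auto intro!: derivative_eq_intros)
    show "inj_on (\<lambda>z. z powr (-\<alpha>)) {0<..}"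
    proof (rule inj_onI)
      fix x y :: real assume *: "x \<in> {0<..}" "y \<in> {0<..}" "x powr (-\<alpha>) = y powr (-\<alpha>)"
      have "x = (x powr (-\<alpha>)) powr (-1/\<alpha>)" using *(1) \<alpha> by (simp add: powr_powr)
      also have "\<dots> = (y powr (-\<alpha>)) powr (-1/\<alpha>)" unfolding *(3) ..
      also have "\<dots> = y" using *(2) \<alpha> by (simp add: powr_powr)
      finally show "x = y" .
    qed
  qed auto
  then have main: "?g absolutely_integrable_on {0<..} \<and> integral {0<..} ?g = \<alpha> * (LBINT z:{0<..}. ?F z)"
    unfolding img .
  then show ig: "set_integrable lborel {0<..} ?g"
    by (subst set_integrable_lborel_iff[OF mg]) simp
  show "(LBINT y:{0<..}. ?g y) = \<alpha> * (LBINT z:{0<..}. ?F z)"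
    using main set_borel_integral_eq_integral(2)[OF ig] by simp
qed

section \<open>The index scale \<open>n t\<close> of time \<open>t\<close>, and Potter bounds at
  integers\<close>

locale regular_scale =
  fixes R n :: "real \<Rightarrow> real" and \<alpha> x0 :: real
  assumes \<alpha>: "0 < \<alpha>" "\<alpha> < 1"
    and R_mono: "mono_on {x0..} R" and R_pos: "\<And>x. x \<ge> x0 \<Longrightarrow> R x > 0"
    and R_nat: "\<And>k. k \<ge> 1 \<Longrightarrow> R (real k) > 0"
    and R_rv: "\<And>h. h > 0 \<Longrightarrow> ((\<lambda>x. R (h * x) / R x) \<longlongrightarrow> h powr (1/\<alpha>)) at_top"
    and n_pos: "\<And>t. n t > 0" and n_lim: "filterlim n at_top at_top"
    and nR: "((\<lambda>t. R (n t) / t) \<longlongrightarrow> 1) at_top"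
begin

lemma index_gt: "1 / \<alpha> > 1" using \<alpha> by simp

lemma ceiling_ratio:
  assumes "y > 0"
  shows "((\<lambda>t. real (nat \<lceil>n t * y\<rceil> + i) / n t) \<longlongrightarrow> y) at_top"
proof -
  have inv: "((\<lambda>t. 1 / n t) \<longlongrightarrow> 0) at_top"
    using filterlim_compose[OF tendsto_inverse_0_at_top n_lim[THEN filterlim_at_top_imp_at_infinity]]
      tendsto_inverse_0_at_top[OF n_lim] by (simp add: inverse_eq_divide)
  have lo: "y \<le> real (nat \<lceil>n t * y\<rceil> + i) / n t" for t
  proof -
    have "n t * y \<le> real (nat \<lceil>n t * y\<rceil> + i)" by linarith
    then show ?thesis using n_pos[of t] by (simp add: field_simps)
  qed
  have hi: "real (nat \<lceil>n t * y\<rceil> + i) / n t \<le> y + real (Suc i) * (1 / n t)" for t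
  proof -
    have "n t * y > 0" using n_pos[of t] assms by simp
    then have "real (nat \<lceil>n t * y\<rceil> + i) \<le> n t * y + real (Suc i)" by linarith
    then have "real (nat \<lceil>n t * y\<rceil> + i) / n t \<le> (n t * y + real (Suc i)) / n t"
      using n_pos[of t] by (intro divide_right_mono) auto
    then show ?thesis using n_pos[of t] by (simp add: add_divide_distrib del: of_nat_add of_nat_Suc)
  qed
  show ?thesis
  proof (rule tendsto_sandwich[OF always_eventually[OF allI[OF lo]] always_eventually[OF allI[OF hi]] tendsto_const])
    show "((\<lambda>t. y + real (Suc i) * (1 / n t)) \<longlongrightarrow> y) at_top"
      using tendsto_add[OF tendsto_const[of y] tendsto_mult[OF tendsto_const[of "real (Suc i)"] inv]] by simp
  qed
qed

text \<open>The index and \<open>n t\<close> have ratio tending to \<open>y\<close>, so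
  \<open>mono_rv_ratio\<close> compares \<open>R\<close> at the two, and \<open>R (n t)\<close> is
  asymptotically \<open>t\<close>. The shift \<open>i\<close> disappears in the limit.\<close>

lemma R_ceiling:
  assumes "y > 0"
  shows "((\<lambda>t. R (real (nat \<lceil>n t * y\<rceil> + i)) / t) \<longlongrightarrow> y powr (1/\<alpha>)) at_top"
proof -
  have "((\<lambda>t. R (real (nat \<lceil>n t * y\<rceil> + i)) / R (n t) * (R (n t) / t)) \<longlongrightarrow> y powr (1/\<alpha>) * 1) at_top"
    using mono_rv_ratio[OF R_mono R_pos R_rv n_lim ceiling_ratio[OF assms] assms]
    by (intro tendsto_mult nR) auto
  then have "((\<lambda>t. R (real (nat \<lceil>n t * y\<rceil> + i)) / R (n t) * (R (n t) / t)) \<longlongrightarrow> y powr (1/\<alpha>)) at_top"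
    by (simp only: mult_1_right)
  then show ?thesis
  proof (rule Lim_transform_eventually)
    have "\<forall>\<^sub>F t in at_top. n t \<ge> x0" using n_lim by (simp add: filterlim_at_top)
    then show "\<forall>\<^sub>F t in at_top. R (real (nat \<lceil>n t * y\<rceil> + i)) / R (n t) * (R (n t) / t) = R (real (nat \<lceil>n t * y\<rceil> + i)) / t"
      by eventually_elim (use R_pos in force)
  qed
qed

text \<open>Potter's bounds hold above a threshold \<open>K\<close> only. The finitely many indices
  below \<open>K\<close> have values of \<open>R\<close> between two positive constants; comparing
  these with \<open>R K\<close> and then \<open>R K\<close> with \<open>R x\<close> extends the
  bounds to all \<open>k \<ge> 1\<close>.\<close>

lemma potter_nat:
  assumes \<eta>: "0 < \<eta>" "\<eta> < 1 / \<alpha>"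
  obtains C1 C2 K where "C1 > 0" "C2 > 0" "K > 0" "K \<ge> x0"
    "\<And>k x. k \<ge> 1 \<Longrightarrow> K \<le> x \<Longrightarrow> real k \<le> x \<Longrightarrow> C1 * (real k / x) powr (1/\<alpha> + \<eta>) \<le> R (real k) / R x"
    "\<And>k x. k \<ge> 1 \<Longrightarrow> K \<le> x \<Longrightarrow> real k \<le> x \<Longrightarrow> R (real k) / R x \<le> C2 * (real k / x) powr (1/\<alpha> - \<eta>)"
    "\<And>k x. K \<le> x \<Longrightarrow> x \<le> real k \<Longrightarrow> C1 * (real k / x) powr (1/\<alpha> - \<eta>) \<le> R (real k) / R x"
proof -
  define p q where "p = 1/\<alpha> - \<eta>" and "q = 1/\<alpha> + \<eta>"
  have pq: "p > 0" "q > 0" using \<eta> \<alpha> by (auto simp: p_def q_def intro: add_pos_pos)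
  obtain C K where CK: "C > 0" "K \<ge> x0" "K > 0"
    and lo: "\<And>x y. K \<le> y \<Longrightarrow> y \<le> x \<Longrightarrow> C * (x / y) powr p \<le> R x / R y"
    and hi: "\<And>x y. K \<le> y \<Longrightarrow> y \<le> x \<Longrightarrow> R x / R y \<le> (x / y) powr q / C"
    using potter[OF R_mono R_pos R_rv[of 2] \<eta>] unfolding p_def q_def by auto
  have RK: "R x > 0" if "x \<ge> K" for x using R_pos CK that by simp
  \<comment> \<open>The inserted 1 makes nonemptiness and the positivity of \<open>c2\<close>
    immediate.\<close>
  define c1 where "c1 = Min (insert 1 ((\<lambda>k. R (real k)) ` {1..nat \<lceil>K\<rceil>}))"
  define c2 where "c2 = Max (insert 1 ((\<lambda>k. R (real k)) ` {1..nat \<lceil>K\<rceil>}))"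
  have c1: "c1 > 0" unfolding c1_def using R_nat by (subst Min_gr_iff) auto
  have c2: "c2 > 0" unfolding c2_def by (subst Max_gr_iff) auto
  have c: "c1 \<le> R (real k)" "R (real k) \<le> c2" if "k \<ge> 1" "real k \<le> K" for k
  proof -
    have "k \<le> nat \<lceil>K\<rceil>" using that by linarith
    then show "c1 \<le> R (real k)" "R (real k) \<le> c2" unfolding c1_def c2_def
      using that by (auto intro!: Min_le Max_ge simp del: Min_insert Max_insert)
  qed
  \<comment> \<open>\<open>potter\<close> measures from the smaller argument. Measuring from the
    larger one means taking reciprocals, which exchanges the roles of \<open>p\<close> and
    \<open>q\<close>.\<close>
  have big_lo: "C * (y / x) powr q \<le> R y / R x" and big_hi: "R y / R x \<le> (y / x) powr p / C"
    if "K \<le> y" "y \<le> x" for x y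
  proof -
    have pos: "R x > 0" "R y > 0" "x > 0" "y > 0" using RK that CK by auto
    have "C * R x \<le> (x / y) powr q * R y" using hi[OF that] pos CK by (simp add: field_simps)
    then have "C * R x * (y / x) powr q \<le> ((x / y) powr q * R y) * (y / x) powr q"
      by (intro mult_right_mono) auto
    also have "\<dots> = R y * ((x / y) powr q * (y / x) powr q)" by (simp only: mult_ac)
    also have "(x / y) powr q * (y / x) powr q = 1"
      using pos by (subst powr_mult[symmetric]) auto
    finally show "C * (y / x) powr q \<le> R y / R x" using pos by (simp add: field_simps)
    have "C * (x / y) powr p * R y \<le> R x" using lo[OF that] pos CK by (simp add: field_simps)
    then have "(C * (x / y) powr p * R y) * (y / x) powr p \<le> R x * (y / x) powr p"
      by (intro mult_right_mono) auto
    moreover have "(C * (x / y) powr p * R y) * (y / x) powr p = C * R y * ((x / y) powr p * (y / x) powr p)"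
      by (simp only: mult_ac)
    moreover have "(x / y) powr p * (y / x) powr p = 1"
      using pos by (subst powr_mult[symmetric]) auto
    ultimately show "R y / R x \<le> (y / x) powr p / C" using pos CK by (simp add: field_simps)
  qed
  define C1 where "C1 = min C (C * c1 / R K)"
  define C2 where "C2 = max (1 / C) (c2 / R K * (K powr p / C))"
  have RK0: "R K > 0" using RK by simp
  have C1: "C1 > 0" "C1 \<le> C" "C1 \<le> C * c1 / R K" using CK c1 RK0 by (auto simp: C1_def)
  have C2: "C2 > 0" "1 / C \<le> C2" "c2 / R K * (K powr p / C) \<le> C2" using CK by (auto simp: C2_def less_max_iff_disj)
  show ?thesis
  proof (rule that[OF C1(1) C2(1) CK(3) CK(2)])
    fix k :: nat and x assume k: "k \<ge> 1" and x: "K \<le> x" and kx: "real k \<le> x"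
    have pos: "R x > 0" "x > 0" "real k > 0" using RK x CK k by auto
    show "C1 * (real k / x) powr (1/\<alpha> + \<eta>) \<le> R (real k) / R x"
      unfolding q_def[symmetric]
    proof (cases "K \<le> real k")
      case True
      have "C1 * (real k / x) powr q \<le> C * (real k / x) powr q" using C1 by (intro mult_right_mono) auto
      also have "\<dots> \<le> R (real k) / R x" by (rule big_lo[OF True kx])
      finally show "C1 * (real k / x) powr q \<le> R (real k) / R x" .
    next
      case False
      have "C1 * (real k / x) powr q \<le> (C * c1 / R K) * (K / x) powr q"
        using C1 False pos pq CK c1 RK0 by (intro mult_mono powr_mono2 divide_right_mono) auto
      also have "\<dots> = c1 / R K * (C * (K / x) powr q)" by simp
      also have "\<dots> \<le> c1 / R K * (R K / R x)"
        using big_lo[OF order_refl x] c1 RK0 by (intro mult_left_mono) auto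
      also have "\<dots> \<le> R (real k) / R x" using c(1)[OF k] False RK0 pos by (simp add: divide_right_mono)
      finally show "C1 * (real k / x) powr q \<le> R (real k) / R x" .
    qed
    show "R (real k) / R x \<le> C2 * (real k / x) powr (1/\<alpha> - \<eta>)"
      unfolding p_def[symmetric]
    proof (cases "K \<le> real k")
      case True
      have "R (real k) / R x \<le> 1 / C * (real k / x) powr p" using big_hi[OF True kx] by simp
      also have "\<dots> \<le> C2 * (real k / x) powr p" using C2 by (intro mult_right_mono) auto
      finally show "R (real k) / R x \<le> C2 * (real k / x) powr p" .
    next
      case False
      have "R (real k) / R x \<le> c2 / R K * (R K / R x)" using c(2)[OF k] False RK0 pos by (simp add: divide_right_mono)
      also have "\<dots> \<le> c2 / R K * ((K / x) powr p / C)"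
        using big_hi[OF order_refl x] c2 RK0 by (intro mult_left_mono) auto
      \<comment> \<open>Here \<open>k \<ge> 1\<close> allows \<open>K\<close> to be enlarged to
        \<open>K * k\<close>, which turns a constant into a bound that scales with
        \<open>k / x\<close>.\<close>
      also have "\<dots> \<le> c2 / R K * ((K * (real k / x)) powr p / C)"
        using c2 RK0 CK k pos pq by (intro mult_left_mono divide_right_mono powr_mono2) (auto simp: field_simps)
      also have "\<dots> = (c2 / R K * (K powr p / C)) * (real k / x) powr p"
        using CK pos by (subst powr_mult) auto
      also have "\<dots> \<le> C2 * (real k / x) powr p" using C2 by (intro mult_right_mono) auto
      finally show "R (real k) / R x \<le> C2 * (real k / x) powr p" .
    qed
  next
    fix k :: nat and x assume x: "K \<le> x" and kx: "x \<le> real k"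
    have "C1 * (real k / x) powr p \<le> C * (real k / x) powr p" using C1 by (intro mult_right_mono) auto
    also have "\<dots> \<le> R (real k) / R x" by (rule lo[OF x kx])
    finally show "C1 * (real k / x) powr (1/\<alpha> - \<eta>) \<le> R (real k) / R x" by (simp add: p_def)
  qed
qed

text \<open>For \<kappa> = \<open>k / n t \<le> 1\<close> the ratio of the values of
  \<open>R\<close> behaves like the power \<open>1/\<alpha>\<close> of \<kappa> up to an arbitrarily
  small change of exponent. The left side is thus nearly the power
  \<open>-(\<beta>2 + \<beta>3/\<alpha>)\<close> of \<kappa>, and the strict hypothesis keeps the
  final exponent \<open>-q\<close> integrable at 0.\<close>

lemma small_index_bound:
  assumes \<beta>: "\<beta>2 + \<beta>3 / \<alpha> < 1"
  shows "\<exists>C q. 0 \<le> C \<and> 0 \<le> q \<and> q < 1 \<and> (\<forall>\<^sub>F t in at_top. \<forall>k\<ge>1. real k \<le> n t \<longrightarrow>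
    (real k / n t) powr (-\<beta>2) * (R (real k) / R (n t)) powr (-\<beta>3) \<le> C * (real k / n t) powr (-q))"
proof -
  define d where "d = 1 - (\<beta>2 + \<beta>3 / \<alpha>)"
  have d: "d > 0" using \<beta> by (simp add: d_def)
  define w where "w = \<bar>\<beta>3\<bar> + 1"
  have w: "w > 0" "\<bar>\<beta>3\<bar> \<le> w" by (auto simp: w_def)
  \<comment> \<open>Since \<open>w\<close> exceeds the modulus of \<open>\<beta>3\<close>, the loss
    \<open>\<eta> * \<bar>\<beta>3\<bar>\<close> uses at most half of the margin \<open>d\<close>.
    The minimum in \<open>\<eta>\<close> keeps it below \<open>1 / \<alpha>\<close>, as Potter's
    bounds require.\<close>
  define e where "e = d / (2 * w)"
  define \<eta> where "\<eta> = min (1 / (2 * \<alpha>)) e"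
  have e: "e > 0" "e * w = d / 2" using d w by (auto simp: e_def)
  have \<eta>: "0 < \<eta>" "\<eta> < 1 / \<alpha>" using \<alpha> e by (auto simp: \<eta>_def min_less_iff_disj field_simps)
  have "\<eta> * \<bar>\<beta>3\<bar> \<le> e * w"
    using e w by (intro mult_mono) (auto simp: \<eta>_def)
  then have "\<eta> * \<bar>\<beta>3\<bar> \<le> d / 2" unfolding e(2) .
  then have small: "\<beta>2 + \<beta>3 / \<alpha> + \<eta> * \<bar>\<beta>3\<bar> < 1" using d by (simp add: d_def)
  obtain C1 C2 K where C: "C1 > 0" "C2 > 0" "K > 0" "K \<ge> x0"
    and lo: "\<And>k x. k \<ge> 1 \<Longrightarrow> K \<le> x \<Longrightarrow> real k \<le> x \<Longrightarrow> C1 * (real k / x) powr (1/\<alpha> + \<eta>) \<le> R (real k) / R x"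
    and hi: "\<And>k x. k \<ge> 1 \<Longrightarrow> K \<le> x \<Longrightarrow> real k \<le> x \<Longrightarrow> R (real k) / R x \<le> C2 * (real k / x) powr (1/\<alpha> - \<eta>)"
    using potter_nat[OF \<eta>] by metis
  define b where "b = \<beta>3 / \<alpha> + \<eta> * \<bar>\<beta>3\<bar>"
  \<comment> \<open>The majorant has to be antitone, hence the exponent is cut off at 0; as \<kappa>
    is at most 1, enlarging \<open>q\<close> only weakens the bound. The modulus in \<open>b\<close>
    covers both signs of \<open>\<beta>3\<close>.\<close>
  define q where "q = max 0 (\<beta>2 + b)"
  define Cq where "Cq = C1 powr (-\<beta>3) + C2 powr (-\<beta>3)"
  have Kn: "\<forall>\<^sub>F t in at_top. n t \<ge> K" using n_lim by (simp add: filterlim_at_top)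
  have main: "(real k / x) powr (-\<beta>2) * (R (real k) / R x) powr (-\<beta>3) \<le> Cq * (real k / x) powr (-q)"
    if k: "k \<ge> 1" and x: "K \<le> x" and kx: "real k \<le> x" for k x
  proof -
    define \<kappa> where "\<kappa> = real k / x"
    have \<kappa>: "\<kappa> > 0" "\<kappa> \<le> 1" using k kx C x by (auto simp: \<kappa>_def)
    have r0: "R (real k) / R x > 0" using R_nat[OF k] R_pos C x by auto
    \<comment> \<open>The sign of \<open>\<beta>3\<close> decides whether the lower or the upper
      Potter bound controls the power \<open>-\<beta>3\<close>.\<close>
    have "(R (real k) / R x) powr (-\<beta>3) \<le> Cq * \<kappa> powr (-b)"
    proof (cases "\<beta>3 \<ge> 0")
      case True
      have "(R (real k) / R x) powr (-\<beta>3) \<le> (C1 * \<kappa> powr (1/\<alpha> + \<eta>)) powr (-\<beta>3)"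
        using lo[OF k x kx, folded \<kappa>_def] True C \<kappa> by (intro powr_mono2') auto
      also have "\<dots> = C1 powr (-\<beta>3) * \<kappa> powr (-b)"
        using C \<kappa> True by (simp add: powr_mult powr_powr b_def algebra_simps)
      also have "\<dots> \<le> Cq * \<kappa> powr (-b)" by (intro mult_right_mono) (auto simp: Cq_def)
      finally show ?thesis .
    next
      case False
      have "(R (real k) / R x) powr (-\<beta>3) \<le> (C2 * \<kappa> powr (1/\<alpha> - \<eta>)) powr (-\<beta>3)"
        using hi[OF k x kx, folded \<kappa>_def] False r0 by (intro powr_mono2) auto
      also have "\<dots> = C2 powr (-\<beta>3) * \<kappa> powr (-b)"
        using C \<kappa> False by (simp add: powr_mult powr_powr b_def algebra_simps)
      also have "\<dots> \<le> Cq * \<kappa> powr (-b)" by (intro mult_right_mono) (auto simp: Cq_def)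
      finally show ?thesis .
    qed
    then have "\<kappa> powr (-\<beta>2) * (R (real k) / R x) powr (-\<beta>3) \<le> \<kappa> powr (-\<beta>2) * (Cq * \<kappa> powr (-b))"
      by (intro mult_left_mono) auto
    also have "\<dots> = Cq * \<kappa> powr (-(\<beta>2 + b))" by (simp add: powr_add[symmetric])
    also have "\<dots> \<le> Cq * \<kappa> powr (-q)"
      using \<kappa> by (intro mult_left_mono powr_mono') (auto simp: q_def Cq_def)
    finally show ?thesis by (simp add: \<kappa>_def)
  qed
  show ?thesis
  proof (intro exI conjI)
    show "0 \<le> Cq" by (auto simp: Cq_def)
    show "0 \<le> q" "q < 1" using small by (auto simp: q_def b_def)
    show "\<forall>\<^sub>F t in at_top. \<forall>k\<ge>1. real k \<le> n t \<longrightarrow>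
      (real k / n t) powr (-\<beta>2) * (R (real k) / R (n t)) powr (-\<beta>3) \<le> Cq * (real k / n t) powr (-q)"
      using Kn by eventually_elim (auto intro: main)
  qed
qed

text \<open>As \<open>1 / \<alpha> > 1\<close>, the Potter exponent can be taken halfway between 1
  and \<open>1 / \<alpha>\<close>; the bound is then integrable at infinity. The estimate
  \<open>t \<le> 2 * R k\<close> places these indices in the range of the local limit
  theorem.\<close>

lemma large_index_bound:
  obtains C p where "C \<ge> 0" "p > 1"
    "\<forall>\<^sub>F t in at_top. \<forall>k. n t \<le> real k \<longrightarrow> t \<le> 2 * R (real k) \<and> t / R (real k) \<le> C * (real k / n t) powr (-p)"
proof -
  define \<eta> where "\<eta> = (1/\<alpha> - 1) / 2"
  have "0 < \<eta>" "\<eta> < 1/\<alpha>" using index_gt by (auto simp: \<eta>_def)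
  then obtain C1 K where C: "C1 > 0" "K > 0" "K \<ge> x0"
    and lo: "\<And>k x. K \<le> x \<Longrightarrow> x \<le> real k \<Longrightarrow> C1 * (real k / x) powr (1/\<alpha> - \<eta>) \<le> R (real k) / R x"
    using potter_nat by metis
  define p where "p = 1/\<alpha> - \<eta>"
  have p: "p > 1" using index_gt by (simp add: p_def \<eta>_def field_simps)
  have Kn: "\<forall>\<^sub>F t in at_top. n t \<ge> K" using n_lim by (simp add: filterlim_at_top)
  have half: "\<forall>\<^sub>F t in at_top. R (n t) / t > 1 / 2" using nR by (rule order_tendstoD) simp
  have "\<forall>\<^sub>F t in at_top. \<forall>k. n t \<le> real k \<longrightarrow> t \<le> 2 * R (real k) \<and> t / R (real k) \<le> 2 / C1 * (real k / n t) powr (-p)"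
    using Kn half eventually_gt_at_top[of 0]
  proof eventually_elim
    case (elim t)
    show ?case
    proof (intro allI impI conjI)
      fix k assume k: "n t \<le> real k"
      have Rn: "R (n t) > 0" using R_pos elim C by auto
      have t: "t < 2 * R (n t)" using elim by (simp add: field_simps)
      have "R (n t) \<le> R (real k)" using k elim C by (intro mono_onD[OF R_mono]) auto
      with t show "t \<le> 2 * R (real k)" by linarith
      have Rk: "R (real k) > 0" using \<open>R (n t) \<le> R (real k)\<close> Rn by linarith
      define \<kappa> where "\<kappa> = real k / n t"
      have \<kappa>: "\<kappa> > 0" using k n_pos[of t] by (auto simp: \<kappa>_def)
      have "C1 * \<kappa> powr p \<le> R (real k) / R (n t)" using lo[OF elim(1) k] by (simp add: \<kappa>_def p_def)
      then have "C1 * \<kappa> powr p * R (n t) \<le> R (real k)" using Rn by (simp add: field_simps)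
      then have "t / R (real k) \<le> t / (C1 * \<kappa> powr p * R (n t))"
        using elim C \<kappa> Rn Rk by (intro divide_left_mono mult_pos_pos) auto
      also have "\<dots> \<le> (2 * R (n t)) / (C1 * \<kappa> powr p * R (n t))"
        using t C \<kappa> Rn by (intro divide_right_mono) auto
      also have "\<dots> = 2 / C1 * \<kappa> powr (-p)" using Rn by (simp add: powr_minus_divide)
      finally show "t / R (real k) \<le> 2 / C1 * (real k / n t) powr (-p)" by (simp add: \<kappa>_def)
    qed
  qed
  then show ?thesis using p C by (intro that[of "2 / C1" p]) auto
qed

end

text \<open>Both powers equal 1 at \<open>y = 1\<close>, so \<open>D\<close> remains antitone across
  the joint. For \<open>x \<ge> 1\<close> the last expression is \<open>C * x powr (q - 1)\<close>,
  and \<open>q < 1\<close> sends it to 0; this is what makes the first terms of a renewal sum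
  negligible.\<close>

lemma power_majorant:
  fixes p q C :: real
  assumes q: "0 \<le> q" "q < 1" and p: "p > 1" and C: "C \<ge> 0"
  defines "D \<equiv> \<lambda>y. C * (if y \<le> 1 then y powr (-q) else y powr (-p))"
  shows "set_integrable lborel {0<..} D" "antimono_on {0<..} D" "\<And>y. D y \<ge> 0"
    "((\<lambda>x. D (1 / x) / x) \<longlongrightarrow> 0) at_top"
proof -
  have "set_integrable lborel {0<..1} D \<longleftrightarrow> set_integrable lborel {0<..1} (\<lambda>y. C * y powr (-q))"
    by (intro set_integrable_cong) (auto simp: D_def)
  then have i1: "set_integrable lborel {0<..1} D"
    using set_integrable_powr_from_0[of "-q"] q by simp
  have "set_integrable lborel {1<..} D \<longleftrightarrow> set_integrable lborel {1<..} (\<lambda>y. C * y powr (-p))"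
    by (intro set_integrable_cong) (auto simp: D_def)
  moreover have "set_integrable lborel {1<..} (\<lambda>y. y powr (-p))"
    using set_integrable_powr_to_inf[of "-p"] p by (rule_tac set_integrable_subset) auto
  ultimately have i2: "set_integrable lborel {1<..} D" by simp
  have "{0<..1} \<union> {1<..} = {0::real<..}" by auto
  with set_integrable_Un[OF i1 i2] show "set_integrable lborel {0<..} D" by simp
  show "antimono_on {0<..} D"
  proof (rule monotone_onI)
    fix x y :: real assume xy: "x \<in> {0<..}" "y \<in> {0<..}" "x \<le> y"
    have "(if y \<le> 1 then y powr (-q) else y powr (-p)) \<le> (if x \<le> 1 then x powr (-q) else x powr (-p))"
    proof -
      consider "y \<le> 1" | "x \<le> 1" "1 < y" | "1 < x" by linarith
      then show ?thesis
      proof cases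
        case 1
        then show ?thesis using xy q by (auto intro!: powr_mono2')
      next
        case 2
        have "y powr (-p) \<le> 1 powr (-p)" using 2 p by (intro powr_mono2') auto
        also have "\<dots> \<le> x powr (-q)" using powr_mono2'[of "-q" x 1] xy 2 q by auto
        finally show ?thesis using 2 by auto
      next
        case 3
        then show ?thesis using xy p by (auto intro!: powr_mono2')
      qed
    qed
    then show "D y \<le> D x" unfolding D_def by (intro mult_left_mono C)
  qed
  show "D y \<ge> 0" for y using C by (auto simp: D_def)
  have "((\<lambda>x. C * x powr (q - 1)) \<longlongrightarrow> C * 0) at_top"
    using q by (intro tendsto_mult tendsto_const tendsto_neg_powr filterlim_ident) auto
  then have "((\<lambda>x. C * x powr (q - 1)) \<longlongrightarrow> 0) at_top" by simp
  then show "((\<lambda>x. D (1 / x) / x) \<longlongrightarrow> 0) at_top"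
  proof (rule Lim_transform_eventually)
    show "\<forall>\<^sub>F x in at_top. C * x powr (q - 1) = D (1 / x) / x"
      using eventually_ge_at_top[of 1]
    proof eventually_elim
      case (elim x)
      then have "(1 / x) powr (-q) = x powr q"
        by (simp add: powr_divide powr_minus_divide)
      moreover have "x powr (q - 1) = x powr q / x" using elim by (simp add: powr_diff)
      ultimately show ?case using elim by (simp add: D_def)
    qed
  qed
qed

section \<open>The renewal theorem with an oscillating factor\<close>

context regular_scale
begin

text \<open>The local limit hypothesis enters twice: with a fixed error it bounds the terms with
  \<open>k > n t\<close>, where \<open>small\<close> says nothing, and with an arbitrary error it
  gives the limit at each fixed \<open>y > 0\<close>, where \<open>t / R k\<close> tends to
  \<open>y powr (-1/\<alpha>)\<close>.\<close>

lemma renewal: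
  fixes P H :: "nat \<Rightarrow> real \<Rightarrow> real" and \<rho> :: "real \<Rightarrow> real" and c0 Hb :: real
    and J :: "nat set" and C \<beta>2 \<beta>3 :: "nat \<Rightarrow> real"
  assumes P: "\<And>k t. P k t \<ge> 0"
    and \<rho>: "continuous_on {0..} \<rho>" "bounded (\<rho> ` {0..})" "\<And>z. z \<ge> 0 \<Longrightarrow> \<rho> z \<ge> 0" "set_integrable lborel {0..} \<rho>"
    and H: "\<And>k t. \<bar>H k t\<bar> \<le> Hb"
    and llt: "\<And>\<epsilon> \<delta>. \<epsilon> > 0 \<Longrightarrow> \<delta> > 0 \<Longrightarrow> \<exists>K t1. \<forall>k\<ge>K. \<forall>t\<ge>t1. t \<le> R (real k) / \<epsilon> \<longrightarrow>
        \<bar>R (real k) * P k t - \<rho> (t / R (real k)) * H k t\<bar> \<le> \<delta>"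
    and avg: "\<And>\<delta>. \<delta> > 0 \<Longrightarrow> \<exists>N\<ge>1. \<forall>k t. \<bar>(\<Sum>i<N. H (k + i) t) / real N - c0\<bar> \<le> \<delta>"
    and J: "finite J" "\<And>j. j \<in> J \<Longrightarrow> C j \<ge> 0" "\<And>j. j \<in> J \<Longrightarrow> \<beta>2 j + \<beta>3 j / \<alpha> < 1"
    and small: "\<forall>\<^sub>F t in at_top. \<forall>k\<ge>1. real k \<le> n t \<longrightarrow>
      t * P k t \<le> (\<Sum>j\<in>J. C j * ((real k / n t) powr (-\<beta>2 j) * (R (real k) / R (n t)) powr (-\<beta>3 j)))"
  shows "\<forall>\<^sub>F t in at_top. summable (\<lambda>k. P (Suc k) t)"
    and "((\<lambda>t. t / n t * (\<Sum>k. P (Suc k) t)) \<longlongrightarrow> c0 * (\<alpha> * (LBINT z:{0<..}. \<rho> z / z powr \<alpha>))) at_top"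
proof -
  define g where "g y = \<rho> (y powr (-1/\<alpha>)) * y powr (-1/\<alpha>)" for y
  have g: "set_integrable lborel {0<..} g" "(LBINT y:{0<..}. g y) = \<alpha> * (LBINT z:{0<..}. \<rho> z / z powr \<alpha>)"
    using density_substitution[OF \<alpha> \<rho>(1,2,4)] by (simp_all add: g_def[abs_def])
  have g0: "g y \<ge> 0" for y using \<rho>(3) by (simp add: g_def)
  obtain \<rho>b where \<rho>b: "\<And>z. z \<ge> 0 \<Longrightarrow> \<bar>\<rho> z\<bar> \<le> \<rho>b"
    using \<rho>(2) by (auto simp: bounded_iff)
  have \<rho>b0: "\<rho>b \<ge> 0" using \<rho>b[of 0] by auto
  have Hb0: "Hb \<ge> 0" using H[of 0 0] by auto

  define small_ok where "small_ok j B q \<longleftrightarrow> 0 \<le> B \<and> 0 \<le> q \<and> q < 1 \<and> (\<forall>\<^sub>F t in at_top. \<forall>k\<ge>1. real k \<le> n t \<longrightarrow>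
    (real k / n t) powr (-\<beta>2 j) * (R (real k) / R (n t)) powr (-\<beta>3 j) \<le> B * (real k / n t) powr (-q))" for j B q
  have "\<forall>j\<in>J. \<exists>B q. small_ok j B q"
    unfolding small_ok_def using small_index_bound J(3) by blast
  then obtain B qq where "\<And>j. j \<in> J \<Longrightarrow> small_ok j (B j) (qq j)"
    by metis
  then have Bq: "\<And>j. j \<in> J \<Longrightarrow> 0 \<le> B j" "\<And>j. j \<in> J \<Longrightarrow> 0 \<le> qq j" "\<And>j. j \<in> J \<Longrightarrow> qq j < 1"
    and Bqe: "\<And>j. j \<in> J \<Longrightarrow> (\<forall>\<^sub>F t in at_top. \<forall>k\<ge>1. real k \<le> n t \<longrightarrow>
    (real k / n t) powr (-\<beta>2 j) * (R (real k) / R (n t)) powr (-\<beta>3 j) \<le> B j * (real k / n t) powr (-qq j))"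
    unfolding small_ok_def by blast+
  \<comment> \<open>The largest of the finitely many exponents dominates all terms, because
    \<open>k / n t \<le> 1\<close> in this range.\<close>
  define q where "q = Max (insert 0 (qq ` J))"
  have q: "0 \<le> q" "q < 1" "\<And>j. j \<in> J \<Longrightarrow> qq j \<le> q"
    unfolding q_def using J(1) Bq(3) by (auto simp del: Max_insert)
  have Bqe': "\<forall>\<^sub>F t in at_top. \<forall>j\<in>J. \<forall>k\<ge>1. real k \<le> n t \<longrightarrow>
    (real k / n t) powr (-\<beta>2 j) * (R (real k) / R (n t)) powr (-\<beta>3 j) \<le> B j * (real k / n t) powr (-qq j)"
    using J(1) Bqe by (intro eventually_ball_finite) auto
  obtain CL p where L: "CL \<ge> 0" "p > 1"
    and Le: "\<forall>\<^sub>F t in at_top. \<forall>k. n t \<le> real k \<longrightarrow> t \<le> 2 * R (real k) \<and> t / R (real k) \<le> CL * (real k / n t) powr (-p)"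
    using large_index_bound .
  \<comment> \<open>The choice of one half for \<epsilon> covers \<open>t \<le> 2 * R k\<close>, the
    range supplied by \<open>large_index_bound\<close>. For a majorant the error 1 is good
    enough.\<close>
  obtain K t1 where Kt: "\<And>k t. k \<ge> K \<Longrightarrow> t \<ge> t1 \<Longrightarrow> t \<le> R (real k) / (1/2) \<Longrightarrow>
        \<bar>R (real k) * P k t - \<rho> (t / R (real k)) * H k t\<bar> \<le> 1"
    using llt[of "1/2" 1] by auto
  define CC where "CC = (\<Sum>j\<in>J. C j * B j) + (\<rho>b * Hb + 1) * CL"
  have CS: "(\<Sum>j\<in>J. C j * B j) \<ge> 0" using J(2) Bq(1) by (intro sum_nonneg mult_nonneg_nonneg) auto
  have CT: "(\<rho>b * Hb + 1) * CL \<ge> 0" using L \<rho>b0 Hb0 by (intro mult_nonneg_nonneg) auto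
  have CC: "CC \<ge> 0" using CS CT by (simp add: CC_def)
  define D where "D y = CC * (if y \<le> 1 then y powr (-q) else y powr (-p))" for y
  have Dp: "set_integrable lborel {0<..} D" "antimono_on {0<..} D" "\<And>y. D y \<ge> 0"
    "((\<lambda>x. D (1 / x) / x) \<longlongrightarrow> 0) at_top"
    using power_majorant[OF q(1,2) L(2) CC] by (simp_all add: D_def[abs_def])
  have nK: "\<forall>\<^sub>F t in at_top. n t \<ge> max 1 (real K)" using n_lim unfolding filterlim_at_top by blast
  have dom: "\<forall>\<^sub>F t in at_top. \<forall>k\<ge>1. t * P k t \<le> D (real k / n t)"
    using Bqe' Le small nK eventually_ge_at_top[of "max 1 t1"]
  proof eventually_elim
    case (elim t)
    show ?case
    proof (intro allI impI)
      fix k :: nat assume k: "k \<ge> 1"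
      show "t * P k t \<le> D (real k / n t)"
      proof (cases "real k \<le> n t")
        case True
        define \<kappa> where "\<kappa> = real k / n t"
        have \<kappa>: "\<kappa> > 0" "\<kappa> \<le> 1" using True k n_pos[of t] by (auto simp: \<kappa>_def)
        have "t * P k t \<le> (\<Sum>j\<in>J. C j * (\<kappa> powr (-\<beta>2 j) * (R (real k) / R (n t)) powr (-\<beta>3 j)))"
          using elim(3) k True by (auto simp: \<kappa>_def)
        also have "\<dots> \<le> (\<Sum>j\<in>J. C j * B j * \<kappa> powr (-q))"
        proof (intro sum_mono)
          fix j assume j: "j \<in> J"
          have "\<kappa> powr (-\<beta>2 j) * (R (real k) / R (n t)) powr (-\<beta>3 j) \<le> B j * \<kappa> powr (-qq j)"
            using elim(1) j k True by (auto simp: \<kappa>_def)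
          also have "\<dots> \<le> B j * \<kappa> powr (-q)"
            using \<kappa> q(3)[OF j] Bq(1)[OF j] by (intro mult_left_mono powr_mono') auto
          finally have "C j * (\<kappa> powr (-\<beta>2 j) * (R (real k) / R (n t)) powr (-\<beta>3 j)) \<le> C j * (B j * \<kappa> powr (-q))"
            using J(2)[OF j] by (intro mult_left_mono)
          then show "C j * (\<kappa> powr (-\<beta>2 j) * (R (real k) / R (n t)) powr (-\<beta>3 j)) \<le> C j * B j * \<kappa> powr (-q)"
            by (simp only: mult.assoc)
        qed
        also have "\<dots> = (\<Sum>j\<in>J. C j * B j) * \<kappa> powr (-q)" by (simp add: sum_distrib_right)
        also have "\<dots> \<le> CC * \<kappa> powr (-q)" using CT by (intro mult_right_mono) (auto simp: CC_def)
        finally show ?thesis using \<kappa> by (simp add: D_def \<kappa>_def)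
      next
        case False
        then have kn: "n t \<le> real k" "real k / n t > 1" using n_pos[of t] by auto
        have Rk: "R (real k) > 0" by (rule R_nat[OF k])
        have le: "t \<le> 2 * R (real k)" "t / R (real k) \<le> CL * (real k / n t) powr (-p)"
          using elim(2) kn(1) by auto
        have kK: "k \<ge> K" using elim(4) kn(1) by linarith
        have "\<bar>R (real k) * P k t - \<rho> (t / R (real k)) * H k t\<bar> \<le> 1"
          using Kt[OF kK, of t] le(1) elim(5) by simp
        moreover have "\<bar>\<rho> (t / R (real k)) * H k t\<bar> \<le> \<rho>b * Hb"
          unfolding abs_mult using H \<rho>b[of "t / R (real k)"] elim(5) Rk \<rho>b0 by (intro mult_mono) auto
        ultimately have RP: "R (real k) * P k t \<le> \<rho>b * Hb + 1" by linarith
        have "t * P k t = t / R (real k) * (R (real k) * P k t)" using Rk by simp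
        also have "\<dots> \<le> (CL * (real k / n t) powr (-p)) * (\<rho>b * Hb + 1)"
          using le(2) RP L(1) P Rk by (intro mult_mono mult_nonneg_nonneg) auto
        also have "\<dots> = ((\<rho>b * Hb + 1) * CL) * (real k / n t) powr (-p)" by (simp only: mult_ac)
        also have "\<dots> \<le> CC * (real k / n t) powr (-p)" using CS by (intro mult_right_mono) (auto simp: CC_def)
        finally show ?thesis using kn by (simp add: D_def)
      qed
    qed
  qed
  have lim: "\<exists>N\<ge>1. \<forall>y>0. \<forall>\<eta>>0. \<forall>\<^sub>F t in at_top.
      \<bar>(\<Sum>i<N. t * P (nat \<lceil>n t * y\<rceil> + i) t) / real N - g y * c0\<bar> \<le> \<delta> * g y + \<eta>" if \<delta>: "\<delta> > 0" for \<delta>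
  proof -
    obtain N where N: "N \<ge> 1" and NH: "\<And>k t. \<bar>(\<Sum>i<N. H (k + i) t) / real N - c0\<bar> \<le> \<delta>"
      using avg[OF \<delta>] by blast
    show ?thesis
    proof (rule exI[of _ N], intro conjI N allI impI)
      fix y \<eta> :: real assume y: "y > 0" and \<eta>: "\<eta> > 0"
      define k where "k t = nat \<lceil>n t * y\<rceil>" for t
      define z where "z = y powr (-1/\<alpha>)"
      have z: "z > 0" using y by (simp add: z_def)
      define a where "a i t = t / R (real (k t + i))" for i t
      have a: "((\<lambda>t. a i t) \<longlongrightarrow> z) at_top" for i
      proof -
        have "((\<lambda>t. inverse (R (real (k t + i)) / t)) \<longlongrightarrow> inverse (y powr (1/\<alpha>))) at_top"
          unfolding k_def using y by (intro tendsto_inverse R_ceiling) auto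
        then show ?thesis by (simp add: a_def z_def powr_minus)
      qed
      have kinf: "\<forall>\<^sub>F t in at_top. k t + i \<ge> K'" for i K'
      proof -
        have "\<forall>\<^sub>F t in at_top. n t \<ge> real K' / y" using n_lim unfolding filterlim_at_top by blast
        then show ?thesis
        proof eventually_elim
          case (elim t)
          then have "real K' \<le> n t * y" using y by (simp add: field_simps)
          then show ?case unfolding k_def by linarith
        qed
      qed
      \<comment> \<open>With \<open>a i t = t / R (k t + i)\<close> the difference splits into
        \<open>a i t\<close> times the local limit error, and
        \<open>(\<rho> (a i t) * a i t - g y)\<close> times the bounded \<open>H\<close>. The second
        part vanishes by continuity of \<open>\<rho>\<close> at the limit \<open>z > 0\<close> of
        \<open>a i t\<close>.\<close>
      have err: "((\<lambda>t. t * P (k t + i) t - g y * H (k t + i) t) \<longlongrightarrow> 0) at_top" for i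
      proof -
        have "((\<lambda>t. \<rho> (a i t) * a i t - g y) \<longlongrightarrow> 0) at_top"
        proof -
          have "isCont \<rho> z"
            using continuous_on_interior[OF \<rho>(1)] z by simp
          then have "((\<lambda>t. \<rho> (a i t) * a i t) \<longlongrightarrow> \<rho> z * z) at_top"
            by (intro tendsto_mult a isCont_tendsto_compose[OF _ a])
          then show ?thesis using LIM_zero by (simp add: g_def z_def)
        qed
        then have e1: "((\<lambda>t. (\<rho> (a i t) * a i t - g y) * H (k t + i) t) \<longlongrightarrow> 0) at_top"
          by (rule lim_null_mult_right_bounded[where B = Hb]) (use H in auto)
        have "((\<lambda>t. R (real (k t + i)) * P (k t + i) t - \<rho> (a i t) * H (k t + i) t) \<longlongrightarrow> 0) at_top"
        proof (rule tendstoI)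
          fix e :: real assume e: "e > 0"
          \<comment> \<open>Eventually \<open>a i t < 2 * z\<close>, which is the range of the local
            limit hypothesis for this \<epsilon>.\<close>
          obtain K' t' where K': "\<And>k t. k \<ge> K' \<Longrightarrow> t \<ge> t' \<Longrightarrow> t \<le> R (real k) / (1 / (2 * z)) \<Longrightarrow>
              \<bar>R (real k) * P k t - \<rho> (t / R (real k)) * H k t\<bar> \<le> e / 2"
            using llt[of "1 / (2 * z)" "e / 2"] e z by auto
          have "\<forall>\<^sub>F t in at_top. a i t < 2 * z" using a z by (intro order_tendstoD) auto
          then show "\<forall>\<^sub>F t in at_top. dist (R (real (k t + i)) * P (k t + i) t - \<rho> (a i t) * H (k t + i) t) 0 < e"
            using kinf[of "max 1 K'" i] eventually_ge_at_top[of t']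
          proof eventually_elim
            case (elim t)
            have Rk: "R (real (k t + i)) > 0" using elim by (intro R_nat) auto
            have "t \<le> R (real (k t + i)) / (1 / (2 * z))"
              using elim(1) Rk by (simp add: a_def pos_divide_less_eq mult_ac del: of_nat_add)
            then have "\<bar>R (real (k t + i)) * P (k t + i) t - \<rho> (a i t) * H (k t + i) t\<bar> \<le> e / 2"
              unfolding a_def using elim by (intro K') auto
            then show ?case using e by (simp add: dist_real_def)
          qed
        qed
        then have e2: "((\<lambda>t. a i t * (R (real (k t + i)) * P (k t + i) t - \<rho> (a i t) * H (k t + i) t)) \<longlongrightarrow> z * 0) at_top"
          by (intro tendsto_mult a)
        have "((\<lambda>t. a i t * (R (real (k t + i)) * P (k t + i) t - \<rho> (a i t) * H (k t + i) t)
            + (\<rho> (a i t) * a i t - g y) * H (k t + i) t) \<longlongrightarrow> 0) at_top"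
          using tendsto_add[OF e2 e1] by simp
        then show ?thesis
        proof (rule Lim_transform_eventually)
          show "\<forall>\<^sub>F t in at_top. a i t * (R (real (k t + i)) * P (k t + i) t - \<rho> (a i t) * H (k t + i) t)
            + (\<rho> (a i t) * a i t - g y) * H (k t + i) t = t * P (k t + i) t - g y * H (k t + i) t"
            using kinf[of 1 i]
          proof eventually_elim
            case (elim t)
            have "R (real (k t + i)) > 0" using elim by (intro R_nat) auto
            then have "a i t * R (real (k t + i)) = t" by (simp add: a_def)
            then have "a i t * (R (real (k t + i)) * P (k t + i) t) = t * P (k t + i) t" by (simp only: mult.assoc[symmetric])
            then show ?case by (simp add: algebra_simps)
          qed
        qed
      qed
      have "((\<lambda>t. (\<Sum>i<N. t * P (k t + i) t - g y * H (k t + i) t) / real N) \<longlongrightarrow> (\<Sum>i<N. 0) / real N) at_top"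
        using N by (intro tendsto_divide tendsto_sum err tendsto_const) auto
      then have "((\<lambda>t. (\<Sum>i<N. t * P (k t + i) t - g y * H (k t + i) t) / real N) \<longlongrightarrow> 0) at_top" by simp
      then have "\<forall>\<^sub>F t in at_top. dist ((\<Sum>i<N. t * P (k t + i) t - g y * H (k t + i) t) / real N) 0 < \<eta>"
        using \<eta> by (rule tendstoD)
      then show "\<forall>\<^sub>F t in at_top. \<bar>(\<Sum>i<N. t * P (nat \<lceil>n t * y\<rceil> + i) t) / real N - g y * c0\<bar> \<le> \<delta> * g y + \<eta>"
        unfolding k_def[symmetric]
      proof eventually_elim
        case (elim t)
        have "(\<Sum>i<N. t * P (k t + i) t - g y * H (k t + i) t) / real N
          = (\<Sum>i<N. t * P (k t + i) t) / real N - g y * ((\<Sum>i<N. H (k t + i) t) / real N)"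
          by (simp add: sum_subtractf sum_distrib_left diff_divide_distrib)
        moreover have "\<bar>g y * ((\<Sum>i<N. H (k t + i) t) / real N) - g y * c0\<bar> \<le> g y * \<delta>"
        proof -
          have "\<bar>g y * ((\<Sum>i<N. H (k t + i) t) / real N - c0)\<bar> \<le> g y * \<delta>"
            unfolding abs_mult using mult_left_mono[OF NH[of "k t" t] g0[of y]] g0[of y] by simp
          then show ?thesis by (simp only: right_diff_distrib)
        qed
        ultimately show ?case using elim by (simp add: dist_real_def mult.commute)
      qed
    qed
  qed
  note rl = renewal_limit[OF P n_pos n_lim Dp(1,2) Dp(3) Dp(4) dom g(1) g0 lim]
  show "\<forall>\<^sub>F t in at_top. summable (\<lambda>k. P (Suc k) t)" by (rule rl(1))
  show "((\<lambda>t. t / n t * (\<Sum>k. P (Suc k) t)) \<longlongrightarrow> c0 * (\<alpha> * (LBINT z:{0<..}. \<rho> z / z powr \<alpha>))) at_top"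
    using rl(2) unfolding g(2) .
qed

end

subsection \<open>Passages of the suspension flow\<close>

text \<open>The length of \<open>{s. a1 \<le> s \<le> a2 \<and> b1 \<le> s - y \<le> b2}\<close>.\<close>

definition overlap :: "real \<Rightarrow> real \<Rightarrow> real \<Rightarrow> real \<Rightarrow> real \<Rightarrow> real" where
  "overlap a1 a2 b1 b2 y = max 0 (min a2 (y + b2) - max a1 (y + b1))"

lemma overlap_meas[measurable]: "overlap a1 a2 b1 b2 \<in> borel_measurable borel"
  unfolding overlap_def[abs_def] by measurable

lemma overlap_nonneg: "0 \<le> overlap a1 a2 b1 b2 y"
  by (simp add: overlap_def)

text \<open>Projected boxes and their preimages under the flow need not be product measurable, but
  they agree almost everywhere with product measurable sets. In the completion this is
  enough.\<close>

lemma completion_AE_eq: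
  assumes W: "W \<in> sets N" and X: "X \<subseteq> space N" and eq: "AE p in N. p \<in> X \<longleftrightarrow> p \<in> W"
  shows "X \<in> sets (completion N)" "emeasure (completion N) X = emeasure N W"
proof -
  obtain Z where Z: "Z \<in> null_sets N" "{p \<in> space N. \<not> (p \<in> X \<longleftrightarrow> p \<in> W)} \<subseteq> Z"
    using eq by (auto simp: eventually_ae_filter)
  have "X = (W - Z) \<union> (X \<inter> Z)"
    using Z(2) X sets.sets_into_space[OF W] by auto
  moreover have XZ: "X \<inter> Z \<in> null_sets (completion N)"
    using Z(1) null_sets_completion_subset[of "X \<inter> Z" Z N] null_sets_completionI by auto
  ultimately show sX: "X \<in> sets (completion N)" using W Z(1) by (metis null_setsD2 sets.Diff sets.Un sets_completionI_sets)
  have "emeasure (completion N) X = emeasure (completion N) W"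
    using eq W by (intro emeasure_eq_AE sX) (auto simp: AE_completion)
  then show "emeasure (completion N) X = emeasure N W" using W by simp
qed

locale suspension = prob_space M for M :: "'a measure" +
  fixes f :: "'a \<Rightarrow> 'a" and \<tau> :: "'a \<Rightarrow> real"
  assumes preserving: "measure_preserving_map M f"
    and \<tau>_meas[measurable]: "\<tau> \<in> borel_measurable M"
    and \<tau>_pos: "\<And>x. x \<in> space M \<Longrightarrow> \<tau> x > 0"
begin

abbreviation S :: "nat \<Rightarrow> 'a \<Rightarrow> real" where "S \<equiv> birkhoff_sum f \<tau>"

lemma f_meas[measurable]: "f \<in> M \<rightarrow>\<^sub>M M"
  and f_distr: "distr M M f = M"
  using preserving by (auto simp: measure_preserving_map_def)

lemma iter_meas[measurable]: "f ^^ k \<in> M \<rightarrow>\<^sub>M M"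
  by (induction k) (auto simp: id_def)

lemma iter_space: "x \<in> space M \<Longrightarrow> (f ^^ k) x \<in> space M"
  using measurable_space[OF iter_meas] .

lemma iter_distr: "distr M M (f ^^ k) = M"
proof (induction k)
  case 0
  then show ?case by (simp add: id_def)
next
  case (Suc k)
  have "distr M M (f ^^ Suc k) = distr (distr M M (f ^^ k)) M f"
    by (subst distr_distr) (auto simp: comp_def)
  then show ?case by (simp only: Suc f_distr)
qed

lemma S_meas[measurable]: "S k \<in> borel_measurable M"
  unfolding birkhoff_sum_def[abs_def]
  by (intro borel_measurable_sum measurable_compose[OF iter_meas \<tau>_meas])

lemma S_0[simp]: "S 0 x = 0" and S_Suc: "S (Suc k) x = S k x + \<tau> ((f ^^ k) x)"
  by (simp_all add: birkhoff_sum_def)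

lemma S_shift: "S (Suc k) x = \<tau> x + S k (f x)"
  unfolding birkhoff_sum_def by (subst sum.lessThan_Suc_shift) (simp add: funpow_swap1)

lemma S_less: "x \<in> space M \<Longrightarrow> S k x < S (Suc k) x"
  using \<tau>_pos[OF iter_space, of x k] by (simp add: S_Suc)

lemma S_mono: "x \<in> space M \<Longrightarrow> j \<le> k \<Longrightarrow> S j x \<le> S k x"
  by (rule lift_Suc_mono_le[of "\<lambda>k. S k x"]) (use S_less in \<open>auto intro: less_imp_le\<close>)

text \<open>On the invariant set where the Birkhoff sums stay bounded, \<open>\<tau> \<circ> f\<^sup>i\<close> tends to \<open>0\<close>, although
  the integral of \<open>min (\<tau> \<circ> f\<^sup>i) 1\<close> over that set does not depend on \<open>i\<close>.\<close>

lemma AE_S_unbounded: "AE x in M. \<forall>u. \<exists>k. u < S (Suc k) x"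
proof -
  define D where "D = {x \<in> space M. \<exists>N::nat. \<forall>k. S k x \<le> real N}"
  have D[measurable]: "D \<in> sets M" unfolding D_def by measurable
  have Df: "f x \<in> D \<longleftrightarrow> x \<in> D" if x: "x \<in> space M" for x
  proof
    assume "f x \<in> D"
    then obtain N :: nat where N: "\<And>k. S k (f x) \<le> real N" by (auto simp: D_def)
    have "S k x \<le> real (N + nat \<lceil>\<tau> x\<rceil>)" for k
    proof (cases k)
      case (Suc j)
      have "\<tau> x \<le> real (nat \<lceil>\<tau> x\<rceil>)" by linarith
      then show ?thesis using N[of j] by (simp add: Suc S_shift)
    qed simp
    then show "x \<in> D" using x unfolding D_def by blast
  next
    assume "x \<in> D"
    then obtain N :: nat where N: "\<And>k. S k x \<le> real N" by (auto simp: D_def)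
    have "S k (f x) \<le> real N" for k
      using N[of "Suc k"] \<tau>_pos[OF x] by (simp add: S_shift)
    then show "f x \<in> D" using measurable_space[OF f_meas x] by (auto simp: D_def)
  qed
  have Dfi: "(f ^^ i) x \<in> D \<longleftrightarrow> x \<in> D" if x: "x \<in> space M" for x i
    by (induction i) (use Df iter_space[OF x] in auto)
  \<comment> \<open>Truncation at 1 gives an integrable function even when \<tau> has infinite
    mean.\<close>
  define g where "g x = min (\<tau> x) 1 * indicator D x" for x
  have g_meas[measurable]: "g \<in> borel_measurable M" unfolding g_def by measurable
  have g_bnd: "0 \<le> g x \<and> g x \<le> 1" if "x \<in> space M" for x
    using \<tau>_pos[OF that] by (auto simp: g_def indicator_def)
  have g_norm: "norm (g x) \<le> 1" if "x \<in> space M" for x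
    using g_bnd[OF that] unfolding real_norm_def by linarith
  have int: "(\<integral>x. g ((f ^^ i) x) \<partial>M) = (\<integral>x. g x \<partial>M)" for i
    using integral_distr[OF iter_meas g_meas, of i] by (simp add: iter_distr)
  have "(\<lambda>i. \<integral>x. g ((f ^^ i) x) \<partial>M) \<longlonglongrightarrow> (\<integral>x. 0 \<partial>M)"
  proof (rule integral_dominated_convergence[where w = "\<lambda>_. 1"])
    show "(\<lambda>x. g ((f ^^ i) x)) \<in> borel_measurable M" for i by (rule measurable_compose[OF iter_meas g_meas])
    show "AE x in M. norm (g ((f ^^ i) x)) \<le> 1" for i
      using g_norm iter_space by (intro AE_I2) blast
    show "AE x in M. (\<lambda>i. g ((f ^^ i) x)) \<longlonglongrightarrow> 0"
    proof (rule AE_I2)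
      fix x assume x: "x \<in> space M"
      show "(\<lambda>i. g ((f ^^ i) x)) \<longlonglongrightarrow> 0"
      proof (cases "x \<in> D")
        case True
        then obtain N :: nat where N: "\<And>k. S k x \<le> real N" by (auto simp: D_def)
        have "summable (\<lambda>i. \<tau> ((f ^^ i) x))"
          using N \<tau>_pos iter_space[OF x] unfolding birkhoff_sum_def
          by (intro summableI_nonneg_bounded[where x = "real N"]) (auto intro: less_imp_le)
        then have z: "(\<lambda>i. \<tau> ((f ^^ i) x)) \<longlonglongrightarrow> 0" by (rule summable_LIMSEQ_zero)
        show ?thesis
        proof (rule tendsto_sandwich[OF _ _ tendsto_const z])
          show "\<forall>\<^sub>F i in sequentially. 0 \<le> g ((f ^^ i) x)"
            using g_bnd iter_space[OF x] by (intro always_eventually) auto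
          show "\<forall>\<^sub>F i in sequentially. g ((f ^^ i) x) \<le> \<tau> ((f ^^ i) x)"
            using \<tau>_pos[OF iter_space[OF x]] by (intro always_eventually) (auto simp: g_def indicator_def intro: less_imp_le)
        qed
      next
        case False
        then show ?thesis using Dfi[OF x] by (simp add: g_def)
      qed
    qed
  qed auto
  then have "(\<integral>x. g x \<partial>M) = 0" by (simp add: int LIMSEQ_const_iff)
  moreover have "integrable M g"
    using g_norm by (intro integrable_const_bound[where B = 1]) auto
  ultimately have "AE x in M. g x = 0"
    using g_bnd by (subst (asm) integral_nonneg_eq_0_iff_AE) auto
  then show ?thesis
    using AE_space
  proof eventually_elim
    case (elim x)
    then have "x \<notin> D" using \<tau>_pos[of x] by (auto simp: g_def indicator_def)
    show ?case
    proof
      fix u :: real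
      have "\<exists>k. \<not> S k x \<le> real (nat \<lceil>u\<rceil>)" using \<open>x \<notin> D\<close> elim(2) unfolding D_def by blast
      then obtain k where "S k x > u" by (meson dual_order.trans not_le real_nat_ceiling_ge)
      then show "\<exists>k. u < S (Suc k) x" using S_less[OF elim(2), of k] by (intro exI[of _ k]) linarith
    qed
  qed
qed

abbreviation "N0 \<equiv> M \<Otimes>\<^sub>M (lborel :: real measure)"

lemma level_null: "{p \<in> space N0. snd p + t = S k (fst p)} \<in> null_sets N0"
proof -
  have m: "{p \<in> space N0. snd p + t = S k (fst p)} \<in> sets N0" by measurable
  have "emeasure N0 {p \<in> space N0. snd p + t = S k (fst p)}
      = (\<integral>\<^sup>+x. emeasure lborel (Pair x -` {p \<in> space N0. snd p + t = S k (fst p)}) \<partial>M)"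
    by (rule lborel.emeasure_pair_measure_alt[OF m])
  also have "\<dots> = (\<integral>\<^sup>+x. 0 \<partial>M)"
  proof (rule nn_integral_cong)
    fix x assume "x \<in> space M"
    then have "Pair x -` {p \<in> space N0. snd p + t = S k (fst p)} = {S k x - t}"
      by (auto simp: space_pair_measure)
    then show "emeasure lborel (Pair x -` {p \<in> space N0. snd p + t = S k (fst p)}) = 0" by simp
  qed
  finally show ?thesis using m by auto
qed

text \<open>For these points neither the start nor the position after time \<open>t\<close> lies on
  a roof level, and the roof is crossed at arbitrarily late times. Hence neither the identification
  on the roof nor the \<open>LEAST\<close> in the flow is ambiguous.\<close>

lemma AE_generic:
  "AE p in N0. (\<forall>u. \<exists>k. u < S (Suc k) (fst p)) \<and> (\<forall>k. snd p \<noteq> S k (fst p) \<and> snd p + t \<noteq> S k (fst p))"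
proof -
  define E where "E = {x \<in> space M. \<not> (\<forall>N::nat. \<exists>k. real N < S (Suc k) x)}"
  have E: "E \<in> sets M" unfolding E_def by measurable
  have "AE x in M. x \<notin> E" using AE_S_unbounded by eventually_elim (auto simp: E_def)
  then have E0: "emeasure M E = 0" using E by (subst AE_iff_measurable[symmetric, of E M "\<lambda>x. x \<notin> E"]) (auto simp: E_def)
  have "E \<times> UNIV \<in> null_sets N0"
    using E E0 by (auto simp: lborel.emeasure_pair_measure_Times)
  then have 1: "AE p in N0. p \<notin> E \<times> UNIV" by (rule AE_not_in)
  have 2: "AE p in N0. \<forall>k. p \<notin> {p \<in> space N0. snd p + 0 = S k (fst p)}"
    using AE_not_in[OF level_null] by (subst AE_all_countable) blast
  have 3: "AE p in N0. \<forall>k. p \<notin> {p \<in> space N0. snd p + t = S k (fst p)}"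
    using AE_not_in[OF level_null] by (subst AE_all_countable) blast
  show ?thesis
    using 1 2 3 AE_space
  proof eventually_elim
    case (elim p)
    have "\<exists>k. u < S (Suc k) (fst p)" for u
    proof -
      have "fst p \<in> space M" using elim(4) by (auto simp: space_pair_measure)
      then have "\<exists>k. real (nat \<lceil>u\<rceil>) < S (Suc k) (fst p)" using elim(1) by (auto simp: E_def mem_Times_iff)
      then show ?thesis by (meson le_less_trans real_nat_ceiling_ge)
    qed
    then show ?case using elim by auto
  qed
qed

text \<open>\<open>susp_proj\<close> moves only points at height \<open>\<tau> x\<close>, and it
  moves them to height 0. Away from these two levels it acts as the identity, as seen from the
  source and from the image.\<close>

lemma proj_mem:
  assumes "A \<times> {a1..a2} \<subseteq> susp_region M \<tau>" "s \<noteq> 0" "s \<noteq> \<tau> x"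
  shows "(x, s) \<in> susp_proj f \<tau> ` (A \<times> {a1..a2}) \<longleftrightarrow> x \<in> A \<and> a1 \<le> s \<and> s \<le> a2"
proof
  assume "(x, s) \<in> susp_proj f \<tau> ` (A \<times> {a1..a2})"
  then show "x \<in> A \<and> a1 \<le> s \<and> s \<le> a2"
    using assms(2) by (auto simp: susp_proj_def split: if_splits)
next
  assume *: "x \<in> A \<and> a1 \<le> s \<and> s \<le> a2"
  then have "susp_proj f \<tau> (x, s) = (x, s)" using assms(3) by (simp add: susp_proj_def)
  moreover have "(x, s) \<in> A \<times> {a1..a2}" using * by auto
  ultimately show "(x, s) \<in> susp_proj f \<tau> ` (A \<times> {a1..a2})" by (metis imageI)
qed

text \<open>The crossing number selected by \<open>LEAST\<close> is the only \<open>k\<close> with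
  \<open>s + t\<close> strictly between \<open>S k x\<close> and \<open>S (Suc k) x\<close>. An
  index on the right side puts its point into the region under the roof, so it must be that
  \<open>k\<close>.\<close>

lemma flow_mem:
  assumes reg: "B \<times> {b1..b2} \<subseteq> susp_region M \<tau>"
    and x: "x \<in> space M" and s: "s \<ge> 0" and t: "t \<ge> 0"
    and unb: "\<And>u. \<exists>k. u < S (Suc k) x" and gen: "\<And>k. s + t \<noteq> S k x"
  shows "susp_flow f \<tau> t (x, s) \<in> susp_proj f \<tau> ` (B \<times> {b1..b2})
    \<longleftrightarrow> (\<exists>k. (f ^^ k) x \<in> B \<and> b1 \<le> s + t - S k x \<and> s + t - S k x \<le> b2)"
proof -
  define k where "k = (LEAST k. s + t < S (Suc k) x)"
  have k: "s + t < S (Suc k) x" unfolding k_def using unb by (rule LeastI_ex)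
  have k_le: "k \<le> j" if "s + t < S (Suc j) x" for j unfolding k_def using that by (rule Least_le)
  have lo: "S k x < s + t"
  proof (cases k)
    case 0
    then show ?thesis using s t gen[of 0] by simp
  next
    case (Suc j)
    then have "\<not> s + t < S (Suc j) x" using k_le[of j] by auto
    then show ?thesis using Suc gen[of k] by auto
  qed
  have fl: "susp_flow f \<tau> t (x, s) = ((f ^^ k) x, s + t - S k x)"
    by (simp add: susp_flow_def Let_def k_def)
  have pm: "((f ^^ k) x, s + t - S k x) \<in> susp_proj f \<tau> ` (B \<times> {b1..b2})
    \<longleftrightarrow> (f ^^ k) x \<in> B \<and> b1 \<le> s + t - S k x \<and> s + t - S k x \<le> b2"
    using lo k by (intro proj_mem[OF reg]) (auto simp: S_Suc)
  have uniq: "j = k" if j: "(f ^^ j) x \<in> B" "b1 \<le> s + t - S j x" "s + t - S j x \<le> b2" for j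
  proof -
    have "((f ^^ j) x, s + t - S j x) \<in> susp_region M \<tau>" using j reg by auto
    then have "S j x \<le> s + t" "s + t \<le> S (Suc j) x" by (auto simp: susp_region_def S_Suc)
    then have "S j x \<le> s + t" "s + t < S (Suc j) x" using gen[of "Suc j"] by auto
    then have "k \<le> j" using k_le by auto
    moreover have "\<not> k < j" using S_mono[OF x, of "Suc k" j] k \<open>S j x \<le> s + t\<close> by auto
    ultimately show ?thesis by simp
  qed
  show ?thesis unfolding fl pm using uniq by blast
qed

text \<open>No roof condition occurs: in the applications it follows from both boxes lying in
  \<open>susp_region M \<tau>\<close>.\<close>

definition passage :: "'a set \<Rightarrow> 'a set \<Rightarrow> real \<Rightarrow> real \<Rightarrow> real \<Rightarrow> real \<Rightarrow> nat \<Rightarrow> real \<Rightarrow> ('a \<times> real) set" where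
  "passage A B a1 a2 b1 b2 k t = {(x, s). x \<in> A \<and> a1 \<le> s \<and> s \<le> a2 \<and> (f ^^ k) x \<in> B
      \<and> b1 \<le> s + t - S k x \<and> s + t - S k x \<le> b2}"

text \<open>This is the \<open>P k t\<close> of the overview, with \<open>overlap\<close> as the
  trapezoidal \<open>G\<close>.\<close>

definition passage_weight :: "'a set \<Rightarrow> 'a set \<Rightarrow> real \<Rightarrow> real \<Rightarrow> real \<Rightarrow> real \<Rightarrow> nat \<Rightarrow> real \<Rightarrow> real" where
  "passage_weight A B a1 a2 b1 b2 k t =
     (\<integral>x. indicator A x * indicator B ((f ^^ k) x) * overlap a1 a2 b1 b2 (S k x - t) \<partial>M)"

lemma passage_sets:
  assumes [measurable]: "A \<in> sets M" "B \<in> sets M"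
  shows "passage A B a1 a2 b1 b2 k t \<in> sets N0"
proof -
  have "passage A B a1 a2 b1 b2 k t = {p \<in> space N0. fst p \<in> A \<and> a1 \<le> snd p \<and> snd p \<le> a2 \<and> (f ^^ k) (fst p) \<in> B
      \<and> b1 \<le> snd p + t - S k (fst p) \<and> snd p + t - S k (fst p) \<le> b2}"
    using sets.sets_into_space[OF assms(1)] by (auto simp: passage_def space_pair_measure)
  also have "\<dots> \<in> sets N0" by measurable
  finally show ?thesis .
qed

lemma passage_integrable:
  assumes [measurable]: "A \<in> sets M" "B \<in> sets M"
  shows "integrable M (\<lambda>x. indicator A x * indicator B ((f ^^ k) x) * overlap a1 a2 b1 b2 (S k x - t))"
proof (rule integrable_const_bound[where B = "max 0 (a2 - a1)"])
  have "0 \<le> overlap a1 a2 b1 b2 y \<and> overlap a1 a2 b1 b2 y \<le> max 0 (a2 - a1)" for y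
    by (auto simp: overlap_def)
  then show "AE x in M. norm (indicator A x * indicator B ((f ^^ k) x) * overlap a1 a2 b1 b2 (S k x - t)) \<le> max 0 (a2 - a1)"
    by (intro AE_I2) (auto simp: indicator_def)
qed measurable

text \<open>Over each base point the fibre is an interval or empty, and \<open>overlap\<close> is
  its length.\<close>

lemma emeasure_passage:
  assumes [measurable]: "A \<in> sets M" "B \<in> sets M"
  shows "emeasure N0 (passage A B a1 a2 b1 b2 k t) = ennreal (passage_weight A B a1 a2 b1 b2 k t)"
proof -
  have "emeasure N0 (passage A B a1 a2 b1 b2 k t) = (\<integral>\<^sup>+x. emeasure lborel (Pair x -` passage A B a1 a2 b1 b2 k t) \<partial>M)"
    by (rule lborel.emeasure_pair_measure_alt[OF passage_sets[OF assms]])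
  also have "\<dots> = (\<integral>\<^sup>+x. ennreal (indicator A x * indicator B ((f ^^ k) x) * overlap a1 a2 b1 b2 (S k x - t)) \<partial>M)"
  proof (rule nn_integral_cong)
    fix x
    show "emeasure lborel (Pair x -` passage A B a1 a2 b1 b2 k t)
      = ennreal (indicator A x * indicator B ((f ^^ k) x) * overlap a1 a2 b1 b2 (S k x - t))"
    proof (cases "x \<in> A \<and> (f ^^ k) x \<in> B")
      case True
      then have "Pair x -` passage A B a1 a2 b1 b2 k t = {max a1 (S k x - t + b1)..min a2 (S k x - t + b2)}"
        by (auto simp: passage_def)
      moreover have "emeasure lborel {l..u} = ennreal (max 0 (u - l))" for l u :: real
        by (cases "l \<le> u") (auto simp: max_def)
      ultimately show ?thesis using True by (simp add: overlap_def)
    next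
      case False
      then have "Pair x -` passage A B a1 a2 b1 b2 k t = {}" by (auto simp: passage_def)
      then show ?thesis using False by auto
    qed
  qed
  also have "\<dots> = ennreal (passage_weight A B a1 a2 b1 b2 k t)"
    unfolding passage_weight_def
    by (rule nn_integral_eq_integral[OF passage_integrable[OF assms]]) (auto simp: overlap_def)
  finally show ?thesis .
qed

lemma susp_space_sets: "susp_space M \<tau> \<in> sets N0"
proof -
  have "susp_space M \<tau> = {p \<in> space N0. 0 \<le> snd p \<and> snd p < \<tau> (fst p)}"
    by (auto simp: susp_space_def space_pair_measure)
  also have "\<dots> \<in> sets N0" by measurable
  finally show ?thesis .
qed

lemma measure_susp:
  assumes "X \<subseteq> susp_space M \<tau>"
  shows "measure (susp_measure M \<tau>) X = measure (completion N0) X"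
proof -
  have "susp_space M \<tau> \<inter> space (completion N0) = susp_space M \<tau>"
    using sets.sets_into_space[OF susp_space_sets] by auto
  then have "susp_space M \<tau> \<inter> space (completion N0) \<in> sets (completion N0)"
    using susp_space_sets by (simp only: sets_completionI_sets)
  then show ?thesis unfolding susp_measure_def using assms by (rule measure_restrict_space)
qed

lemma proj_subset:
  assumes "A \<times> {a1..a2} \<subseteq> susp_region M \<tau>"
  shows "susp_proj f \<tau> ` (A \<times> {a1..a2}) \<subseteq> susp_space M \<tau>"
proof -
  have "susp_proj f \<tau> ` susp_region M \<tau> = susp_space M \<tau>"
    by (intro susp_proj_image f_meas \<tau>_pos)
  then show ?thesis using image_mono[OF assms, of "susp_proj f \<tau>"] by simp
qed

lemma measure_susp_box:
  assumes A: "A \<in> sets M" and reg: "A \<times> {a1..a2} \<subseteq> susp_region M \<tau>" and a: "a1 \<le> a2"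
  shows "measure (susp_measure M \<tau>) (susp_proj f \<tau> ` (A \<times> {a1..a2})) = measure M A * (a2 - a1)"
proof -
  let ?X = "susp_proj f \<tau> ` (A \<times> {a1..a2})"
  have W: "A \<times> {a1..a2} \<in> sets N0" using A by auto
  have X: "?X \<subseteq> space N0"
    using proj_subset[OF reg] sets.sets_into_space[OF susp_space_sets] by blast
  have "AE p in N0. p \<in> ?X \<longleftrightarrow> p \<in> A \<times> {a1..a2}"
    using AE_generic[of 0]
  proof eventually_elim
    case (elim p)
    obtain x s where p: "p = (x, s)" by (cases p)
    have "s \<noteq> S k x" for k using elim p by auto
    from this[of 0] this[of 1] have "s \<noteq> 0" "s \<noteq> \<tau> x" by (auto simp: S_Suc)
    then show ?case unfolding p using proj_mem[OF reg] by auto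
  qed
  then have "emeasure (completion N0) ?X = emeasure N0 (A \<times> {a1..a2})"
    by (rule completion_AE_eq(2)[OF W X])
  also have "\<dots> = ennreal (measure M A * (a2 - a1))"
    using A a by (simp add: lborel.emeasure_pair_measure_Times emeasure_eq_measure ennreal_mult)
  finally show ?thesis
    using a by (simp add: measure_susp[OF proj_subset[OF reg]] measure_def[of "completion N0"])
qed

text \<open>Off a null set an orbit segment belongs to exactly one \<open>passage\<close>, the one
  indexed by its number of crossings. The sum is kept in \<open>ennreal\<close> because its
  convergence, for large \<open>t\<close>, only comes out of the renewal theorem.\<close>

lemma measure_susp_passage:
  assumes A: "A \<in> sets M" and B: "B \<in> sets M"
    and regA: "A \<times> {a1..a2} \<subseteq> susp_region M \<tau>" and regB: "B \<times> {b1..b2} \<subseteq> susp_region M \<tau>"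
    and t: "t \<ge> 0"
  shows "measure (susp_measure M \<tau>) (susp_proj f \<tau> ` (A \<times> {a1..a2}) \<inter> susp_preimage M f \<tau> t (susp_proj f \<tau> ` (B \<times> {b1..b2})))
    = enn2real (\<Sum>k. ennreal (passage_weight A B a1 a2 b1 b2 k t))"
proof -
  let ?A = "susp_proj f \<tau> ` (A \<times> {a1..a2})" and ?B = "susp_proj f \<tau> ` (B \<times> {b1..b2})"
  let ?X = "?A \<inter> susp_preimage M f \<tau> t ?B"
  let ?Z = "\<lambda>k. {p \<in> space N0. snd p + t = S k (fst p)}"
  \<comment> \<open>A point that lands on the roof could count for \<open>k\<close>, at height
    \<tau>, and for \<open>Suc k\<close>, at height 0. Removing this null level makes the sets
    disjoint.\<close>
  define W where "W k = passage A B a1 a2 b1 b2 k t - ?Z (Suc k)" for k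
  have W: "W k \<in> sets N0" for k
    unfolding W_def using level_null[of t "Suc k"] by (intro sets.Diff passage_sets A B) auto
  have X: "?X \<subseteq> susp_space M \<tau>" by (auto simp: susp_preimage_def)
  then have Xs: "?X \<subseteq> space N0" using sets.sets_into_space[OF susp_space_sets] by blast
  have disj: "disjoint_family W"
    unfolding disjoint_family_on_def
  proof (intro ballI impI)
    fix i j :: nat assume "i \<noteq> j"
    have False if p: "(x, s) \<in> W i" "(x, s) \<in> W j" and ij: "i < j" for x s i j
    proof -
      have xA: "x \<in> space M" using p sets.sets_into_space[OF A] by (auto simp: W_def passage_def)
      have "((f ^^ i) x, s + t - S i x) \<in> susp_region M \<tau>" "((f ^^ j) x, s + t - S j x) \<in> susp_region M \<tau>"
        using p regB by (auto simp: W_def passage_def)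
      then have "s + t \<le> S (Suc i) x" "S j x \<le> s + t" by (auto simp: susp_region_def S_Suc)
      moreover have "s + t \<noteq> S (Suc i) x" using p xA by (auto simp: W_def space_pair_measure)
      moreover have "S (Suc i) x \<le> S j x" using ij by (intro S_mono xA) auto
      ultimately show False by simp
    qed
    then show "W i \<inter> W j = {}" using \<open>i \<noteq> j\<close> by (metis disjoint_iff linorder_neqE_nat surj_pair)
  qed
  have "AE p in N0. p \<in> ?X \<longleftrightarrow> p \<in> (\<Union>k. W k)"
    using AE_generic[of t] AE_space
  proof eventually_elim
    case (elim p)
    obtain x s where p: "p = (x, s)" by (cases p)
    have x: "x \<in> space M" using elim(2) p by (auto simp: space_pair_measure)
    have gen: "\<And>k. s \<noteq> S k x" "\<And>k. s + t \<noteq> S k x" "\<And>u. \<exists>k. u < S (Suc k) x" using elim(1) p by auto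
    have s: "s \<noteq> 0" "s \<noteq> \<tau> x" using gen(1)[of 0] gen(1)[of 1] by (auto simp: S_Suc)
    have "p \<in> ?X \<longleftrightarrow> x \<in> A \<and> a1 \<le> s \<and> s \<le> a2 \<and> p \<in> susp_space M \<tau> \<and> susp_flow f \<tau> t (x, s) \<in> ?B"
      using proj_mem[OF regA s] by (auto simp: susp_preimage_def p)
    also have "\<dots> \<longleftrightarrow> x \<in> A \<and> a1 \<le> s \<and> s \<le> a2 \<and> susp_flow f \<tau> t (x, s) \<in> ?B"
    proof -
      have "p \<in> susp_space M \<tau>" if "x \<in> A" "a1 \<le> s" "s \<le> a2"
      proof -
        have "(x, s) \<in> susp_region M \<tau>" using that regA by auto
        then show ?thesis using s p by (auto simp: susp_region_def susp_space_def)
      qed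
      then show ?thesis by auto
    qed
    also have "\<dots> \<longleftrightarrow> x \<in> A \<and> a1 \<le> s \<and> s \<le> a2 \<and> (\<exists>k. (f ^^ k) x \<in> B \<and> b1 \<le> s + t - S k x \<and> s + t - S k x \<le> b2)"
    proof -
      have "s \<ge> 0" if "x \<in> A" "a1 \<le> s" "s \<le> a2"
      proof -
        have "(x, s) \<in> susp_region M \<tau>" using that regA by auto
        then show ?thesis by (auto simp: susp_region_def)
      qed
      then show ?thesis using flow_mem[OF regB x _ t gen(3) gen(2)] by auto
    qed
    also have "\<dots> \<longleftrightarrow> p \<in> (\<Union>k. W k)"
      using gen(2) by (auto simp: W_def passage_def p)
    finally show ?case .
  qed
  then have "emeasure (completion N0) ?X = emeasure N0 (\<Union>k. W k)"
    using W by (intro completion_AE_eq(2) Xs) auto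
  also have "\<dots> = (\<Sum>k. emeasure N0 (W k))"
    using W disj by (intro suminf_emeasure[symmetric]) auto
  also have "\<dots> = (\<Sum>k. ennreal (passage_weight A B a1 a2 b1 b2 k t))"
    unfolding W_def by (intro suminf_cong)
      (simp only: emeasure_Diff_null_set[OF level_null passage_sets[OF A B]] emeasure_passage[OF A B])
  finally show ?thesis by (simp add: measure_susp[OF X] measure_def[of "completion N0"])
qed

end

subsection \<open>The tail of the roof function\<close>

locale renewal_setting = suspension M f \<tau> for M :: "'a measure" and f :: "'a \<Rightarrow> 'a" and \<tau> :: "'a \<Rightarrow> real" +
  fixes L R :: "real \<Rightarrow> real" and \<alpha> :: real
  assumes \<alpha>: "0 < \<alpha>" "\<alpha> < 1" and L: "slowly_varying L"
    and tail: "(\<lambda>t. measure M {x\<in>space M. \<tau> x > t}) \<sim>[at_top] (\<lambda>t. L t / t powr \<alpha>)"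
    and R_reg: "regularly_varying (1 / \<alpha>) R" and R_ev_mono: "eventually_monotone R"
    and LR: "((\<lambda>t. t * L (R t) / R t powr \<alpha>) \<longlongrightarrow> 1) at_top"
begin

definition tail_prob :: "real \<Rightarrow> real" where "tail_prob t = measure M {x\<in>space M. \<tau> x > t}"

text \<open>Asymptotically \<open>n t\<close> is \<open>t powr \<alpha> / L t\<close>, the inverse of \<open>R\<close>, but \<open>n\<close> is monotone, so no
  uniform convergence theorem for the possibly nonmeasurable \<open>L\<close> is needed.\<close>

definition n :: "real \<Rightarrow> real" where "n t = 1 / tail_prob t"

lemma L_pos: "t > 0 \<Longrightarrow> L t > 0"
  and L_ratio: "h > 0 \<Longrightarrow> ((\<lambda>t. L (h * t) / L t) \<longlongrightarrow> 1) at_top"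
  using L by (auto simp: slowly_varying_def)

lemma tail_ratio: "((\<lambda>t. tail_prob t / (L t / t powr \<alpha>)) \<longlongrightarrow> 1) at_top"
  unfolding tail_prob_def
proof (rule asymp_equivD_strong[OF tail])
  show "\<forall>\<^sub>F t in at_top. measure M {x \<in> space M. t < \<tau> x} \<noteq> 0 \<or> L t / t powr \<alpha> \<noteq> 0"
    using eventually_gt_at_top[of 0] by eventually_elim (use L_pos in force)
qed

lemma tail_antimono: "s \<le> t \<Longrightarrow> tail_prob t \<le> tail_prob s"
  unfolding tail_prob_def by (intro finite_measure_mono) auto

text \<open>Being asymptotic to a positive function, the tail is positive far out, and then
  everywhere because it is antitone. So \<open>n\<close> is a genuine reciprocal at every
  \<open>t\<close>.\<close>

lemma tail_pos: "tail_prob t > 0"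
proof -
  have "\<forall>\<^sub>F t in at_top. tail_prob t / (L t / t powr \<alpha>) > 0"
    using tail_ratio by (rule order_tendstoD) simp
  then have "\<forall>\<^sub>F t in at_top. tail_prob t > 0"
    using eventually_gt_at_top[of 0]
  proof eventually_elim
    case (elim t)
    define w where "w = L t / t powr \<alpha>"
    have "w > 0" using L_pos[OF elim(2)] elim(2) by (simp add: w_def)
    with elim(1) show ?case unfolding w_def[symmetric] by (simp add: zero_less_divide_iff)
  qed
  then have "\<forall>\<^sub>F s in at_top. tail_prob s > 0 \<and> s \<ge> t"
    using eventually_ge_at_top[of t] by eventually_elim auto
  then obtain s where "tail_prob s > 0" "s \<ge> t" by (auto simp: eventually_at_top_linorder)
  then show ?thesis using tail_antimono[of t s] by linarith
qed

lemma tail_lim: "(tail_prob \<longlongrightarrow> 0) at_top"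
proof -
  interpret rd: real_distribution "distr M borel \<tau>" by (rule real_distribution_distr) simp
  have "tail_prob t = 1 - cdf (distr M borel \<tau>) t" for t
  proof -
    have "tail_prob t = prob (space M - (\<tau> -` {..t} \<inter> space M))"
      unfolding tail_prob_def by (intro arg_cong[of _ _ prob]) auto
    also have "\<dots> = 1 - prob (\<tau> -` {..t} \<inter> space M)" by (rule prob_compl) measurable
    also have "prob (\<tau> -` {..t} \<inter> space M) = cdf (distr M borel \<tau>) t"
      unfolding cdf_def by (subst measure_distr) auto
    finally show ?thesis .
  qed
  then have "tail_prob = (\<lambda>t. 1 - cdf (distr M borel \<tau>) t)" by auto
  moreover have "((\<lambda>t. 1 - cdf (distr M borel \<tau>) t) \<longlongrightarrow> 1 - 1) at_top"
    by (intro tendsto_diff tendsto_const rd.cdf_lim_at_top_prob)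
  ultimately show ?thesis by simp
qed

lemma n_pos: "n t > 0" using tail_pos by (simp add: n_def)

lemma n_mono: "s \<le> t \<Longrightarrow> n s \<le> n t"
  unfolding n_def using tail_antimono tail_pos by (intro divide_left_mono) auto

lemma n_lim: "filterlim n at_top at_top"
  unfolding n_def[abs_def] inverse_eq_divide[symmetric]
  using tail_lim tail_pos by (intro filterlim_inverse_at_top) auto

lemma n_L: "((\<lambda>t. n t * L t / t powr \<alpha>) \<longlongrightarrow> 1) at_top"
proof -
  have "((\<lambda>t. inverse (tail_prob t / (L t / t powr \<alpha>))) \<longlongrightarrow> inverse 1) at_top"
    by (intro tendsto_inverse tail_ratio) simp
  then show ?thesis by (simp add: n_def)
qed

lemma n_rv:
  assumes h: "h > 0"
  shows "((\<lambda>t. n (h * t) / n t) \<longlongrightarrow> h powr \<alpha>) at_top"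
proof -
  have ht: "filterlim (\<lambda>t. h * t) at_top at_top"
    using h by (intro filterlim_tendsto_pos_mult_at_top[OF tendsto_const] filterlim_ident)
  have "((\<lambda>t. (n (h * t) * L (h * t) / (h * t) powr \<alpha>) / (n t * L t / t powr \<alpha>) / (L (h * t) / L t) * h powr \<alpha>)
      \<longlongrightarrow> 1 / 1 / 1 * h powr \<alpha>) at_top"
    by (intro tendsto_intros filterlim_compose[OF n_L ht] n_L L_ratio h) auto
  then have "((\<lambda>t. (n (h * t) * L (h * t) / (h * t) powr \<alpha>) / (n t * L t / t powr \<alpha>) / (L (h * t) / L t) * h powr \<alpha>)
      \<longlongrightarrow> h powr \<alpha>) at_top" by simp
  then show ?thesis
  proof (rule Lim_transform_eventually)
    show "\<forall>\<^sub>F t in at_top. (n (h * t) * L (h * t) / (h * t) powr \<alpha>) / (n t * L t / t powr \<alpha>) / (L (h * t) / L t) * h powr \<alpha> = n (h * t) / n t"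
      using eventually_gt_at_top[of 0]
    proof eventually_elim
      case (elim t)
      have "L t > 0" "L (h * t) > 0" "n t > 0" using elim h L_pos n_pos by auto
      moreover have "(h * t) powr \<alpha> = h powr \<alpha> * t powr \<alpha>" using elim h by (simp add: powr_mult)
      moreover have "h powr \<alpha> > 0" "t powr \<alpha> > 0" using elim h by auto
      ultimately show ?case by (simp add: field_simps)
    qed
  qed
qed

lemma R_pos: "t > 0 \<Longrightarrow> R t > 0"
  using R_reg by (auto simp: regularly_varying_def slowly_varying_def)

lemma R_rv:
  assumes h: "h > 0"
  shows "((\<lambda>x. R (h * x) / R x) \<longlongrightarrow> h powr (1/\<alpha>)) at_top"
proof -
  obtain L' where L': "slowly_varying L'" "\<And>t. t > 0 \<Longrightarrow> R t = t powr (1/\<alpha>) * L' t"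
    using R_reg by (auto simp: regularly_varying_def)
  have "((\<lambda>x. h powr (1/\<alpha>) * (L' (h * x) / L' x)) \<longlongrightarrow> h powr (1/\<alpha>) * 1) at_top"
    using L'(1) h by (intro tendsto_intros) (auto simp: slowly_varying_def)
  then have "((\<lambda>x. h powr (1/\<alpha>) * (L' (h * x) / L' x)) \<longlongrightarrow> h powr (1/\<alpha>)) at_top" by simp
  then show ?thesis
  proof (rule Lim_transform_eventually)
    show "\<forall>\<^sub>F x in at_top. h powr (1/\<alpha>) * (L' (h * x) / L' x) = R (h * x) / R x"
      using eventually_gt_at_top[of 0]
      by eventually_elim (use h in \<open>simp add: L'(2) powr_mult\<close>)
  qed
qed

text \<open>An eventually decreasing \<open>R\<close> would contradict
  \<open>R (2 * x) / R x\<close> tending to \<open>2 powr (1/\<alpha>) > 1\<close>.\<close>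

lemma R_mono: "\<exists>x0>0. mono_on {x0..} R"
proof -
  obtain t0 where t0: "mono_on {t0..} R \<or> antimono_on {t0..} R"
    using R_ev_mono by (auto simp: eventually_monotone_def)
  have "\<not> antimono_on {t0..} R"
  proof
    assume am: "antimono_on {t0..} R"
    have "(2::real) powr (1/\<alpha>) > 2 powr 0" using \<alpha> by (intro powr_less_mono) auto
    then have "(2::real) powr (1/\<alpha>) > 1" by simp
    with R_rv[of 2] have "\<forall>\<^sub>F x in at_top. R (2 * x) / R x > 1" by (intro order_tendstoD) auto
    then have "\<forall>\<^sub>F x in at_top. R (2 * x) / R x > 1 \<and> x \<ge> max t0 1"
      using eventually_ge_at_top[of "max t0 1"] by eventually_elim auto
    then obtain x where x: "R (2 * x) / R x > 1" "x \<ge> max t0 1" by (auto simp: eventually_at_top_linorder)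
    have "R (2 * x) \<le> R x" using x by (intro monotone_onD[OF am]) auto
    then show False using x R_pos[of x] by (simp add: less_divide_eq)
  qed
  with t0 have "mono_on {t0..} R" by blast
  then have "mono_on {max t0 1..} R" by (rule monotone_on_subset) auto
  then show ?thesis by (intro exI[of _ "max t0 1"]) auto
qed

text \<open>Potter's lower bound with half of the index already tends to infinity.\<close>

lemma R_lim: "filterlim R at_top at_top"
proof -
  obtain x0 where x0: "x0 > 0" "mono_on {x0..} R" using R_mono by blast
  define p where "p = 1/\<alpha> - 1/(2*\<alpha>)"
  have p: "p > 0" using \<alpha> by (simp add: p_def field_simps)
  have \<eta>: "0 < 1/(2*\<alpha>)" "1/(2*\<alpha>) < 1/\<alpha>" using \<alpha> by (simp_all add: field_simps)
  obtain C K where CK: "C > 0" "K \<ge> x0" "K > 0"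
    and lo: "\<And>x y. K \<le> y \<Longrightarrow> y \<le> x \<Longrightarrow> C * (x / y) powr p \<le> R x / R y"
    using potter[OF x0(2) _ R_rv[of 2] \<eta>] R_pos x0(1) unfolding p_def
    by (metis less_le_trans zero_less_numeral)
  have "((\<lambda>x. x powr (-p)) \<longlongrightarrow> 0) at_top"
    using p by (intro tendsto_neg_powr filterlim_ident) auto
  then have "filterlim (\<lambda>x. inverse (x powr (-p))) at_top at_top"
    by (rule filterlim_inverse_at_top) (use eventually_gt_at_top[of 0] in \<open>eventually_elim, simp\<close>)
  then have pw: "filterlim (\<lambda>x. x powr p) at_top at_top" by (simp add: powr_minus)
  have "filterlim (\<lambda>x. (C * R K / K powr p) * x powr p) at_top at_top"
    using CK R_pos p by (intro filterlim_tendsto_pos_mult_at_top[OF tendsto_const] pw) auto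
  then show ?thesis
  proof (rule filterlim_at_top_mono)
    show "\<forall>\<^sub>F x in at_top. (C * R K / K powr p) * x powr p \<le> R x"
      using eventually_ge_at_top[of K]
    proof eventually_elim
      case (elim x)
      have "(x / K) powr p = x powr p / K powr p" using elim CK by (intro powr_divide)
      then show ?case using lo[OF order_refl elim] R_pos[OF CK(3)] by (simp add: field_simps)
    qed
  qed
qed

text \<open>Both \<open>n (R x)\<close> and \<open>x\<close> are asymptotic to
  \<open>R x powr \<alpha> / L (R x)\<close>, the first by \<open>n_L\<close> and the second by the
  defining relation of \<open>R\<close>.\<close>

lemma n_R: "((\<lambda>x. n (R x) / x) \<longlongrightarrow> 1) at_top"
proof -
  have "((\<lambda>x. (n (R x) * L (R x) / R x powr \<alpha>) / (x * L (R x) / R x powr \<alpha>)) \<longlongrightarrow> 1 / 1) at_top"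
    by (intro tendsto_divide LR filterlim_compose[OF n_L R_lim]) auto
  then have "((\<lambda>x. (n (R x) * L (R x) / R x powr \<alpha>) / (x * L (R x) / R x powr \<alpha>)) \<longlongrightarrow> 1) at_top" by simp
  then show ?thesis
  proof (rule Lim_transform_eventually)
    show "\<forall>\<^sub>F x in at_top. (n (R x) * L (R x) / R x powr \<alpha>) / (x * L (R x) / R x powr \<alpha>) = n (R x) / x"
      using eventually_gt_at_top[of 0]
    proof eventually_elim
      case (elim x)
      have "L (R x) > 0" "R x powr \<alpha> > 0" using R_pos[OF elim] L_pos by auto
      then show ?case by simp
    qed
  qed
qed

text \<open>Inverts \<open>n_R\<close> using only the monotonicity of \<open>n\<close>: if
  \<open>R (n t) \<le> l * t\<close> with \<open>l < 1\<close>, then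
  \<open>n (R (n t)) \<le> n (l * t)\<close>, which is about \<open>l powr \<alpha> * n t\<close>
  and so too small to be asymptotic to \<open>n t\<close>. The upper bound is symmetric.\<close>

lemma R_n: "((\<lambda>t. R (n t) / t) \<longlongrightarrow> 1) at_top"
proof -
  have nRn: "((\<lambda>t. n (R (n t)) / n t) \<longlongrightarrow> 1) at_top" by (rule filterlim_compose[OF n_R n_lim])
  show ?thesis
  proof (rule order_tendstoI)
    fix c :: real assume c: "c < 1"
    define l where "l = max c (1/2)"
    have l: "l > 0" "l < 1" "c \<le> l" using c by (auto simp: l_def)
    have la: "l powr \<alpha> < 1" using powr_less_mono2[of \<alpha> l 1] l \<alpha> by simp
    then obtain v where v: "l powr \<alpha> < v" "v < 1" using dense by blast
    have "\<forall>\<^sub>F t in at_top. n (l * t) / n t < v" using n_rv[OF l(1)] v(1) by (rule order_tendstoD)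
    moreover have "\<forall>\<^sub>F t in at_top. v < n (R (n t)) / n t" using nRn v(2) by (rule order_tendstoD)
    ultimately show "\<forall>\<^sub>F t in at_top. c < R (n t) / t"
      using eventually_gt_at_top[of 0]
    proof eventually_elim
      case (elim t)
      then have "n (l * t) / n t < n (R (n t)) / n t" by linarith
      then have "n (l * t) < n (R (n t))" using n_pos[of t] by (simp add: divide_less_cancel)
      then have "l * t < R (n t)" using n_mono[of "R (n t)" "l * t"] by linarith
      then have "l < R (n t) / t" using elim(3) by (simp add: less_divide_eq)
      then show ?case using l by linarith
    qed
  next
    fix c :: real assume c: "1 < c"
    have "1 powr \<alpha> < c powr \<alpha>" using c \<alpha> by (intro powr_less_mono2) auto
    then have "1 < c powr \<alpha>" by simp
    then obtain v where v: "1 < v" "v < c powr \<alpha>" using dense by blast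
    have "\<forall>\<^sub>F t in at_top. v < n (c * t) / n t" using n_rv[of c] v(2) c by (intro order_tendstoD(1)) auto
    moreover have "\<forall>\<^sub>F t in at_top. n (R (n t)) / n t < v" using nRn v(1) by (rule order_tendstoD)
    ultimately show "\<forall>\<^sub>F t in at_top. R (n t) / t < c"
      using eventually_gt_at_top[of 0]
    proof eventually_elim
      case (elim t)
      then have "n (R (n t)) / n t < n (c * t) / n t" by linarith
      then have "n (R (n t)) < n (c * t)" using n_pos[of t] by (simp add: divide_less_cancel)
      then have "R (n t) < c * t" using n_mono[of "c * t" "R (n t)"] by linarith
      then show ?case using elim(3) by (simp add: divide_less_eq)
    qed
  qed
qed

lemma scale: "\<exists>x0. regular_scale R n \<alpha> x0"
proof -
  obtain x0 where x0: "x0 > 0" "mono_on {x0..} R" using R_mono by blast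
  have "regular_scale R n \<alpha> x0"
    using \<alpha> x0 R_pos R_rv n_pos n_lim R_n by unfold_locales auto
  then show ?thesis by blast
qed

lemma shift_ratio: "((\<lambda>t. (t + d) / t) \<longlongrightarrow> (1::real)) at_top"
proof -
  have "((\<lambda>t. 1 + d / t) \<longlongrightarrow> 1 + 0) at_top"
    by (intro tendsto_add tendsto_const tendsto_divide_0[OF tendsto_const] filterlim_at_top_imp_at_infinity filterlim_ident)
  then have "((\<lambda>t. 1 + d / t) \<longlongrightarrow> 1) at_top" by simp
  then show ?thesis
    by (rule Lim_transform_eventually)
      (use eventually_gt_at_top[of 0] in \<open>eventually_elim, simp add: field_simps\<close>)
qed

text \<open>The condition \<open>\<beta>\<^sub>1 + \<beta>\<^sub>2 \<alpha> + \<beta>\<^sub>3 = 1\<close> makes each term of the small-time bound scale invariant.\<close>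

lemma bound_scale:
  assumes \<beta>: "\<beta>1 + \<beta>2 * \<alpha> + \<beta>3 = 1"
  shows "((\<lambda>t. t / (L (t + d) powr \<beta>2 * (t + d) powr \<beta>1 * n t powr \<beta>2 * R (n t) powr \<beta>3)) \<longlongrightarrow> 1) at_top"
proof -
  have td: "filterlim (\<lambda>t. t + d) at_top at_top"
    using filterlim_tendsto_add_at_top[OF tendsto_const[of d] filterlim_ident] by (simp add: add.commute)
  \<comment> \<open>Slow variation controls \<open>L\<close> along fixed multiples of the argument
    only. The shift by \<open>d\<close> is therefore carried over to the monotone \<open>n\<close>,
    to which \<open>mono_rv_ratio\<close> applies.\<close>
  have nn: "((\<lambda>t. n (t + d) / n t) \<longlongrightarrow> 1 powr \<alpha>) at_top"
    by (rule mono_rv_ratio[where ?x0.0 = 0])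
      (auto intro!: mono_onI n_mono n_pos n_rv filterlim_ident shift_ratio)
  have "((\<lambda>t. (n (t + d) * L (t + d) / (t + d) powr \<alpha>) * ((t + d) / t) powr \<alpha> / (n (t + d) / n t))
      \<longlongrightarrow> 1 * 1 powr \<alpha> / 1 powr \<alpha>) at_top"
    by (intro tendsto_divide tendsto_mult nn filterlim_compose[OF n_L td] tendsto_powr shift_ratio tendsto_const) auto
  then have "((\<lambda>t. (n (t + d) * L (t + d) / (t + d) powr \<alpha>) * ((t + d) / t) powr \<alpha> / (n (t + d) / n t))
      \<longlongrightarrow> 1) at_top" by simp
  then have Ln: "((\<lambda>t. L (t + d) * n t / t powr \<alpha>) \<longlongrightarrow> 1) at_top"
  proof (rule Lim_transform_eventually)
    show "\<forall>\<^sub>F t in at_top. (n (t + d) * L (t + d) / (t + d) powr \<alpha>) * ((t + d) / t) powr \<alpha> / (n (t + d) / n t)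
      = L (t + d) * n t / t powr \<alpha>"
      using eventually_gt_at_top[of "max 0 (-d)"]
    proof eventually_elim
      case (elim t)
      then have t: "t > 0" "t + d > 0" by auto
      have "((t + d) / t) powr \<alpha> = (t + d) powr \<alpha> / t powr \<alpha>" using t by (intro powr_divide)
      moreover have "(t + d) powr \<alpha> > 0" using t by simp
      moreover have "n (t + d) > 0" by (rule n_pos)
      ultimately show ?case by (simp add: field_simps)
    qed
  qed
  have "((\<lambda>t. (L (t + d) * n t / t powr \<alpha>) powr (-\<beta>2) * ((t + d) / t) powr (-\<beta>1) * (R (n t) / t) powr (-\<beta>3))
      \<longlongrightarrow> 1 powr (-\<beta>2) * 1 powr (-\<beta>1) * 1 powr (-\<beta>3)) at_top"
    by (intro tendsto_mult tendsto_powr Ln shift_ratio R_n tendsto_const) auto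
  then have "((\<lambda>t. (L (t + d) * n t / t powr \<alpha>) powr (-\<beta>2) * ((t + d) / t) powr (-\<beta>1) * (R (n t) / t) powr (-\<beta>3))
      \<longlongrightarrow> 1) at_top" by simp
  then show ?thesis
  proof (rule Lim_transform_eventually)
    show "\<forall>\<^sub>F t in at_top. (L (t + d) * n t / t powr \<alpha>) powr (-\<beta>2) * ((t + d) / t) powr (-\<beta>1) * (R (n t) / t) powr (-\<beta>3)
      = t / (L (t + d) powr \<beta>2 * (t + d) powr \<beta>1 * n t powr \<beta>2 * R (n t) powr \<beta>3)"
      using eventually_gt_at_top[of "max 0 (-d)"]
    proof eventually_elim
      case (elim t)
      then have t: "t > 0" "t + d > 0" by auto
      have pos: "L (t + d) > 0" "n t > 0" "R (n t) > 0" using L_pos[OF t(2)] n_pos R_pos[OF n_pos] by auto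
      have q: "(x / y) powr (-b) = y powr b / x powr b" if "x > 0" "y > 0" for x y b :: real
        using that by (simp add: powr_divide powr_minus field_simps)
      have "(L (t + d) * n t / t powr \<alpha>) powr (-\<beta>2) = t powr (\<alpha> * \<beta>2) / (L (t + d) powr \<beta>2 * n t powr \<beta>2)"
        using t pos by (subst q) (auto simp: powr_mult powr_powr)
      moreover have "((t + d) / t) powr (-\<beta>1) = t powr \<beta>1 / (t + d) powr \<beta>1"
        using t by (subst q) auto
      moreover have "(R (n t) / t) powr (-\<beta>3) = t powr \<beta>3 / R (n t) powr \<beta>3"
        using t pos by (subst q) auto
      moreover have "t powr (\<alpha> * \<beta>2) * t powr \<beta>1 * t powr \<beta>3 = t"
      proof -
        have "t powr (\<alpha> * \<beta>2) * t powr \<beta>1 * t powr \<beta>3 = t powr (\<alpha> * \<beta>2 + \<beta>1 + \<beta>3)" by (simp only: powr_add)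
        also have "\<alpha> * \<beta>2 + \<beta>1 + \<beta>3 = 1" using \<beta> by (simp add: mult.commute)
        finally show ?thesis using t by simp
      qed
      ultimately show ?case by (simp add: mult_ac)
    qed
  qed
qed

end

subsection \<open>Local limits of the passage weights\<close>

context renewal_setting
begin

lemma passage_weight_nonneg: "0 \<le> passage_weight A B a1 a2 b1 b2 k t"
  unfolding passage_weight_def by (intro integral_nonneg_AE AE_I2) (auto simp: overlap_nonneg)

text \<open>The overlap is at most \<open>a2 - a1\<close> and vanishes unless
  \<open>S k x - t\<close> lies between \<open>a1 - b2\<close> and \<open>a2 - b1\<close>.\<close>

lemma passage_weight_le:
  assumes A: "A \<in> sets M" and B: "B \<in> sets M" and a: "a1 \<le> a2" and l: "a2 - b1 \<le> a1 - b2 + l"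
  shows "passage_weight A B a1 a2 b1 b2 k t
    \<le> (a2 - a1) * measure M {x\<in>space M. S k x \<in> {t + (a1 - b2)..t + (a1 - b2) + l}}"
proof -
  let ?E = "{x\<in>space M. S k x \<in> {t + (a1 - b2)..t + (a1 - b2) + l}}"
  have E: "?E \<in> sets M" by measurable
  have "passage_weight A B a1 a2 b1 b2 k t \<le> (\<integral>x. (a2 - a1) * indicator ?E x \<partial>M)"
    unfolding passage_weight_def
  proof (rule integral_mono[OF passage_integrable[OF A B]])
    show "integrable M (\<lambda>x. (a2 - a1) * indicator ?E x)"
      using E by (intro integrable_mult_right) (simp add: emeasure_eq_measure)
    fix x assume x: "x \<in> space M"
    have "overlap a1 a2 b1 b2 (S k x - t) \<le> (a2 - a1) * indicator ?E x"
      using x a l by (auto simp: overlap_def indicator_def)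
    then show "indicator A x * indicator B ((f ^^ k) x) * overlap a1 a2 b1 b2 (S k x - t) \<le> (a2 - a1) * indicator ?E x"
      using a by (auto simp: indicator_def overlap_nonneg)
  qed
  also have "\<dots> = (a2 - a1) * measure M ?E"
    using E sets.sets_into_space[OF E] by (simp add: inf_absorb1)
  finally show ?thesis .
qed

text \<open>The assumed bound is used at the shifted time \<open>t + d\<close>. By
  \<open>bound_scale\<close> each of its terms, multiplied by \<open>t\<close>, is asymptotically
  the same expression in the ratios \<open>k / n t\<close> and \<open>R k / R (n t)\<close>
  alone.\<close>

lemma small_weights:
  fixes r :: nat and \<beta>1 \<beta>2 \<beta>3 :: "nat \<Rightarrow> real"
  assumes A: "A \<in> sets M" and B: "B \<in> sets M" and a: "a1 \<le> a2" and b: "b1 \<le> b2"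
    and \<beta>: "\<And>j. j \<in> {1..r} \<Longrightarrow> \<beta>1 j + \<beta>2 j * \<alpha> + \<beta>3 j = 1"
    and bound: "\<And>l. l > 0 \<Longrightarrow> \<exists>C t0. t0 > 0 \<and> (\<forall>k\<ge>1. \<forall>t\<ge>t0.
           measure M {x\<in>space M. S k x \<in> {t..t + l}}
             \<le> (\<Sum>j=1..r. C * l / (L t powr \<beta>2 j * t powr \<beta>1 j
                                    * real k powr \<beta>2 j * R (real k) powr \<beta>3 j)))"
  shows "\<exists>C\<ge>0. \<forall>\<^sub>F t in at_top. \<forall>k\<ge>1. t * passage_weight A B a1 a2 b1 b2 k t
     \<le> (\<Sum>j\<in>{1..r}. C * ((real k / n t) powr (-\<beta>2 j) * (R (real k) / R (n t)) powr (-\<beta>3 j)))"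
proof -
  \<comment> \<open>The summand 1 keeps the window length positive for degenerate boxes.\<close>
  define l where "l = (a2 - a1) + (b2 - b1) + 1"
  define d where "d = a1 - b2"
  have l: "l > 0" "a2 - b1 \<le> a1 - b2 + l" using a b by (auto simp: l_def)
  obtain C t0 where t0: "t0 > 0" and C: "\<And>k t. k \<ge> 1 \<Longrightarrow> t \<ge> t0 \<Longrightarrow>
           measure M {x\<in>space M. S k x \<in> {t..t + l}}
             \<le> (\<Sum>j=1..r. C * l / (L t powr \<beta>2 j * t powr \<beta>1 j
                                    * real k powr \<beta>2 j * R (real k) powr \<beta>3 j))"
    using bound[OF l(1)] by blast
  \<comment> \<open>The sign of \<open>C\<close> is unknown, hence the modulus; the factor 2 is the
    eventual bound on \<open>E j t\<close>, which tends to 1.\<close>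
  define C' where "C' = (a2 - a1) * (\<bar>C\<bar> * l * 2)"
  have C': "C' \<ge> 0" using a l by (simp add: C'_def)
  define E where "E j t = t / (L (t + d) powr \<beta>2 j * (t + d) powr \<beta>1 j * n t powr \<beta>2 j * R (n t) powr \<beta>3 j)" for j t
  have "\<forall>\<^sub>F t in at_top. E j t < 2" if "j \<in> {1..r}" for j
    using bound_scale[OF \<beta>[OF that]] unfolding E_def by (rule order_tendstoD) simp
  then have Ev: "\<forall>\<^sub>F t in at_top. \<forall>j\<in>{1..r}. E j t < 2"
    by (intro eventually_ball_finite) auto
  have "\<forall>\<^sub>F t in at_top. \<forall>k\<ge>1. t * passage_weight A B a1 a2 b1 b2 k t
     \<le> (\<Sum>j\<in>{1..r}. C' * ((real k / n t) powr (-\<beta>2 j) * (R (real k) / R (n t)) powr (-\<beta>3 j)))"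
    using Ev eventually_ge_at_top[of "max 1 (t0 - d)"]
  proof eventually_elim
    case (elim t)
    have t: "t > 0" "t + d \<ge> t0" using elim(2) by auto
    show ?case
    proof (intro allI impI)
      fix k :: nat assume k: "k \<ge> 1"
      have pos: "real k > 0" "R (real k) > 0" "n t > 0" "R (n t) > 0" using k n_pos R_pos by auto
      have q: "(x / y) powr (-b) = y powr b / x powr b" if "x > 0" "y > 0" for x y b :: real
        using that by (simp add: powr_divide powr_minus field_simps)
      have "passage_weight A B a1 a2 b1 b2 k t
         \<le> (a2 - a1) * measure M {x\<in>space M. S k x \<in> {t + d..t + d + l}}"
        unfolding d_def by (rule passage_weight_le[OF A B a l(2)])
      also have "\<dots> \<le> (a2 - a1) * (\<Sum>j=1..r. C * l / (L (t + d) powr \<beta>2 j * (t + d) powr \<beta>1 j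
                                    * real k powr \<beta>2 j * R (real k) powr \<beta>3 j))"
        using a t k by (intro mult_left_mono C) auto
      finally have "t * passage_weight A B a1 a2 b1 b2 k t \<le> t * ((a2 - a1) * (\<Sum>j=1..r. C * l / (L (t + d) powr \<beta>2 j * (t + d) powr \<beta>1 j
                                    * real k powr \<beta>2 j * R (real k) powr \<beta>3 j)))"
        using t by (intro mult_left_mono) auto
      also have "\<dots> = (\<Sum>j\<in>{1..r}. t * ((a2 - a1) * (C * l / (L (t + d) powr \<beta>2 j * (t + d) powr \<beta>1 j
                                    * real k powr \<beta>2 j * R (real k) powr \<beta>3 j))))"
        by (simp only: sum_distrib_left)
      also have "\<dots> \<le> (\<Sum>j\<in>{1..r}. C' * ((real k / n t) powr (-\<beta>2 j) * (R (real k) / R (n t)) powr (-\<beta>3 j)))"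
      proof (rule sum_mono)
        fix j assume j: "j \<in> {1..r}"
        define Q where "Q = (real k / n t) powr (-\<beta>2 j) * (R (real k) / R (n t)) powr (-\<beta>3 j)"
        have Q: "Q = (n t powr \<beta>2 j / real k powr \<beta>2 j) * (R (n t) powr \<beta>3 j / R (real k) powr \<beta>3 j)"
          unfolding Q_def using pos by (simp add: q)
        have Q0: "Q \<ge> 0" by (simp add: Q_def)
        have E0: "E j t \<ge> 0" unfolding E_def using t by (intro divide_nonneg_nonneg mult_nonneg_nonneg) auto
        have npw: "n t powr \<beta>2 j > 0" "R (n t) powr \<beta>3 j > 0" using pos by auto
        have "t * ((a2 - a1) * (C * l / (L (t + d) powr \<beta>2 j * (t + d) powr \<beta>1 j
                                    * real k powr \<beta>2 j * R (real k) powr \<beta>3 j)))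
            = (a2 - a1) * (C * l) * (E j t * Q)"
          unfolding E_def Q using npw by (simp add: mult_ac)
        also have "\<dots> \<le> (a2 - a1) * (\<bar>C\<bar> * l) * (2 * Q)"
        proof (rule mult_mono)
          show "(a2 - a1) * (C * l) \<le> (a2 - a1) * (\<bar>C\<bar> * l)" using a l by (intro mult_left_mono mult_right_mono) auto
          have "E j t < 2" using elim(1) j by blast
          then show "E j t * Q \<le> 2 * Q" using Q0 by (intro mult_right_mono) auto
          show "0 \<le> (a2 - a1) * (\<bar>C\<bar> * l)" using a l by simp
          show "0 \<le> E j t * Q" using E0 Q0 by simp
        qed
        also have "\<dots> = C' * Q" by (simp add: C'_def)
        finally show "t * ((a2 - a1) * (C * l / (L (t + d) powr \<beta>2 j * (t + d) powr \<beta>1 j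
                                    * real k powr \<beta>2 j * R (real k) powr \<beta>3 j)))
          \<le> C' * ((real k / n t) powr (-\<beta>2 j) * (R (real k) / R (n t)) powr (-\<beta>3 j))" by (simp only: Q_def)
      qed
      finally show "t * passage_weight A B a1 a2 b1 b2 k t
         \<le> (\<Sum>j\<in>{1..r}. C' * ((real k / n t) powr (-\<beta>2 j) * (R (real k) / R (n t)) powr (-\<beta>3 j)))" .
    qed
  qed
  with C' show ?thesis by blast
qed

text \<open>The common form of both local limit theorems. The threshold \<open>t1\<close> absorbs
  the bounded shifts of time caused by the boxes, which could otherwise make the time
  negative.\<close>

definition local_limit :: "(real \<Rightarrow> real) \<Rightarrow> (nat \<Rightarrow> real \<Rightarrow> real) \<Rightarrow> (nat \<Rightarrow> real \<Rightarrow> real) \<Rightarrow> bool" where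
  "local_limit \<rho> P H \<longleftrightarrow> (\<forall>\<epsilon>>0. \<forall>\<delta>>0. \<exists>K t1. \<forall>k\<ge>K. \<forall>t\<ge>t1. t \<le> R (real k) / \<epsilon> \<longrightarrow>
        \<bar>R (real k) * P k t - \<rho> (t / R (real k)) * H k t\<bar> \<le> \<delta>)"

text \<open>Since \<open>n t * L t / t powr \<alpha>\<close> tends to 1, the normalisation
  \<open>t / n t\<close> of the renewal theorem may be exchanged for
  \<open>L t * t powr (1 - \<alpha>)\<close>.\<close>

lemma mixing_limit:
  fixes r :: nat and \<beta>1 \<beta>2 \<beta>3 :: "nat \<Rightarrow> real" and H :: "nat \<Rightarrow> real \<Rightarrow> real"
  assumes A: "A \<in> sets M" and B: "B \<in> sets M" and a: "a1 \<le> a2" and b: "b1 \<le> b2"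
    and regA: "A \<times> {a1..a2} \<subseteq> susp_region M \<tau>" and regB: "B \<times> {b1..b2} \<subseteq> susp_region M \<tau>"
    and \<beta>_index: "\<And>j. j \<in> {1..r} \<Longrightarrow> \<beta>2 j + \<beta>3 j / \<alpha> < 1"
    and \<beta>: "\<And>j. j \<in> {1..r} \<Longrightarrow> \<beta>1 j + \<beta>2 j * \<alpha> + \<beta>3 j = 1"
    and bound: "\<And>l. l > 0 \<Longrightarrow> \<exists>C t0. t0 > 0 \<and> (\<forall>k\<ge>1. \<forall>t\<ge>t0.
           measure M {x\<in>space M. S k x \<in> {t..t + l}}
             \<le> (\<Sum>j=1..r. C * l / (L t powr \<beta>2 j * t powr \<beta>1 j
                                    * real k powr \<beta>2 j * R (real k) powr \<beta>3 j)))"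
    and \<rho>: "bounded_cont_density \<rho>"
    and H: "\<And>k t. \<bar>H k t\<bar> \<le> Hb"
    and llt: "local_limit \<rho> (passage_weight A B a1 a2 b1 b2) H"
    and avg: "\<And>\<delta>. \<delta> > 0 \<Longrightarrow> \<exists>N\<ge>1. \<forall>k t. \<bar>(\<Sum>i<N. H (k + i) t) / real N - c0\<bar> \<le> \<delta>"
  shows "((\<lambda>t. L t * t powr (1 - \<alpha>) * measure (susp_measure M \<tau>)
      (susp_proj f \<tau> ` (A \<times> {a1..a2}) \<inter> susp_preimage M f \<tau> t (susp_proj f \<tau> ` (B \<times> {b1..b2}))))
    \<longlongrightarrow> c0 * (\<alpha> * (LBINT z:{0<..}. \<rho> z / z powr \<alpha>))) at_top"
proof -
  let ?P = "passage_weight A B a1 a2 b1 b2"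
  let ?\<nu> = "\<lambda>t. measure (susp_measure M \<tau>)
      (susp_proj f \<tau> ` (A \<times> {a1..a2}) \<inter> susp_preimage M f \<tau> t (susp_proj f \<tau> ` (B \<times> {b1..b2})))"
  obtain x0 where "regular_scale R n \<alpha> x0" using scale by blast
  then interpret rs: regular_scale R n \<alpha> x0 .
  obtain C where C: "C \<ge> 0" "\<forall>\<^sub>F t in at_top. \<forall>k\<ge>1. t * ?P k t
     \<le> (\<Sum>j\<in>{1..r}. C * ((real k / n t) powr (-\<beta>2 j) * (R (real k) / R (n t)) powr (-\<beta>3 j)))"
    using small_weights[OF A B a b \<beta> bound] by blast
  have small: "\<forall>\<^sub>F t in at_top. \<forall>k\<ge>1. real k \<le> n t \<longrightarrow> t * ?P k t
     \<le> (\<Sum>j\<in>{1..r}. C * ((real k / n t) powr (-\<beta>2 j) * (R (real k) / R (n t)) powr (-\<beta>3 j)))"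
    using C(2) by eventually_elim blast
  have \<rho>': "continuous_on {0..} \<rho>" "bounded (\<rho> ` {0..})" "\<And>z. z \<ge> 0 \<Longrightarrow> \<rho> z \<ge> 0" "set_integrable lborel {0..} \<rho>"
    using \<rho> by (auto simp: bounded_cont_density_def)
  have llt': "\<And>\<epsilon> \<delta>. \<epsilon> > 0 \<Longrightarrow> \<delta> > 0 \<Longrightarrow> \<exists>K t1. \<forall>k\<ge>K. \<forall>t\<ge>t1. t \<le> R (real k) / \<epsilon> \<longrightarrow>
        \<bar>R (real k) * ?P k t - \<rho> (t / R (real k)) * H k t\<bar> \<le> \<delta>"
    using llt unfolding local_limit_def by blast
  note ren = rs.renewal[where P = ?P and J = "{1..r}" and C = "\<lambda>_. C" and ?\<beta>2.0 = \<beta>2 and ?\<beta>3.0 = \<beta>3,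
      OF passage_weight_nonneg \<rho>' H llt' avg finite_atLeastAtMost C(1) \<beta>_index small]
  have ren1: "\<forall>\<^sub>F t in at_top. summable (\<lambda>k. ?P (Suc k) t)"
    by (rule ren(1))
  have ren2: "((\<lambda>t. t / n t * (\<Sum>k. ?P (Suc k) t)) \<longlongrightarrow> c0 * (\<alpha> * (LBINT z:{0<..}. \<rho> z / z powr \<alpha>))) at_top"
    by (rule ren(2))
  have eq: "\<forall>\<^sub>F t in at_top. (n t * L t / t powr \<alpha>) * (t / n t * (\<Sum>k. ?P (Suc k) t)) = L t * t powr (1 - \<alpha>) * ?\<nu> t"
    using ren1 eventually_gt_at_top[of "max 0 (b2 - a1)"]
  proof eventually_elim
    case (elim t)
    \<comment> \<open>A passage without a crossing needs \<open>t \<le> b2 - a1\<close>. So the sum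
      from 0 given by the flow agrees with the sum from 1 in the renewal theorem.\<close>
    have P0: "?P 0 t = 0"
    proof -
      have "b2 - t < a1" using elim(2) by simp
      then have "min a2 (- t + b2) - max a1 (- t + b1) \<le> 0" by linarith
      then have "overlap a1 a2 b1 b2 (S 0 x - t) = 0" for x by (simp add: overlap_def)
      then show ?thesis unfolding passage_weight_def by simp
    qed
    have sm: "summable (\<lambda>k. ?P k t)" using elim(1) by (simp only: summable_Suc_iff[of "\<lambda>k. ?P k t"])
    have "(\<Sum>k. ennreal (?P k t)) = ennreal (\<Sum>k. ?P k t)"
      using sm passage_weight_nonneg by (intro suminf_ennreal2) auto
    also have "(\<Sum>k. ?P k t) = (\<Sum>k. ?P (Suc k) t)"
      using suminf_split_head[OF sm] P0 by simp
    finally have "(\<Sum>k. ennreal (?P k t)) = ennreal (\<Sum>k. ?P (Suc k) t)" .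
    moreover have "0 \<le> (\<Sum>k. ?P (Suc k) t)"
      using elim(1) passage_weight_nonneg by (intro suminf_nonneg)
    moreover have "t \<ge> 0" using elim(2) by simp
    ultimately have "?\<nu> t = (\<Sum>k. ?P (Suc k) t)"
      by (simp add: measure_susp_passage[OF A B regA regB])
    moreover have "t powr (1 - \<alpha>) = t / t powr \<alpha>" using elim by (simp add: powr_diff)
    ultimately show ?case using n_pos[of t] by simp
  qed
  have "((\<lambda>t. (n t * L t / t powr \<alpha>) * (t / n t * (\<Sum>k. ?P (Suc k) t)))
      \<longlongrightarrow> 1 * (c0 * (\<alpha> * (LBINT z:{0<..}. \<rho> z / z powr \<alpha>)))) at_top"
    by (intro tendsto_mult n_L ren2)
  then have "((\<lambda>t. (n t * L t / t powr \<alpha>) * (t / n t * (\<Sum>k. ?P (Suc k) t)))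
      \<longlongrightarrow> c0 * (\<alpha> * (LBINT z:{0<..}. \<rho> z / z powr \<alpha>))) at_top" by simp
  then show ?thesis using eq by (rule Lim_transform_eventually)
qed

text \<open>Fubini with the height outermost: for fixed \<open>s\<close> the section is an event of
  the aperiodic local limit theorem, with a window of fixed length \<open>b2 - b1\<close> that moves
  with \<open>s\<close>.\<close>

lemma passage_weight_bounds:
  assumes A: "A \<in> sets M" and B: "B \<in> sets M" and a: "a1 \<le> a2"
    and q: "\<And>s. a1 \<le> s \<Longrightarrow> s \<le> a2 \<Longrightarrow>
      lo \<le> measure M {x\<in>space M. x \<in> A \<and> (f ^^ k) x \<in> B \<and> S k x \<in> {s + t - b2..s + t - b1}} \<and>
      measure M {x\<in>space M. x \<in> A \<and> (f ^^ k) x \<in> B \<and> S k x \<in> {s + t - b2..s + t - b1}} \<le> hi"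
  shows "lo * (a2 - a1) \<le> passage_weight A B a1 a2 b1 b2 k t \<and> passage_weight A B a1 a2 b1 b2 k t \<le> hi * (a2 - a1)"
proof -
  let ?q = "\<lambda>s. measure M {x\<in>space M. x \<in> A \<and> (f ^^ k) x \<in> B \<and> S k x \<in> {s + t - b2..s + t - b1}}"
  interpret ps: pair_sigma_finite M "lborel :: real measure" ..
  have hi0: "hi \<ge> 0" using q[of a1] a by (meson measure_nonneg order_trans order_refl)
  have const: "(\<integral>\<^sup>+s. ennreal v * indicator {a1..a2} s \<partial>lborel) = ennreal (v * (a2 - a1))" if "v \<ge> 0" for v
    using a that by (subst nn_integral_cmult_indicator) (auto simp: ennreal_mult)
  have "ennreal (passage_weight A B a1 a2 b1 b2 k t)
      = (\<integral>\<^sup>+s. emeasure M ((\<lambda>x. (x, s)) -` passage A B a1 a2 b1 b2 k t) \<partial>lborel)"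
    using ps.emeasure_pair_measure_alt2[OF passage_sets[OF A B]] emeasure_passage[OF A B] by simp
  also have "\<dots> = (\<integral>\<^sup>+s. ennreal (?q s) * indicator {a1..a2} s \<partial>lborel)"
  proof (rule nn_integral_cong)
    fix s :: real
    show "emeasure M ((\<lambda>x. (x, s)) -` passage A B a1 a2 b1 b2 k t) = ennreal (?q s) * indicator {a1..a2} s"
    proof (cases "s \<in> {a1..a2}")
      case True
      then have "(\<lambda>x. (x, s)) -` passage A B a1 a2 b1 b2 k t
          = {x\<in>space M. x \<in> A \<and> (f ^^ k) x \<in> B \<and> S k x \<in> {s + t - b2..s + t - b1}}"
        using sets.sets_into_space[OF A] by (auto simp: passage_def)
      then show ?thesis using True by (simp add: emeasure_eq_measure)
    next
      case False
      then have "(\<lambda>x. (x, s)) -` passage A B a1 a2 b1 b2 k t = {}" by (auto simp: passage_def)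
      then show ?thesis using False by simp
    qed
  qed
  finally have eq: "ennreal (passage_weight A B a1 a2 b1 b2 k t) = (\<integral>\<^sup>+s. ennreal (?q s) * indicator {a1..a2} s \<partial>lborel)" .
  have "ennreal (passage_weight A B a1 a2 b1 b2 k t) \<le> (\<integral>\<^sup>+s. ennreal hi * indicator {a1..a2} s \<partial>lborel)"
    unfolding eq using q by (intro nn_integral_mono) (auto simp: indicator_def intro!: ennreal_leI)
  then have up: "passage_weight A B a1 a2 b1 b2 k t \<le> hi * (a2 - a1)"
    using hi0 a by (simp add: const ennreal_le_iff)
  \<comment> \<open>\<open>lo\<close> may be negative, which the integral in \<open>ennreal\<close>
    cannot express.\<close>
  have "(\<integral>\<^sup>+s. ennreal (max 0 lo) * indicator {a1..a2} s \<partial>lborel) \<le> ennreal (passage_weight A B a1 a2 b1 b2 k t)"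
    unfolding eq using q by (intro nn_integral_mono) (auto simp: indicator_def intro!: ennreal_leI)
  then have "max 0 lo * (a2 - a1) \<le> passage_weight A B a1 a2 b1 b2 k t"
    unfolding const[OF max.cobounded1] using passage_weight_nonneg by (subst (asm) ennreal_le_iff)
  moreover have "lo * (a2 - a1) \<le> max 0 lo * (a2 - a1)" using a by (intro mult_right_mono) auto
  ultimately show ?thesis using up by linarith
qed

lemma R_seq: "filterlim (\<lambda>k. R (real k)) at_top sequentially"
  by (rule filterlim_compose[OF R_lim filterlim_real_sequentially])

text \<open>The window at height \<open>s\<close> ends at \<open>u = s + t - b1\<close>, a bounded
  distance from \<open>t\<close>. The theorem's uniformity in time handles all \<open>s\<close> at
  once, and uniform continuity of \<rho> replaces \<open>u / R k\<close> by \<open>t / R k\<close>.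
  Windows of length 0 are treated separately because the theorem asks for
  \<open>l > 0\<close>.\<close>

lemma local_limit_aperiodic:
  assumes mllt: "mllt_aperiodic M f \<tau> R \<X> c \<rho>" and AX: "A \<in> \<X>" and BX: "B \<in> \<X>"
    and a: "a1 \<le> a2" and b: "b1 \<le> b2"
  shows "local_limit \<rho> (passage_weight A B a1 a2 b1 b2)
     (\<lambda>k t. c * measure M A * measure M B * (a2 - a1) * (b2 - b1))"
proof (cases "b1 = b2")
  case True
  have "overlap a1 a2 b1 b2 y = 0" for y by (simp add: overlap_def True)
  then have "passage_weight A B a1 a2 b1 b2 k t = 0" for k t by (simp add: passage_weight_def)
  then show ?thesis unfolding local_limit_def using True by auto
next
  case False
  define l where "l = b2 - b1"
  have l: "l > 0" using b False by (simp add: l_def)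
  have A: "A \<in> sets M" and B: "B \<in> sets M" and c: "c > 0" and \<rho>: "continuous_on {0..} \<rho>"
    using mllt AX BX by (auto simp: mllt_aperiodic_def bounded_cont_density_def)
  define w where "w = a2 - a1"
  have w: "w \<ge> 0" using a by (simp add: w_def)
  define m where "m = c * l * measure M A * measure M B"
  have m: "m \<ge> 0" using c l by (simp add: m_def)
  show ?thesis
    unfolding local_limit_def
  proof (intro allI impI)
    fix \<epsilon> \<delta> :: real assume \<epsilon>: "\<epsilon> > 0" and \<delta>: "\<delta> > 0"
    \<comment> \<open>One \<open>\<delta>'\<close> goes to the local limit theorem and one to the
      modulus of continuity of \<rho>; their sum is integrated over heights of total length
      \<open>w\<close>.\<close>
    define \<delta>' where "\<delta>' = \<delta> / (2 * (w + 1))"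
    have \<delta>': "\<delta>' > 0" using \<delta> w by (simp add: \<delta>'_def)
    have \<delta>w: "2 * \<delta>' * w \<le> \<delta>"
    proof -
      define x where "x = 2 * (w + 1)"
      have x: "x > 0" using w by (simp add: x_def)
      have "2 * \<delta>' * w \<le> \<delta>' * x" using \<delta>' by (simp add: x_def algebra_simps)
      also have "\<dots> = \<delta>" unfolding \<delta>'_def x_def[symmetric] using x by simp
      finally show ?thesis .
    qed
    \<comment> \<open>The shifted time \<open>u\<close> may exceed \<open>R k / \<epsilon>\<close>
      by \<open>s0\<close>, which is eventually at most another \<open>R k / \<epsilon>\<close>;
      hence the doubled range, here and in the use of the theorem.\<close>
    have "uniformly_continuous_on {0..2/\<epsilon>} \<rho>"
      by (intro compact_uniformly_continuous continuous_on_subset[OF \<rho>]) auto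
    then obtain \<eta> where \<eta>: "\<eta> > 0" "\<And>x y. x \<in> {0..2/\<epsilon>} \<Longrightarrow> y \<in> {0..2/\<epsilon>} \<Longrightarrow> dist y x < \<eta> \<Longrightarrow> dist (\<rho> y) (\<rho> x) < \<delta>' / (m + 1)"
      using \<delta>' m unfolding uniformly_continuous_on_def by (metis add_nonneg_pos divide_pos_pos zero_less_one)
    \<comment> \<open>Bounds \<open>\<bar>u - t\<bar>\<close>, and as lower threshold for
      \<open>t\<close> makes \<open>u\<close> nonnegative.\<close>
    define s0 where "s0 = \<bar>a1\<bar> + \<bar>a2\<bar> + \<bar>b1\<bar> + 1"
    have "\<forall>\<^sub>F k in sequentially. R (real k) \<ge> max 1 (max (\<epsilon> * s0) (2 * s0 / \<eta>))"
      using R_seq unfolding filterlim_at_top by blast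
    moreover have "\<forall>\<^sub>F k in sequentially. \<forall>u. 0 \<le> u \<and> u \<le> R (real k) / (\<epsilon> / 2) \<longrightarrow>
          \<bar>R (real k) * measure M {x\<in>space M. x \<in> A \<and> (f ^^ k) x \<in> B \<and> S k x \<in> {u - l..u}}
            - c * \<rho> (u / R (real k)) * l * measure M A * measure M B\<bar> < \<delta>'"
    proof -
      have "\<And>l \<epsilon> \<delta>. l > 0 \<Longrightarrow> \<epsilon> > 0 \<Longrightarrow> \<delta> > 0 \<Longrightarrow> \<forall>\<^sub>F k in sequentially. \<forall>u. 0 \<le> u \<and> u \<le> R (real k) / \<epsilon> \<longrightarrow>
          \<bar>R (real k) * measure M {x\<in>space M. x \<in> A \<and> (f ^^ k) x \<in> B \<and> S k x \<in> {u - l..u}}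
            - c * \<rho> (u / R (real k)) * l * measure M A * measure M B\<bar> < \<delta>"
        using mllt AX BX unfolding mllt_aperiodic_def by blast
      from this[OF l half_gt_zero[OF \<epsilon>] \<delta>'] show ?thesis .
    qed
    ultimately have "\<forall>\<^sub>F k in sequentially. R (real k) \<ge> max 1 (max (\<epsilon> * s0) (2 * s0 / \<eta>)) \<and>
        (\<forall>u. 0 \<le> u \<and> u \<le> R (real k) / (\<epsilon> / 2) \<longrightarrow>
          \<bar>R (real k) * measure M {x\<in>space M. x \<in> A \<and> (f ^^ k) x \<in> B \<and> S k x \<in> {u - l..u}}
            - c * \<rho> (u / R (real k)) * l * measure M A * measure M B\<bar> < \<delta>')"
      by (rule eventually_conj)
    then obtain K where K: "\<And>k. k \<ge> K \<Longrightarrow> R (real k) \<ge> max 1 (max (\<epsilon> * s0) (2 * s0 / \<eta>))"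
      "\<And>k u. k \<ge> K \<Longrightarrow> 0 \<le> u \<Longrightarrow> u \<le> R (real k) / (\<epsilon> / 2) \<Longrightarrow>
          \<bar>R (real k) * measure M {x\<in>space M. x \<in> A \<and> (f ^^ k) x \<in> B \<and> S k x \<in> {u - l..u}}
            - c * \<rho> (u / R (real k)) * l * measure M A * measure M B\<bar> < \<delta>'"
      unfolding eventually_sequentially by blast
    have "\<bar>R (real k) * passage_weight A B a1 a2 b1 b2 k t - \<rho> (t / R (real k)) * (m * w)\<bar> \<le> \<delta>"
      if k: "k \<ge> K" and t: "t \<ge> s0" "t \<le> R (real k) / \<epsilon>" for k t
    proof -
      define rk where "rk = R (real k)"
      have rk: "rk \<ge> 1" "\<epsilon> * s0 \<le> rk" "2 * s0 / \<eta> \<le> rk" using K(1)[OF k] by (auto simp: rk_def)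
      define v where "v = m * \<rho> (t / rk)"
      have q: "(v - 2 * \<delta>') / rk \<le> measure M {x\<in>space M. x \<in> A \<and> (f ^^ k) x \<in> B \<and> S k x \<in> {s + t - b2..s + t - b1}} \<and>
          measure M {x\<in>space M. x \<in> A \<and> (f ^^ k) x \<in> B \<and> S k x \<in> {s + t - b2..s + t - b1}} \<le> (v + 2 * \<delta>') / rk"
        if s: "a1 \<le> s" "s \<le> a2" for s
      proof -
        define u where "u = s + t - b1"
        have us: "u - l = s + t - b2" "u = s + t - b1" by (simp_all add: u_def l_def)
        have ut: "\<bar>u - t\<bar> \<le> s0" "t \<ge> 0" using s t by (auto simp: u_def s0_def)
        have u0: "u \<ge> 0" using s t by (auto simp: u_def s0_def)
        have s0rk: "s0 \<le> rk / \<epsilon>" using rk(2) \<epsilon> by (simp add: field_simps)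
        have "u \<le> rk / \<epsilon> + rk / \<epsilon>" using ut s0rk t(2) unfolding rk_def by linarith
        then have u1: "u \<le> rk / (\<epsilon> / 2)" by (simp add: mult.commute)
        have "u / rk \<in> {0..2/\<epsilon>}" using u0 u1 rk(1) \<epsilon> by (auto simp: field_simps)
        moreover have "t / rk \<in> {0..2/\<epsilon>}"
        proof -
          have "t \<le> rk / \<epsilon>" using t(2) by (simp add: rk_def)
          also have "\<dots> \<le> rk * (2 / \<epsilon>)" using rk(1) \<epsilon> by (simp add: field_simps)
          finally show ?thesis using ut(2) rk(1) by (simp add: field_simps)
        qed
        moreover have "dist (u / rk) (t / rk) < \<eta>"
        proof -
          have "dist (u / rk) (t / rk) = \<bar>u - t\<bar> / rk"
            using rk(1) by (simp add: dist_real_def diff_divide_distrib[symmetric])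
          also have "\<dots> \<le> s0 / rk" using ut rk(1) by (intro divide_right_mono) auto
          also have "\<dots> < \<eta>"
          proof -
            have "2 * s0 \<le> rk * \<eta>" using rk(3) \<eta>(1) by (simp add: field_simps)
            moreover have "s0 > 0" by (simp add: s0_def add_nonneg_pos)
            ultimately show ?thesis using rk(1) by (simp add: divide_less_eq mult.commute)
          qed
          finally show ?thesis .
        qed
        ultimately have "dist (\<rho> (u / rk)) (\<rho> (t / rk)) < \<delta>' / (m + 1)" by (intro \<eta>(2))
        then have "m * \<bar>\<rho> (u / rk) - \<rho> (t / rk)\<bar> \<le> m * (\<delta>' / (m + 1))"
          using m by (intro mult_left_mono) (auto simp: dist_real_def)
        also have "\<dots> \<le> \<delta>'" using m \<delta>' by (simp add: field_simps)
        finally have "\<bar>m * \<rho> (u / rk) - v\<bar> \<le> \<delta>'"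
          using m by (simp add: v_def right_diff_distrib[symmetric] abs_mult)
        moreover have "\<bar>rk * measure M {x\<in>space M. x \<in> A \<and> (f ^^ k) x \<in> B \<and> S k x \<in> {u - l..u}} - m * \<rho> (u / rk)\<bar> < \<delta>'"
          using K(2)[OF k u0] u1 unfolding rk_def m_def by (simp add: mult_ac)
        ultimately have "v - 2 * \<delta>' \<le> rk * measure M {x\<in>space M. x \<in> A \<and> (f ^^ k) x \<in> B \<and> S k x \<in> {u - l..u}}"
          "rk * measure M {x\<in>space M. x \<in> A \<and> (f ^^ k) x \<in> B \<and> S k x \<in> {u - l..u}} \<le> v + 2 * \<delta>'"
          by linarith+
        moreover have "rk > 0" using rk(1) by simp
        ultimately show ?thesis unfolding us(1)[symmetric] us(2)[symmetric]
          by (simp add: pos_divide_le_eq pos_le_divide_eq mult.commute)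
      qed
      have pw: "(v - 2 * \<delta>') / rk * w \<le> passage_weight A B a1 a2 b1 b2 k t \<and> passage_weight A B a1 a2 b1 b2 k t \<le> (v + 2 * \<delta>') / rk * w"
        unfolding w_def by (rule passage_weight_bounds[OF A B a q])
      have cancel: "rk * (x / rk * w) = x * w" for x using rk(1) by simp
      have rk0: "rk \<ge> 0" using rk(1) by simp
      have "rk * ((v - 2 * \<delta>') / rk * w) \<le> rk * passage_weight A B a1 a2 b1 b2 k t"
        "rk * passage_weight A B a1 a2 b1 b2 k t \<le> rk * ((v + 2 * \<delta>') / rk * w)"
        using pw by (auto intro: mult_left_mono[OF _ rk0] simp del: times_divide_eq_left)
      then have "(v - 2 * \<delta>') * w \<le> rk * passage_weight A B a1 a2 b1 b2 k t"
        "rk * passage_weight A B a1 a2 b1 b2 k t \<le> (v + 2 * \<delta>') * w" by (simp_all only: cancel)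
      then have "v * w - 2 * \<delta>' * w \<le> rk * passage_weight A B a1 a2 b1 b2 k t"
        "rk * passage_weight A B a1 a2 b1 b2 k t \<le> v * w + 2 * \<delta>' * w" by (simp_all only: left_diff_distrib distrib_right)
      then have "\<bar>rk * passage_weight A B a1 a2 b1 b2 k t - v * w\<bar> \<le> \<delta>" using \<delta>w by linarith
      then show ?thesis by (simp add: rk_def v_def mult_ac)
    qed
    then have "\<forall>k\<ge>K. \<forall>t\<ge>s0. t \<le> R (real k) / \<epsilon> \<longrightarrow>
        \<bar>R (real k) * passage_weight A B a1 a2 b1 b2 k t - \<rho> (t / R (real k)) * (m * w)\<bar> \<le> \<delta>" by blast
    moreover have "m * w = c * measure M A * measure M B * (a2 - a1) * (b2 - b1)"
      by (simp add: m_def w_def l_def mult_ac)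
    ultimately show "\<exists>K t1. \<forall>k\<ge>K. \<forall>t\<ge>t1. t \<le> R (real k) / \<epsilon> \<longrightarrow>
        \<bar>R (real k) * passage_weight A B a1 a2 b1 b2 k t
          - \<rho> (t / R (real k)) * (c * measure M A * measure M B * (a2 - a1) * (b2 - b1))\<bar> \<le> \<delta>"
      by (intro exI[of _ K] exI[of _ s0]) simp
  qed
qed

end

subsection \<open>Sums over a lattice\<close>

lemma sets_lattice_measure[measurable_cong, simp]: "sets (lattice_measure h) = sets borel"
  by (simp add: lattice_measure_def)

lemma space_lattice_measure[simp]: "space (lattice_measure h) = UNIV"
  by (simp add: lattice_measure_def space_scale_measure)

lemma emeasure_lattice_measure:
  assumes "X \<in> sets borel"
  shows "emeasure (lattice_measure h) X = ennreal h * emeasure (count_space UNIV) {n::int. h * of_int n \<in> X}"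
  using assms by (simp add: lattice_measure_def emeasure_distr vimage_def)

lemma finite_lattice_points:
  fixes h Z :: real
  assumes "h > 0"
  shows "finite {n::int. \<bar>h * of_int n\<bar> \<le> Z}"
proof (rule finite_subset)
  show "{n::int. \<bar>h * of_int n\<bar> \<le> Z} \<subseteq> {-\<lceil>Z / h\<rceil>..\<lceil>Z / h\<rceil>}"
  proof
    fix n :: int assume "n \<in> {n. \<bar>h * of_int n\<bar> \<le> Z}"
    then have "h * \<bar>of_int n\<bar> \<le> Z" using assms by (simp add: abs_mult)
    then have "\<bar>of_int n\<bar> \<le> Z / h" using assms by (simp add: field_simps)
    then have "\<bar>real_of_int n\<bar> \<le> of_int \<lceil>Z / h\<rceil>" by linarith
    then show "n \<in> {-\<lceil>Z / h\<rceil>..\<lceil>Z / h\<rceil>}" by auto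
  qed
qed simp

lemma emeasure_lattice_finite:
  assumes "h > 0"
  shows "emeasure (lattice_measure h) {-Z..Z} < \<infinity>"
proof -
  have "finite {n::int. h * of_int n \<in> {-Z..Z}}"
    using finite_lattice_points[OF assms, of Z] by (rule finite_subset[rotated]) auto
  then show ?thesis
    by (simp add: emeasure_lattice_measure ennreal_mult_less_top of_nat_less_top)
qed

lemma sigma_finite_lattice:
  assumes "h > 0"
  shows "sigma_finite_measure (lattice_measure h)"
proof
  show "\<exists>A. countable A \<and> A \<subseteq> sets (lattice_measure h) \<and> \<Union> A = space (lattice_measure h) \<and>
    (\<forall>a\<in>A. emeasure (lattice_measure h) a \<noteq> \<infinity>)"
  proof (intro exI conjI ballI)
    show "countable (range (\<lambda>k::nat. {-real k..real k}))" by simp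
    show "range (\<lambda>k::nat. {-real k..real k}) \<subseteq> sets (lattice_measure h)" by auto
    show "\<Union> (range (\<lambda>k::nat. {-real k..real k})) = space (lattice_measure h)"
    proof -
      have "\<exists>k::nat. -real k \<le> x \<and> x \<le> real k" for x
      proof -
        obtain k :: nat where "\<bar>x\<bar> \<le> real k" using real_arch_simple by blast
        then show ?thesis by (intro exI[of _ k]) linarith
      qed
      then show ?thesis by auto
    qed
    fix a assume "a \<in> range (\<lambda>k::nat. {-real k..real k})"
    then obtain k :: nat where "a = {-real k..real k}" by blast
    then show "emeasure (lattice_measure h) a \<noteq> \<infinity>"
      using emeasure_lattice_finite[OF assms, of "real k"] by simp
  qed
qed

lemma integral_lattice:
  fixes u :: "real \<Rightarrow> real"
  assumes h: "h > 0" and u: "u \<in> borel_measurable borel" and F: "finite F" "\<And>n. u (h * of_int n) \<noteq> 0 \<Longrightarrow> n \<in> F"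
  shows "integral\<^sup>L (lattice_measure h) u = h * (\<Sum>n\<in>F. u (h * of_int n))"
proof -
  have lat: "lattice_measure h = density (distr (count_space (UNIV::int set)) borel (\<lambda>n. h * of_int n)) (\<lambda>_. ennreal h)"
    by (rule measure_eqI) (simp_all add: lattice_measure_def emeasure_density_const)
  have fin: "finite {n\<in>UNIV. u (h * of_int n) \<noteq> 0}"
    using F by (auto intro: finite_subset[OF _ F(1)])
  have "integral\<^sup>L (lattice_measure h) u = (\<integral>x. h * u x \<partial>distr (count_space (UNIV::int set)) borel (\<lambda>n. h * of_int n))"
    unfolding lat using h u by (subst integral_density) auto
  also have "\<dots> = h * (\<integral>n. u (h * of_int n) \<partial>count_space UNIV)"
    using u by (subst integral_distr) auto
  also have "(\<integral>n. u (h * of_int n) \<partial>count_space UNIV) = (\<Sum>n | n \<in> UNIV \<and> u (h * of_int n) \<noteq> 0. u (h * of_int n))"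
    by (rule lebesgue_integral_count_space_finite_support[OF fin])
  also have "\<dots> = (\<Sum>n\<in>F. u (h * of_int n))"
    using F by (intro sum.mono_neutral_left) auto
  finally show ?thesis .
qed

locale lattice_periodization =
  fixes G :: "real \<Rightarrow> real" and h g :: real
  assumes h: "h > 0" and lip: "\<And>x y. \<bar>G x - G y\<bar> \<le> \<bar>x - y\<bar>" and supp: "\<And>x. \<bar>x\<bar> > g \<Longrightarrow> G x = 0"
begin

lemma cont: "continuous_on X G"
proof (rule continuous_onI)
  fix x e :: real assume e: "e > 0"
  have "dist (G x') (G x) \<le> e" if "dist x' x < e" for x'
    using lip[of x' x] that by (simp add: dist_real_def)
  then show "\<exists>d>0. \<forall>x'\<in>X. dist x' x < d \<longrightarrow> dist (G x') (G x) \<le> e" using e by blast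
qed

lemma meas[measurable]: "G \<in> borel_measurable borel"
  by (intro borel_measurable_continuous_onI cont)

text \<open>The periodization of \<open>G\<close>: \<open>h\<close> times the sum of
  \<open>G\<close> over the coset of \<open>v\<close> modulo \<open>h\<close>.\<close>

definition S :: "real \<Rightarrow> real" where "S v = (\<integral>z. G (z + v) \<partial>lattice_measure h)"

lemma S_finite:
  assumes "finite F" "\<And>n. G (h * of_int n + v) \<noteq> 0 \<Longrightarrow> n \<in> F"
  shows "S v = h * (\<Sum>n\<in>F. G (h * of_int n + v))"
  unfolding S_def using assms by (intro integral_lattice[OF h]) auto

lemma support_bound:
  assumes "G (h * of_int n + v) \<noteq> 0" and "\<bar>v\<bar> \<le> V"
  shows "\<bar>h * of_int n\<bar> \<le> g + V"
  using assms supp[of "h * of_int n + v"] by (cases "\<bar>h * of_int n + v\<bar> > g") linarith+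

lemma S_bounded_window:
  assumes "\<bar>v\<bar> \<le> V"
  shows "S v = h * (\<Sum>n | \<bar>h * of_int n\<bar> \<le> g + V. G (h * of_int n + v))"
  using support_bound[OF _ assms] by (intro S_finite finite_lattice_points h) auto

lemma S_shift: "S (v + h * of_int m) = S v"
proof -
  define F where "F = {n::int. \<bar>h * of_int n\<bar> \<le> g + (\<bar>v\<bar> + \<bar>h * of_int m\<bar>)}"
  have F: "finite F" unfolding F_def by (rule finite_lattice_points[OF h])
  have "\<bar>v + h * of_int m\<bar> \<le> \<bar>v\<bar> + \<bar>h * of_int m\<bar>" by (rule abs_triangle_ineq)
  then have "S (v + h * of_int m) = h * (\<Sum>n\<in>F. G (h * of_int n + (v + h * of_int m)))"
    unfolding F_def by (rule S_bounded_window)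
  also have "(\<Sum>n\<in>F. G (h * of_int n + (v + h * of_int m))) = (\<Sum>n\<in>(\<lambda>n. n + m) ` F. G (h * of_int n + v))"
    by (subst sum.reindex) (auto simp: algebra_simps)
  also have "h * \<dots> = S v"
  proof (rule S_finite[symmetric])
    show "finite ((\<lambda>n. n + m) ` F)" using F by simp
    fix n assume *: "G (h * of_int n + v) \<noteq> 0"
    have "\<bar>h * of_int n\<bar> \<le> g + \<bar>v\<bar>" using support_bound[OF *] by simp
    then have "\<bar>h * of_int (n - m)\<bar> \<le> g + (\<bar>v\<bar> + \<bar>h * of_int m\<bar>)" by (simp add: right_diff_distrib)
    then have "n - m \<in> F" by (simp add: F_def)
    then show "n \<in> (\<lambda>n. n + m) ` F" by (rule rev_image_eqI) simp
  qed
  finally show ?thesis .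
qed

lemma reduce: obtains m :: int where "0 \<le> v + h * of_int m" "v + h * of_int m < h"
proof
  have "of_int \<lfloor>v / h\<rfloor> \<le> v / h" "v / h < of_int \<lfloor>v / h\<rfloor> + 1" by linarith+
  then have "of_int \<lfloor>v / h\<rfloor> * h \<le> v" "v < (of_int \<lfloor>v / h\<rfloor> + 1) * h"
    using h by (simp_all only: pos_le_divide_eq pos_divide_less_eq)
  then show "0 \<le> v + h * of_int (- \<lfloor>v / h\<rfloor>)" "v + h * of_int (- \<lfloor>v / h\<rfloor>) < h"
    by (simp_all add: algebra_simps)
qed

text \<open>A common shift by a multiple of \<open>h\<close> moves \<open>v\<close> into one period
  and \<open>w\<close> to within \<open>2 * h\<close> of 0. Then only a fixed finite set of lattice
  points contributes, and each term is 1-Lipschitz.\<close>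

lemma S_lipschitz: "\<exists>C\<ge>0. \<forall>v w. \<bar>v - w\<bar> \<le> h \<longrightarrow> \<bar>S v - S w\<bar> \<le> C * \<bar>v - w\<bar>"
proof -
  define F where "F = {n::int. \<bar>h * of_int n\<bar> \<le> g + 2 * h}"
  have main: "\<bar>S v - S w\<bar> \<le> h * real (card F) * \<bar>v - w\<bar>" if vw: "\<bar>v - w\<bar> \<le> h" for v w
  proof -
    obtain m where m: "0 \<le> v + h * of_int m" "v + h * of_int m < h" using reduce[of v] .
    define v' w' where "v' = v + h * of_int m" and "w' = w + h * of_int m"
    have b: "\<bar>v'\<bar> \<le> 2 * h" "\<bar>w'\<bar> \<le> 2 * h" using m vw h by (auto simp: v'_def w'_def abs_le_iff)
    have "\<bar>S v - S w\<bar> = \<bar>S v' - S w'\<bar>" by (simp add: v'_def w'_def S_shift)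
    also have "S v' - S w' = h * (\<Sum>n\<in>F. G (h * of_int n + v') - G (h * of_int n + w'))"
      unfolding F_def using b by (simp add: S_bounded_window sum_subtractf right_diff_distrib)
    also have "\<bar>\<dots>\<bar> = h * \<bar>\<Sum>n\<in>F. G (h * of_int n + v') - G (h * of_int n + w')\<bar>"
      using h by (simp add: abs_mult)
    also have "\<dots> \<le> h * (\<Sum>n\<in>F. \<bar>v' - w'\<bar>)"
    proof (intro mult_left_mono order_trans[OF sum_abs] sum_mono)
      fix n show "\<bar>G (h * of_int n + v') - G (h * of_int n + w')\<bar> \<le> \<bar>v' - w'\<bar>"
        using lip[of "h * of_int n + v'" "h * of_int n + w'"] by simp
    qed (use h in simp)
    also have "\<dots> = h * real (card F) * \<bar>v - w\<bar>" by (simp add: v'_def w'_def)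
    finally show ?thesis .
  qed
  show ?thesis using main h by (intro exI[of _ "h * real (card F)"]) auto
qed

lemma S_cont: "continuous_on X S"
proof (rule continuous_onI)
  fix x e :: real assume e: "e > 0"
  obtain C where C: "C \<ge> 0" "\<And>v w. \<bar>v - w\<bar> \<le> h \<Longrightarrow> \<bar>S v - S w\<bar> \<le> C * \<bar>v - w\<bar>"
    using S_lipschitz by blast
  show "\<exists>d>0. \<forall>x'\<in>X. dist x' x < d \<longrightarrow> dist (S x') (S x) \<le> e"
  proof (intro exI[of _ "min h (e / (C + 1))"] conjI ballI impI)
    show "0 < min h (e / (C + 1))" using e C h by auto
    fix x' assume *: "dist x' x < min h (e / (C + 1))"
    then have "\<bar>S x' - S x\<bar> \<le> C * \<bar>x' - x\<bar>" by (intro C) (auto simp: dist_real_def)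
    also have "\<dots> \<le> (C + 1) * (e / (C + 1))" using * C by (intro mult_mono) (auto simp: dist_real_def)
    also have "\<dots> = e" using C by simp
    finally show "dist (S x') (S x) \<le> e" by (simp add: dist_real_def)
  qed
qed

lemma S_meas[measurable]: "S \<in> borel_measurable borel"
  by (intro borel_measurable_continuous_onI S_cont)

lemma S_bounded: "\<exists>b\<ge>0. \<forall>v. \<bar>S v\<bar> \<le> b"
proof -
  have "compact (S ` {0..h})" by (intro compact_continuous_image S_cont) auto
  then obtain b where b: "\<And>v. v \<in> {0..h} \<Longrightarrow> \<bar>S v\<bar> \<le> b"
    using compact_imp_bounded by (force simp: bounded_iff)
  have "\<bar>S v\<bar> \<le> b" for v
  proof -
    obtain m where m: "0 \<le> v + h * of_int m" "v + h * of_int m < h" using reduce[of v] .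
    then show ?thesis using b[of "v + h * of_int m"] by (simp add: S_shift)
  qed
  moreover have "b \<ge> 0" using b[of 0] h by auto
  ultimately show ?thesis by blast
qed

lemma integral_pieces: "(\<Sum>i<k. integral {b + h * real i..b + h * real (Suc i)} G) = integral {b..b + h * real k} G"
proof (induction k)
  case (Suc k)
  have "integral {b..b + h * real k} G + integral {b + h * real k..b + h * real (Suc k)} G = integral {b..b + h * real (Suc k)} G"
    using h by (intro Henstock_Kurzweil_Integration.integral_combine integrable_continuous_real cont) (auto simp: algebra_simps)
  then show ?case using Suc by simp
qed simp

text \<open>Integrating the translates of \<open>G\<close> over one period amounts to integrating
  \<open>G\<close> over consecutive intervals of length \<open>h\<close>, which tile a set
  containing the support.\<close>

lemma S_mean:
  assumes J: "(G has_integral J) {-g..g}"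
  shows "integral {0..h} (\<lambda>u. S (u + c)) = h * J"
proof -
  \<comment> \<open>Large enough that the \<open>2 * N + 1\<close> intervals, which start at
    \<open>c - h * N\<close>, cover the support of \<open>G\<close>, and that no other lattice point
    contributes for \<open>u\<close> in \<open>{0..h}\<close>.\<close>
  obtain N :: nat where N: "(\<bar>g\<bar> + \<bar>c\<bar> + 2 * h) / h \<le> real N" using real_arch_simple by blast
  then have Nh: "\<bar>g\<bar> + \<bar>c\<bar> + 2 * h \<le> h * real N" using h by (simp add: field_simps)
  define k where "k = Suc (2 * N)"
  define b where "b = c - h * real N"
  have Su: "S (u + c) = h * (\<Sum>i<k. G (u + (b + h * real i)))" if u: "u \<in> {0..h}" for u
  proof -
    have "S (u + c) = h * (\<Sum>n\<in>(\<lambda>i. int i - int N) ` {..<k}. G (h * of_int n + (u + c)))"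
    proof (rule S_finite)
      fix n assume *: "G (h * of_int n + (u + c)) \<noteq> 0"
      have "\<bar>u + c\<bar> \<le> h + \<bar>c\<bar>" using u h by auto
      with * have "\<bar>h * of_int n\<bar> \<le> g + (h + \<bar>c\<bar>)" by (rule support_bound)
      then have "h * \<bar>of_int n\<bar> \<le> g + (h + \<bar>c\<bar>)" using h by (simp add: abs_mult)
      then have "h * \<bar>of_int n\<bar> \<le> h * real N" using Nh h by linarith
      then have "\<bar>real_of_int n\<bar> \<le> real N" using mult_le_cancel_left_pos[OF h] by blast
      then have "nat (n + int N) < k" "n = int (nat (n + int N)) - int N" unfolding k_def by linarith+
      then show "n \<in> (\<lambda>i. int i - int N) ` {..<k}" by blast
    qed simp
    also have "(\<Sum>n\<in>(\<lambda>i. int i - int N) ` {..<k}. G (h * of_int n + (u + c))) = (\<Sum>i<k. G (u + (b + h * real i)))"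
      by (subst sum.reindex) (auto simp: inj_on_def b_def algebra_simps)
    finally show ?thesis .
  qed
  have shift: "integral {0..h} (\<lambda>u. G (u + d)) = integral {d..d + h} G" for d
    using integral_shift_Icc_real[of 0 h G d] by (simp add: comp_def add.commute)
  have "integral {0..h} (\<lambda>u. S (u + c)) = integral {0..h} (\<lambda>u. h * (\<Sum>i<k. G (u + (b + h * real i))))"
    by (intro integral_cong Su)
  also have "\<dots> = h * (\<Sum>i<k. integral {0..h} (\<lambda>u. G (u + (b + h * real i))))"
    by (subst integral_mult_right, subst integral_sum)
      (auto intro!: integrable_continuous_real continuous_on_compose2[OF cont[of UNIV]] continuous_intros)
  also have "(\<Sum>i<k. integral {0..h} (\<lambda>u. G (u + (b + h * real i)))) = (\<Sum>i<k. integral {b + h * real i..b + h * real (Suc i)} G)"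
    by (simp add: shift algebra_simps)
  also have "\<dots> = integral {b..b + h * real k} G" by (rule integral_pieces)
  also have "\<dots> = J"
  proof (rule integral_unique)
    show "(G has_integral J) {b..b + h * real k}"
    proof (rule has_integral_on_superset[OF J])
      show "G x = 0" if "x \<notin> {-g..g}" for x using that supp[of x] by auto
      have "b \<le> -g" using Nh h by (simp add: b_def)
      moreover have "b + h * real k = c + h * real N + h" by (simp add: b_def k_def algebra_simps)
      then have "g \<le> b + h * real k" using Nh h by linarith
      ultimately show "{-g..g} \<subseteq> {b..b + h * real k}" by auto
    qed
  qed
  finally show ?thesis .
qed

text \<open>Density of the multiples of \<open>a\<close> modulo \<open>h\<close>, made uniform in
  \<open>x\<close>. Half of \<eta> is spent on moving \<open>x\<close>, modulo \<open>h\<close>, to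
  a finite net of one period, and half on approximating the points of the net, so finitely many
  multiples suffice.\<close>

lemma dense_shifts:
  assumes irr: "a / h \<notin> \<rat>" and \<eta>: "\<eta> > 0"
  shows "\<exists>J::nat. \<forall>x. \<exists>j m::int. \<bar>j\<bar> \<le> int J \<and> \<bar>x - (of_int j * a + h * of_int m)\<bar> \<le> \<eta>"
proof -
  have "\<exists>j m::int. \<bar>x - (of_int j * a + h * of_int m)\<bar> \<le> \<eta> / 2" for x
  proof -
    have "\<eta> / (2 * h) > 0" using \<eta> h by simp
    from sequence_of_fractional_parts_is_dense[OF irr this, of "x / h"]
    obtain m j where "\<bar>of_int j * (a / h) - of_int m - x / h\<bar> < \<eta> / (2 * h)" by blast
    then have "h * \<bar>of_int j * (a / h) - of_int m - x / h\<bar> < h * (\<eta> / (2 * h))"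
      using h by (intro mult_strict_left_mono)
    moreover have "h * \<bar>of_int j * (a / h) - of_int m - x / h\<bar> = \<bar>of_int j * a - h * of_int m - x\<bar>"
    proof -
      have "h * \<bar>of_int j * (a / h) - of_int m - x / h\<bar> = \<bar>h * (of_int j * (a / h) - of_int m - x / h)\<bar>"
        using h by (simp add: abs_mult)
      also have "h * (of_int j * (a / h) - of_int m - x / h) = of_int j * a - h * of_int m - x"
        using h by (simp add: field_simps)
      finally show ?thesis .
    qed
    moreover have "h * (\<eta> / (2 * h)) = \<eta> / 2" using h by simp
    ultimately have "\<bar>of_int j * a - h * of_int m - x\<bar> < \<eta> / 2" by linarith
    moreover have "x - (of_int j * a + h * of_int (-m)) = - (of_int j * a - h * of_int m - x)" by (simp add: algebra_simps)
    ultimately have "\<bar>x - (of_int j * a + h * of_int (-m))\<bar> \<le> \<eta> / 2" by linarith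
    then show ?thesis by blast
  qed
  then obtain jj mm :: "real \<Rightarrow> int" where jm: "\<And>x. \<bar>x - (of_int (jj x) * a + h * of_int (mm x))\<bar> \<le> \<eta> / 2"
    by metis
  \<comment> \<open>The net has mesh \<open>\<eta> / 2\<close>; this many steps reach across a
    period of length \<open>h\<close>.\<close>
  define K where "K = nat \<lceil>2 * h / \<eta>\<rceil>"
  define J where "J = nat (Max ((\<lambda>i. \<bar>jj (\<eta> / 2 * real i)\<bar>) ` {..K}))"
  have J: "\<bar>jj (\<eta> / 2 * real i)\<bar> \<le> int J" if "i \<le> K" for i
  proof -
    have "\<bar>jj (\<eta> / 2 * real i)\<bar> \<le> Max ((\<lambda>i. \<bar>jj (\<eta> / 2 * real i)\<bar>) ` {..K})" using that by (intro Max_ge) auto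
    then show ?thesis unfolding J_def by linarith
  qed
  show ?thesis
  proof (intro exI[of _ J] allI)
    fix x
    obtain m where m: "0 \<le> x + h * of_int m" "x + h * of_int m < h" using reduce[of x] .
    define y where "y = x + h * of_int m"
    define i where "i = nat \<lfloor>y / (\<eta> / 2)\<rfloor>"
    have y0: "y / (\<eta> / 2) \<ge> 0" using m \<eta> by (simp add: y_def)
    have i: "real i \<le> y / (\<eta> / 2)" "y / (\<eta> / 2) < real i + 1" using y0 unfolding i_def by linarith+
    have "y / (\<eta> / 2) \<le> h / (\<eta> / 2)" using m \<eta> by (intro divide_right_mono) (auto simp: y_def)
    then have "y / (\<eta> / 2) \<le> 2 * h / \<eta>" by (simp add: mult.commute)
    then have "i \<le> K" using i(1) unfolding K_def by linarith
    have near: "\<bar>y - \<eta> / 2 * real i\<bar> \<le> \<eta> / 2" using i \<eta> by (auto simp: field_simps abs_le_iff)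
    have "\<bar>x - (of_int (jj (\<eta> / 2 * real i)) * a + h * of_int (mm (\<eta> / 2 * real i) - m))\<bar>
      = \<bar>(y - \<eta> / 2 * real i) + (\<eta> / 2 * real i - (of_int (jj (\<eta> / 2 * real i)) * a + h * of_int (mm (\<eta> / 2 * real i))))\<bar>"
      by (simp add: y_def algebra_simps)
    also have "\<dots> \<le> \<eta>" using near jm[of "\<eta> / 2 * real i"] by linarith
    finally show "\<exists>j m::int. \<bar>j\<bar> \<le> int J \<and> \<bar>x - (of_int j * a + h * of_int m)\<bar> \<le> \<eta>"
      using J[OF \<open>i \<le> K\<close>] by blast
  qed
qed

text \<open>Averages over \<open>N\<close> consecutive shifts by \<open>a\<close> are almost invariant under such a shift, hence, these
  shifts being dense modulo \<open>h\<close>, almost constant.\<close>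

lemma uniform_averages:
  assumes irr: "a / h \<notin> \<rat>" and J: "(G has_integral J) {-g..g}" and \<delta>: "\<delta> > 0"
  shows "\<exists>N\<ge>1. \<forall>v. \<bar>(\<Sum>i<N. S (v + a * real i)) / real N - J\<bar> \<le> \<delta>"
proof -
  obtain C where C: "C \<ge> 0" "\<And>v w. \<bar>v - w\<bar> \<le> h \<Longrightarrow> \<bar>S v - S w\<bar> \<le> C * \<bar>v - w\<bar>"
    using S_lipschitz by blast
  obtain b where b: "b \<ge> 0" "\<And>v. \<bar>S v\<bar> \<le> b" using S_bounded by blast
  define \<eta> where "\<eta> = min h (\<delta> / (2 * (C + 1)))"
  have \<eta>: "\<eta> > 0" "\<eta> \<le> h" using \<delta> C h by (auto simp: \<eta>_def)
  have C\<eta>: "C * \<eta> \<le> \<delta> / 2"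
  proof -
    have "C * \<eta> \<le> (C + 1) * (\<delta> / (2 * (C + 1)))" using C \<delta> \<eta> by (intro mult_mono) (auto simp: \<eta>_def)
    also have "\<dots> = \<delta> / 2"
    proof -
      define x where "x = C + 1"
      have "x > 0" using C by (simp add: x_def)
      then show ?thesis unfolding x_def[symmetric] by simp
    qed
    finally show ?thesis .
  qed
  obtain K :: nat where K: "\<And>x. \<exists>j m::int. \<bar>j\<bar> \<le> int K \<and> \<bar>x - (of_int j * a + h * of_int m)\<bar> \<le> \<eta>"
    using dense_shifts[OF irr \<eta>(1)] by blast
  \<comment> \<open>One shift by \<open>a\<close> replaces a single summand and so changes the
    average by at most \<open>2 * b / N\<close>. Up to \<open>K\<close> shifts must together stay
    below \<open>\<delta> / 2\<close>.\<close>
  define N where "N = Suc (nat \<lceil>4 * b * real K / \<delta>\<rceil>)"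
  have N: "N \<ge> 1" "4 * b * real K / \<delta> \<le> real N" unfolding N_def by (simp, linarith)
  have NK: "real K * (2 * b / real N) \<le> \<delta> / 2"
    using N \<delta> by (simp add: field_simps)
  define A where "A v = (\<Sum>i<N. S (v + a * real i)) / real N" for v
  have A1: "\<bar>A (v + a) - A v\<bar> \<le> 2 * b / real N" for v
  proof -
    have "(\<Sum>i<N. S (v + a + a * real i)) - (\<Sum>i<N. S (v + a * real i))
        = (\<Sum>i<N. S (v + a * real (Suc i)) - S (v + a * real i))"
      by (simp add: sum_subtractf algebra_simps)
    also have "\<dots> = S (v + a * real N) - S (v + a * real 0)" by (rule sum_lessThan_telescope)
    finally have "A (v + a) - A v = (S (v + a * real N) - S v) / real N"
      by (simp add: A_def diff_divide_distrib[symmetric])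
    moreover have "\<bar>S (v + a * real N) - S v\<bar> \<le> 2 * b" using b(2)[of "v + a * real N"] b(2)[of v] by linarith
    ultimately show ?thesis using N by (simp add: divide_right_mono)
  qed
  have An: "\<bar>A (v + of_nat j * a) - A v\<bar> \<le> real j * (2 * b / real N)" for v j
  proof (induction j)
    case (Suc j)
    have "A (v + of_nat (Suc j) * a) - A v = (A ((v + of_nat j * a) + a) - A (v + of_nat j * a)) + (A (v + of_nat j * a) - A v)"
      by (simp add: algebra_simps)
    also have "\<bar>\<dots>\<bar> \<le> 2 * b / real N + real j * (2 * b / real N)"
      using A1[of "v + of_nat j * a"] Suc by linarith
    finally show ?case by (simp add: algebra_simps add_divide_distrib)
  qed simp
  have Ai: "\<bar>A (v + of_int j * a) - A v\<bar> \<le> \<delta> / 2" if "\<bar>j\<bar> \<le> int K" for v j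
  proof -
    define i where "i = nat \<bar>j\<bar>"
    have iK: "i \<le> K" using that by (simp add: i_def)
    have "\<bar>A (v + of_int j * a) - A v\<bar> \<le> real i * (2 * b / real N)"
    proof (cases "j \<ge> 0")
      case True
      then have "of_int j = real i" by (simp add: i_def)
      then show ?thesis using An[of v i] by simp
    next
      case False
      then have "of_int j = - real i" by (simp add: i_def)
      then show ?thesis using An[of "v + of_int j * a" i] by (simp add: abs_minus_commute)
    qed
    also have "\<dots> \<le> real K * (2 * b / real N)" using iK b by (intro mult_right_mono) auto
    finally show ?thesis using NK by linarith
  qed
  have Ah: "A (v + h * of_int m) = A v" for v m
  proof -
    have "S (v + h * of_int m + a * real i) = S (v + a * real i)" for i
      using S_shift[of "v + a * real i" m] by (simp add: algebra_simps)
    then show ?thesis by (simp add: A_def)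
  qed
  have Al: "\<bar>A v - A w\<bar> \<le> C * \<eta>" if "\<bar>v - w\<bar> \<le> \<eta>" for v w
  proof -
    have "A v - A w = (\<Sum>i<N. S (v + a * real i) - S (w + a * real i)) / real N"
      unfolding A_def sum_subtractf diff_divide_distrib ..
    then have "\<bar>A v - A w\<bar> = \<bar>\<Sum>i<N. S (v + a * real i) - S (w + a * real i)\<bar> / real N"
      by (simp only: abs_divide abs_of_nat)
    also have "\<dots> \<le> (\<Sum>i<N. C * \<eta>) / real N"
    proof (rule divide_right_mono)
      have "\<bar>S (v + a * real i) - S (w + a * real i)\<bar> \<le> C * \<eta>" for i
      proof -
        have e: "(v + a * real i) - (w + a * real i) = v - w" by simp
        have "\<bar>v - w\<bar> \<le> h" using that \<eta>(2) by linarith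
        then have "\<bar>S (v + a * real i) - S (w + a * real i)\<bar> \<le> C * \<bar>v - w\<bar>"
          using C(2)[of "v + a * real i" "w + a * real i"] unfolding e by blast
        also have "\<dots> \<le> C * \<eta>" by (rule mult_left_mono[OF that C(1)])
        finally show ?thesis .
      qed
      then show "\<bar>\<Sum>i<N. S (v + a * real i) - S (w + a * real i)\<bar> \<le> (\<Sum>i<N. C * \<eta>)"
        by (intro order_trans[OF sum_abs] sum_mono)
    qed simp
    also have "\<dots> = C * \<eta>" using N by simp
    finally show ?thesis .
  qed
  \<comment> \<open>From \<open>v\<close> to \<open>w\<close> in three moves: a multiple of
    \<open>h\<close> changes nothing, at most \<open>K\<close> shifts by \<open>a\<close> cost
    \<open>\<delta> / 2\<close>, and the remaining distance \<eta> costs \<open>\<delta> / 2\<close>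
    by the Lipschitz bound.\<close>
  have osc: "\<bar>A w - A v\<bar> \<le> \<delta>" for v w
  proof -
    obtain j m :: int where jm: "\<bar>j\<bar> \<le> int K" "\<bar>(w - v) - (of_int j * a + h * of_int m)\<bar> \<le> \<eta>" using K by blast
    have "\<bar>A w - A (v + of_int j * a + h * of_int m)\<bar> \<le> C * \<eta>" using jm(2) by (intro Al) (simp add: algebra_simps)
    then show ?thesis using Ai[OF jm(1), of v] C\<eta> unfolding Ah by linarith
  qed
  have Ac: "continuous_on X A" for X
    unfolding A_def using N by (intro continuous_intros continuous_on_compose2[OF S_cont[of UNIV]]) auto
  \<comment> \<open>The mean of \<open>A\<close> over a period is \<open>J\<close>. Oscillating by
    at most \<delta>, \<open>A\<close> stays within \<delta> of its mean.\<close>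
  have Aint: "integral {0..h} A = h * J"
  proof -
    have "integral {0..h} A = integral {0..h} (\<lambda>u. \<Sum>i<N. S (u + a * real i)) / real N"
      unfolding A_def by simp
    also have "integral {0..h} (\<lambda>u. \<Sum>i<N. S (u + a * real i)) = (\<Sum>i<N. integral {0..h} (\<lambda>u. S (u + a * real i)))"
      by (intro integral_sum) (auto intro!: integrable_continuous_real continuous_on_compose2[OF S_cont[of UNIV]] continuous_intros)
    also have "\<dots> = real N * (h * J)" by (simp add: S_mean[OF J])
    finally show ?thesis using N by simp
  qed
  have "\<bar>A v - J\<bar> \<le> \<delta>" for v
  proof -
    have "A u \<le> A v + \<delta>" "A v - \<delta> \<le> A u" for u using osc[of u v] by linarith+
    then have "integral {0..h} A \<le> integral {0..h} (\<lambda>_. A v + \<delta>)" "integral {0..h} (\<lambda>_. A v - \<delta>) \<le> integral {0..h} A"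
      by (intro integral_le integrable_continuous_real Ac continuous_on_const; blast)+
    then have "h * J \<le> h * (A v + \<delta>)" "h * (A v - \<delta>) \<le> h * J" using h by (simp_all add: Aint)
    then show ?thesis using h by (simp add: abs_le_iff)
  qed
  then show ?thesis using N(1) unfolding A_def by blast
qed

end

section \<open>Regularity, support and mass of the trapezoidal kernel\<close>

lemma overlap_lipschitz: "\<bar>overlap a1 a2 b1 b2 x - overlap a1 a2 b1 b2 y\<bar> \<le> \<bar>x - y\<bar>"
  unfolding overlap_def by linarith

lemma overlap_support:
  assumes "\<bar>y\<bar> > \<bar>a1\<bar> + \<bar>a2\<bar> + \<bar>b1\<bar> + \<bar>b2\<bar>"
  shows "overlap a1 a2 b1 b2 y = 0"
proof -
  have "min a2 (y + b2) - max a1 (y + b1) \<le> 0" using assms by linarith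
  then show ?thesis by (simp add: overlap_def)
qed

text \<open>The area of one planar set computed in two ways: its sections at fixed \<open>y\<close>
  have length \<open>overlap a1 a2 b1 b2 y\<close>, those at fixed \<open>s\<close> in
  \<open>{a1..a2}\<close> have length \<open>b2 - b1\<close>.\<close>

lemma overlap_integral:
  assumes a: "a1 \<le> a2" and b: "b1 \<le> b2" and g: "g \<ge> \<bar>a1\<bar> + \<bar>a2\<bar> + \<bar>b1\<bar> + \<bar>b2\<bar>"
  shows "(overlap a1 a2 b1 b2 has_integral (a2 - a1) * (b2 - b1)) {-g..g}"
proof -
  define E where "E = {p \<in> space (lborel \<Otimes>\<^sub>M lborel). a1 \<le> snd p \<and> snd p \<le> a2 \<and> b1 \<le> snd p - fst p \<and> snd p - fst p \<le> (b2::real)}"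
  have E: "E \<in> sets (lborel \<Otimes>\<^sub>M lborel)" unfolding E_def by measurable
  have len: "emeasure lborel {l..u} = ennreal (max 0 (u - l))" for l u :: real
    by (cases "l \<le> u") (auto simp: max_def)
  have "emeasure (lborel \<Otimes>\<^sub>M lborel) E = (\<integral>\<^sup>+y. emeasure lborel (Pair y -` E) \<partial>lborel)"
    by (rule lborel.emeasure_pair_measure_alt[OF E])
  also have "\<dots> = (\<integral>\<^sup>+y. ennreal (overlap a1 a2 b1 b2 y) \<partial>lborel)"
  proof (rule nn_integral_cong)
    fix y :: real
    have "Pair y -` E = {max a1 (y + b1)..min a2 (y + b2)}" by (auto simp: E_def space_pair_measure)
    then show "emeasure lborel (Pair y -` E) = ennreal (overlap a1 a2 b1 b2 y)" by (simp add: len overlap_def)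
  qed
  finally have 1: "emeasure (lborel \<Otimes>\<^sub>M lborel) E = (\<integral>\<^sup>+y. ennreal (overlap a1 a2 b1 b2 y) \<partial>lborel)" .
  have "emeasure (lborel \<Otimes>\<^sub>M lborel) E = (\<integral>\<^sup>+s. emeasure lborel ((\<lambda>y. (y, s)) -` E) \<partial>lborel)"
    by (rule lborel_pair.emeasure_pair_measure_alt2[OF E])
  also have "\<dots> = (\<integral>\<^sup>+s. ennreal (b2 - b1) * indicator {a1..a2} s \<partial>lborel)"
  proof (rule nn_integral_cong)
    fix s :: real
    have "(\<lambda>y. (y, s)) -` E = (if s \<in> {a1..a2} then {s - b2..s - b1} else {})" by (auto simp: E_def space_pair_measure)
    then show "emeasure lborel ((\<lambda>y. (y, s)) -` E) = ennreal (b2 - b1) * indicator {a1..a2} s"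
      using b by auto
  qed
  also have "\<dots> = ennreal ((a2 - a1) * (b2 - b1))"
    using a b by (subst nn_integral_cmult_indicator) (auto simp: ennreal_mult mult.commute)
  finally have nn: "(\<integral>\<^sup>+y. ennreal (overlap a1 a2 b1 b2 y) \<partial>lborel) = ennreal ((a2 - a1) * (b2 - b1))" using 1 by simp
  have hb: "has_bochner_integral lborel (overlap a1 a2 b1 b2) ((a2 - a1) * (b2 - b1))"
    by (rule has_bochner_integral_nn_integral[OF _ _ _ nn]) (use a b in \<open>auto simp: overlap_def\<close>)
  then have "(overlap a1 a2 b1 b2 has_integral (a2 - a1) * (b2 - b1)) UNIV"
    using has_integral_integral_lborel[of "overlap a1 a2 b1 b2"] by (auto simp: has_bochner_integral_iff)
  moreover have "overlap a1 a2 b1 b2 = (\<lambda>y. if y \<in> {-g..g} then overlap a1 a2 b1 b2 y else 0)"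
    using g by (intro ext) (auto intro!: overlap_support)
  ultimately show ?thesis by (metis has_integral_restrict_UNIV)
qed

section \<open>Integrals against the limit measure, and continuous approximation of sets\<close>

context prob_space
begin

text \<open>The lattice measure is infinite but finite on bounded sets, so boundedness and bounded
  support in the last variable suffice.\<close>

lemma integrable_triple:
  fixes \<Phi> :: "'a \<times> 'a \<times> real \<Rightarrow> real"
  assumes h: "h > 0" and meas[measurable]: "\<Phi> \<in> borel_measurable (M \<Otimes>\<^sub>M (M \<Otimes>\<^sub>M lattice_measure h))"
    and bd: "\<And>x y z. x \<in> space M \<Longrightarrow> y \<in> space M \<Longrightarrow> \<bar>\<Phi> (x, y, z)\<bar> \<le> b * indicator {-Z..Z} z"
  shows "integrable (M \<Otimes>\<^sub>M (M \<Otimes>\<^sub>M lattice_measure h)) \<Phi>"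
proof -
  interpret lat: sigma_finite_measure "lattice_measure h" by (rule sigma_finite_lattice[OF h])
  interpret p: pair_sigma_finite M "lattice_measure h" ..
  have fin: "emeasure (M \<Otimes>\<^sub>M (M \<Otimes>\<^sub>M lattice_measure h)) (space M \<times> space M \<times> {-Z..Z}) < \<infinity>"
    using emeasure_lattice_finite[OF h, of Z]
    by (subst p.P.emeasure_pair_measure_Times) (auto simp: lat.emeasure_pair_measure_Times emeasure_space_1)
  show ?thesis
  proof (rule Bochner_Integration.integrable_bound[OF _ meas])
    show "integrable (M \<Otimes>\<^sub>M (M \<Otimes>\<^sub>M lattice_measure h)) (\<lambda>p. b * indicator (space M \<times> space M \<times> {-Z..Z}) p)"
      using fin by (intro integrable_mult_right) simp
    show "AE p in M \<Otimes>\<^sub>M (M \<Otimes>\<^sub>M lattice_measure h). norm (\<Phi> p) \<le> norm (b * indicator (space M \<times> space M \<times> {-Z..Z}) p)"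
    proof (rule AE_I2)
      fix p assume "p \<in> space (M \<Otimes>\<^sub>M (M \<Otimes>\<^sub>M lattice_measure h))"
      then obtain x y z where p: "p = (x, y, z)" "x \<in> space M" "y \<in> space M" by (auto simp: space_pair_measure)
      have "\<bar>\<Phi> (x, y, z)\<bar> \<le> \<bar>b * indicator {-Z..Z} z\<bar>" using bd[OF p(2,3), of z] by linarith
      then show "norm (\<Phi> p) \<le> norm (b * indicator (space M \<times> space M \<times> {-Z..Z}) p)"
        using p by (simp add: indicator_def)
    qed
  qed
qed

text \<open>The lattice variable is moved innermost, where its integral becomes a
  periodization.\<close>

lemma integral_triple:
  fixes \<Phi> :: "'a \<times> 'a \<times> real \<Rightarrow> real"
  assumes h: "h > 0" and meas[measurable]: "\<Phi> \<in> borel_measurable (M \<Otimes>\<^sub>M (M \<Otimes>\<^sub>M lattice_measure h))"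
    and bd: "\<And>x y z. x \<in> space M \<Longrightarrow> y \<in> space M \<Longrightarrow> \<bar>\<Phi> (x, y, z)\<bar> \<le> b * indicator {-Z..Z} z"
  shows "integral\<^sup>L (M \<Otimes>\<^sub>M (M \<Otimes>\<^sub>M lattice_measure h)) \<Phi>
    = (\<integral>p. (\<integral>z. \<Phi> (fst p, snd p, z) \<partial>lattice_measure h) \<partial>(M \<Otimes>\<^sub>M M))"
proof -
  interpret lat: sigma_finite_measure "lattice_measure h" by (rule sigma_finite_lattice[OF h])
  interpret p: pair_sigma_finite M "lattice_measure h" ..
  interpret q: pair_sigma_finite M "M \<Otimes>\<^sub>M lattice_measure h" ..
  interpret mm: pair_prob_space M M ..
  have b: "b \<ge> 0 \<or> Z < 0"
  proof -
    obtain x where "x \<in> space M" using not_empty by blast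
    then show ?thesis using bd[of x x 0] by (auto simp: indicator_def)
  qed
  have zint: "integrable (lattice_measure h) (\<lambda>z. b * indicator {-Z..Z} z)"
    using emeasure_lattice_finite[OF h, of Z] by (intro integrable_mult_right) simp
  define F where "F p = (\<integral>z. \<Phi> (fst p, snd p, z) \<partial>lattice_measure h)" for p
  have mF[measurable]: "F \<in> borel_measurable (M \<Otimes>\<^sub>M M)"
    unfolding F_def by measurable
  have bF: "\<bar>F p\<bar> \<le> (\<integral>z. b * indicator {-Z..Z} z \<partial>lattice_measure h)" if "p \<in> space (M \<Otimes>\<^sub>M M)" for p
  proof -
    have p: "fst p \<in> space M" "snd p \<in> space M" using that by (auto simp: space_pair_measure)
    have m: "(\<lambda>z. \<Phi> (fst p, snd p, z)) \<in> borel_measurable (lattice_measure h)" using p by measurable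
    show ?thesis unfolding F_def
      by (rule integral_abs_bound_integral[OF Bochner_Integration.integrable_bound[OF zint m] zint])
        (use bd[OF p] in \<open>auto intro!: AE_I2 order_trans[OF _ abs_ge_self]\<close>)
  qed
  have iF: "integrable (M \<Otimes>\<^sub>M M) F"
    using bF by (intro mm.P.integrable_const_bound[OF _ mF] AE_I2) auto
  have "integral\<^sup>L (M \<Otimes>\<^sub>M (M \<Otimes>\<^sub>M lattice_measure h)) \<Phi> = (\<integral>x. (\<integral>r. \<Phi> (x, r) \<partial>(M \<Otimes>\<^sub>M lattice_measure h)) \<partial>M)"
    by (rule q.integral_fst'[OF integrable_triple[OF h meas bd], symmetric])
  also have "\<dots> = (\<integral>x. (\<integral>y. F (x, y) \<partial>M) \<partial>M)"
  proof (rule Bochner_Integration.integral_cong[OF refl])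
    fix x assume x: "x \<in> space M"
    have m: "(\<lambda>r. \<Phi> (x, r)) \<in> borel_measurable (M \<Otimes>\<^sub>M lattice_measure h)" using x by measurable
    have fin: "emeasure (M \<Otimes>\<^sub>M lattice_measure h) (space M \<times> {-Z..Z}) < \<infinity>"
      using emeasure_lattice_finite[OF h, of Z] by (simp add: lat.emeasure_pair_measure_Times emeasure_space_1)
    have "integrable (M \<Otimes>\<^sub>M lattice_measure h) (\<lambda>r. \<Phi> (x, r))"
    proof (rule Bochner_Integration.integrable_bound[OF _ m])
      show "integrable (M \<Otimes>\<^sub>M lattice_measure h) (\<lambda>p. b * indicator (space M \<times> {-Z..Z}) p)"
        using fin by (intro integrable_mult_right) simp
      show "AE r in M \<Otimes>\<^sub>M lattice_measure h. norm (\<Phi> (x, r)) \<le> norm (b * indicator (space M \<times> {-Z..Z}) r)"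
      proof (rule AE_I2)
        fix r assume "r \<in> space (M \<Otimes>\<^sub>M lattice_measure h)"
        then obtain y z where r: "r = (y, z)" "y \<in> space M" by (auto simp: space_pair_measure)
        have "\<bar>\<Phi> (x, y, z)\<bar> \<le> \<bar>b * indicator {-Z..Z} z\<bar>" using bd[OF x r(2), of z] by linarith
        then show "norm (\<Phi> (x, r)) \<le> norm (b * indicator (space M \<times> {-Z..Z}) r)"
          using r by (simp add: indicator_def)
      qed
    qed
    from p.integral_fst'[OF this] show "(\<integral>r. \<Phi> (x, r) \<partial>(M \<Otimes>\<^sub>M lattice_measure h)) = (\<integral>y. F (x, y) \<partial>M)"
      by (simp add: F_def)
  qed
  also have "\<dots> = (\<integral>p. F p \<partial>(M \<Otimes>\<^sub>M M))"
    by (rule mm.integral_fst'[OF iF])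
  finally show ?thesis by (simp add: F_def)
qed

lemma integral_prod_fst:
  fixes u v :: "'a \<Rightarrow> real"
  assumes [measurable]: "u \<in> borel_measurable M" "v \<in> borel_measurable M"
    and b: "\<And>x. x \<in> space M \<Longrightarrow> \<bar>u x\<bar> \<le> 1" "\<And>x. x \<in> space M \<Longrightarrow> \<bar>v x\<bar> \<le> 1"
  shows "(\<integral>p. u (fst p) * v (snd p) \<partial>(M \<Otimes>\<^sub>M M)) = (\<integral>x. u x \<partial>M) * (\<integral>y. v y \<partial>M)"
proof -
  interpret mm: pair_prob_space M M ..
  have "integrable (M \<Otimes>\<^sub>M M) (\<lambda>p. u (fst p) * v (snd p))"
  proof (rule mm.P.integrable_const_bound[where B = 1])
    show "AE p in M \<Otimes>\<^sub>M M. norm (u (fst p) * v (snd p)) \<le> 1"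
      using b by (intro AE_I2) (auto simp: space_pair_measure abs_mult intro!: mult_le_one)
  qed measurable
  from mm.integral_fst'[OF this] show ?thesis by simp
qed

text \<open>Regularity gives continuous functions below the indicators of the interior and of the
  exterior of \<open>A\<close>. The second, subtracted from 1, lies above the indicator of
  \<open>A\<close>. As the frontier is null, interior and exterior have total measure 1, and the two
  defects of \<open>e / 2\<close> add up to \<open>e\<close>.\<close>

lemma continuous_approximation:
  assumes bor: "borel_for T M" and reg: "cont_inner_regular T M" and A: "A \<in> sets M"
    and fr: "measure M (T frontier_of A) = 0" and e: "e > 0"
  obtains \<phi> \<psi> where "continuous_map T euclideanreal \<phi>" "continuous_map T euclideanreal \<psi>"
    "\<And>x. x \<in> space M \<Longrightarrow> 0 \<le> \<phi> x \<and> \<phi> x \<le> indicator A x \<and> indicator A x \<le> \<psi> x \<and> \<psi> x \<le> 1"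
    "integral\<^sup>L M \<psi> - integral\<^sup>L M \<phi> \<le> e"
proof -
  have sp: "space M = topspace T" using bor by (simp add: borel_for_def)
  have op: "U \<in> sets M" if "openin T U" for U using bor that by (auto simp: borel_for_def)
  have AT: "A \<subseteq> topspace T" using sets.sets_into_space[OF A] sp by simp
  define U V where "U = T interior_of A" and "V = topspace T - T closure_of A"
  have U: "openin T U" and V: "openin T V" by (auto simp: U_def V_def)
  have UA: "U \<subseteq> A" unfolding U_def by (rule interior_of_subset)
  have VA: "V \<inter> A = {}" using closure_of_subset[OF AT] by (auto simp: V_def)
  have e2: "e / 2 > 0" using e by simp
  obtain \<phi> where \<phi>: "continuous_map T euclideanreal \<phi>" "\<And>x. x \<in> topspace T \<Longrightarrow> 0 \<le> \<phi> x \<and> \<phi> x \<le> indicator U x"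
    "integral\<^sup>L M \<phi> > measure M U - e / 2"
    using reg[unfolded cont_inner_regular_def, rule_format, OF conjI[OF U e2]] by metis
  obtain \<xi> where \<xi>: "continuous_map T euclideanreal \<xi>" "\<And>x. x \<in> topspace T \<Longrightarrow> 0 \<le> \<xi> x \<and> \<xi> x \<le> indicator V x"
    "integral\<^sup>L M \<xi> > measure M V - e / 2"
    using reg[unfolded cont_inner_regular_def, rule_format, OF conjI[OF V e2]] by metis
  have ci: "integrable M \<xi>"
  proof (rule integrable_const_bound)
    show "AE x in M. norm (\<xi> x) \<le> 1"
    proof (rule AE_I2)
      fix x assume "x \<in> space M"
      then show "norm (\<xi> x) \<le> 1" using \<xi>(2)[of x] sp by (cases "x \<in> V") auto
    qed
  qed (rule continuous_map_borel_for[OF bor \<xi>(1)])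
  have "measure M U + measure M V = 1"
  proof -
    have "space M - (U \<union> V) = T frontier_of A"
      by (auto simp: U_def V_def frontier_of_def sp) (use closure_of_subset_topspace in fastforce)+
    then have "measure M (space M - (U \<union> V)) = 0" using fr by simp
    moreover have "measure M (space M - (U \<union> V)) = 1 - measure M (U \<union> V)"
      using op[OF U] op[OF V] by (intro prob_compl) auto
    moreover have "measure M (U \<union> V) = measure M U + measure M V"
      using op[OF U] op[OF V] UA VA by (intro finite_measure_Union) auto
    ultimately show ?thesis by simp
  qed
  moreover have "integral\<^sup>L M (\<lambda>x. 1 - \<xi> x) = 1 - integral\<^sup>L M \<xi>"
    using ci by (simp add: prob_space)
  ultimately have "integral\<^sup>L M (\<lambda>x. 1 - \<xi> x) - integral\<^sup>L M \<phi> \<le> e"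
    using \<phi>(3) \<xi>(3) by linarith
  moreover have "continuous_map T euclideanreal (\<lambda>x. 1 - \<xi> x)"
    by (intro continuous_intros \<xi>(1)) auto
  moreover have "0 \<le> \<phi> x \<and> \<phi> x \<le> indicator A x \<and> indicator A x \<le> 1 - \<xi> x \<and> 1 - \<xi> x \<le> 1" if "x \<in> space M" for x
  proof -
    have x: "x \<in> topspace T" using that sp by simp
    show ?thesis using \<phi>(2)[OF x] \<xi>(2)[OF x] UA VA
      by (cases "x \<in> U"; cases "x \<in> V"; cases "x \<in> A") auto
  qed
  ultimately show ?thesis using \<phi>(1) by (intro that[of \<phi> "\<lambda>x. 1 - \<xi> x"])
qed

end

lemma abs_integral_le:
  fixes u v :: "'a \<Rightarrow> real"
  assumes "integrable M u" "integrable M v" "\<And>x. x \<in> space M \<Longrightarrow> \<bar>u x\<bar> \<le> v x"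
  shows "\<bar>integral\<^sup>L M u\<bar> \<le> integral\<^sup>L M v"
proof -
  have "\<bar>integral\<^sup>L M u\<bar> \<le> (\<integral>x. \<bar>u x\<bar> \<partial>M)" by (rule integral_abs_bound)
  also have "\<dots> \<le> integral\<^sup>L M v" using assms by (intro integral_mono) auto
  finally show ?thesis .
qed

section \<open>The local limit of the passage weights in the periodic case\<close>

context renewal_setting
begin

text \<open>Write \<open>t = w + \<theta>\<close> with \<open>w \<in> s k + h\<int>\<close> and \<open>0 \<le> \<theta> < h\<close>. Uniformity in \<open>\<theta>\<close> comes from a
  finite net, at the cost of the error \<open>\<eta> * \<xi> z\<close> in the test functions.\<close>

lemma local_limit_periodic:
  assumes mllt: "mllt_periodic T M f \<tau> R c \<rho>" and reg: "cont_inner_regular T M"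
    and A: "A \<in> sets M" and B: "B \<in> sets M"
    and frA: "measure M (T frontier_of A) = 0" and frB: "measure M (T frontier_of B) = 0"
    and a: "a1 \<le> a2" and b: "b1 \<le> b2"
  shows "\<exists>H Hb. (\<forall>k t. \<bar>H k t\<bar> \<le> Hb) \<and> local_limit \<rho> (passage_weight A B a1 a2 b1 b2) H \<and>
    (\<forall>\<delta>>0. \<exists>N\<ge>1. \<forall>k t. \<bar>(\<Sum>i<N. H (k + i) t) / real N
        - c * measure M A * measure M B * (a2 - a1) * (b2 - b1)\<bar> \<le> \<delta>)"
proof -
  have bor: "borel_for T M" and c: "c > 0" and \<rho>: "bounded_cont_density \<rho>"
    using mllt by (auto simp: mllt_periodic_def)
  have sp: "space M = topspace T" using bor by (simp add: borel_for_def)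
  define uniform where "uniform \<hh> s h \<phi> \<longleftrightarrow> (\<forall>\<epsilon>>0. \<forall>\<delta>>0. \<forall>\<^sub>F k in sequentially.
       \<forall>v \<in> shifted_lattice s h k \<inter> {0..R (real k) / \<epsilon>}.
         \<bar>R (real k) * integral\<^sup>L (llt_measure M f \<tau> \<hh> k v) \<phi>
           - c * \<rho> (v / R (real k)) * integral\<^sup>L (M \<Otimes>\<^sub>M (M \<Otimes>\<^sub>M lattice_measure h)) \<phi>\<bar> < \<delta>)" for \<hh> s h \<phi>
  obtain \<hh> :: "'a \<Rightarrow> real" and s h :: real where \<hh>: "continuous_map T euclideanreal \<hh>" "bounded (\<hh> ` topspace T)"
    and h: "h > 0" and irr: "s / h \<notin> \<rat>"
    and unif: "\<And>\<phi>. llt_test_function T \<phi> \<Longrightarrow> uniform \<hh> s h \<phi>"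
    using mllt unfolding mllt_periodic_def Let_def uniform_def[symmetric] by blast
  have llt: "\<forall>\<^sub>F k in sequentially.
       \<forall>v \<in> shifted_lattice s h k \<inter> {0..R (real k) / \<epsilon>}.
         \<bar>R (real k) * integral\<^sup>L (llt_measure M f \<tau> \<hh> k v) \<phi>
           - c * \<rho> (v / R (real k)) * integral\<^sup>L (M \<Otimes>\<^sub>M (M \<Otimes>\<^sub>M lattice_measure h)) \<phi>\<bar> < \<delta>"
    if "llt_test_function T \<phi>" "\<epsilon> > 0" "\<delta> > 0" for \<phi> \<epsilon> \<delta>
    using unif[OF that(1), unfolded uniform_def, rule_format, OF that(2,3)] by simp
  have \<hh>m[measurable]: "\<hh> \<in> borel_measurable M" by (rule continuous_map_borel_for[OF bor \<hh>(1)])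
  obtain Hm where Hm: "\<And>x. x \<in> space M \<Longrightarrow> \<bar>\<hh> x\<bar> \<le> Hm"
    using \<hh>(2) unfolding bounded_iff sp by auto
  obtain \<rho>b where \<rho>b: "\<And>z. z \<ge> 0 \<Longrightarrow> 0 \<le> \<rho> z \<and> \<rho> z \<le> \<rho>b"
    using \<rho> by (force simp: bounded_cont_density_def bounded_iff)
  have \<rho>b0: "\<rho>b \<ge> 0" using \<rho>b[of 0] by auto
  have \<rho>c: "continuous_on {0..} \<rho>" using \<rho> by (simp add: bounded_cont_density_def)

  define g where "g = \<bar>a1\<bar> + \<bar>a2\<bar> + \<bar>b1\<bar> + \<bar>b2\<bar>"
  define G where "G = overlap a1 a2 b1 b2"
  define Gm where "Gm = a2 - a1"
  interpret lp: lattice_periodization G h g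
    using h by unfold_locales (auto simp: G_def g_def overlap_lipschitz overlap_support)
  have Gb: "0 \<le> G y" "G y \<le> Gm" for y using a by (auto simp: G_def Gm_def overlap_def)
  have Gm0: "Gm \<ge> 0" using a by (simp add: Gm_def)
  define J where "J = (a2 - a1) * (b2 - b1)"
  have J: "(G has_integral J) {-g..g}" unfolding G_def J_def g_def by (rule overlap_integral[OF a b order_refl])
  obtain Sb where Sb: "Sb \<ge> 0" "\<And>v. \<bar>lp.S v\<bar> \<le> Sb" using lp.S_bounded by blast

  \<comment> \<open>All \<open>z\<close> at which \<open>G\<close> contributes for some phase
    \<theta> in \<open>{0..h}\<close> satisfy \<open>\<bar>z\<bar> \<le> Z - 1\<close>. The extra 1
    lets the continuous cutoff \<xi> fall from 1 to 0.\<close>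
  define Z where "Z = g + 2 * Hm + h + 1"
  define \<xi> where "\<xi> z = max 0 (min 1 (Z - \<bar>z\<bar>))" for z :: real
  have \<xi>m[measurable]: "\<xi> \<in> borel_measurable borel" unfolding \<xi>_def by measurable
  have \<xi>b: "0 \<le> \<xi> z" "\<xi> z \<le> 1" "\<xi> z \<le> indicator {-Z..Z} z" for z
    by (auto simp: \<xi>_def indicator_def abs_le_iff)
  have \<xi>1: "\<xi> z = 1" if "\<bar>z\<bar> \<le> Z - 1" for z using that by (simp add: \<xi>_def)
  define X where "X = (\<integral>z. \<xi> z \<partial>lattice_measure h)"
  have X0: "X \<ge> 0" unfolding X_def using \<xi>b by (intro integral_nonneg_AE AE_I2) auto

  have Gz: "\<bar>z\<bar> \<le> Z - 1" if "G (z + \<hh> x - \<hh> y - \<theta>) \<noteq> 0" "x \<in> space M" "y \<in> space M" "0 \<le> \<theta>" "\<theta> \<le> h" for x y z \<theta>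
  proof -
    have "\<bar>z + \<hh> x - \<hh> y - \<theta>\<bar> \<le> g" using that(1) lp.supp[of "z + \<hh> x - \<hh> y - \<theta>"] by linarith
    then show ?thesis using Hm[OF that(2)] Hm[OF that(3)] that(4,5) unfolding Z_def by linarith
  qed
  have G\<xi>: "G (z + \<hh> x - \<hh> y - \<theta>) \<le> Gm * \<xi> z" if "x \<in> space M" "y \<in> space M" "0 \<le> \<theta>" "\<theta> \<le> h" for x y z \<theta>
  proof (cases "G (z + \<hh> x - \<hh> y - \<theta>) = 0")
    case True
    then show ?thesis using Gm0 \<xi>b(1)[of z] by simp
  next
    case False
    then show ?thesis using \<xi>1[OF Gz[OF False that]] Gb(2) by simp
  qed
  have Gdiff: "\<bar>G (z + \<hh> x - \<hh> y - \<theta>) - G (z + \<hh> x - \<hh> y - \<theta>')\<bar> \<le> \<eta> * \<xi> z"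
    if "x \<in> space M" "y \<in> space M" "0 \<le> \<theta>" "\<theta> \<le> h" "0 \<le> \<theta>'" "\<theta>' \<le> h" "\<bar>\<theta> - \<theta>'\<bar> \<le> \<eta>" for x y z \<theta> \<theta>' \<eta>
  proof (cases "G (z + \<hh> x - \<hh> y - \<theta>) = 0 \<and> G (z + \<hh> x - \<hh> y - \<theta>') = 0")
    case True
    have "0 \<le> \<eta> * \<xi> z" using \<xi>b(1) that(7) by (intro mult_nonneg_nonneg) linarith+
    then show ?thesis using True by simp
  next
    case False
    then have "\<xi> z = 1" using \<xi>1 Gz that by blast
    then show ?thesis
      using lp.lip[of "z + \<hh> x - \<hh> y - \<theta>" "z + \<hh> x - \<hh> y - \<theta>'"] that(7) by simp
  qed

  \<comment> \<open>Adding \<open>\<hh> x - \<hh> y\<close> cancels the coboundary in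
    \<open>llt_map\<close>. With indicators and \<kappa> = 0 this is the integrand of the passage
    weight; with continuous \<phi>, \<psi> and a small \<kappa> of either sign it is a test function
    that tolerates a perturbation of the phase \<theta>.\<close>
  define \<Phi> where "\<Phi> \<phi> \<psi> \<theta> \<kappa> p = \<phi> (fst p) * \<psi> (fst (snd p)) *
    (G (snd (snd p) + \<hh> (fst p) - \<hh> (fst (snd p)) - \<theta>) + \<kappa> * \<xi> (snd (snd p)))" for \<phi> \<psi> :: "'a \<Rightarrow> real" and \<theta> \<kappa> p
  let ?\<Lambda> = "M \<Otimes>\<^sub>M (M \<Otimes>\<^sub>M lattice_measure h)"
  have \<Phi>m: "\<Phi> \<phi> \<psi> \<theta> \<kappa> \<in> borel_measurable (M \<Otimes>\<^sub>M (M \<Otimes>\<^sub>M borel))"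
    if [measurable]: "\<phi> \<in> borel_measurable M" "\<psi> \<in> borel_measurable M" for \<phi> \<psi> \<theta> \<kappa>
    unfolding \<Phi>_def by measurable
  have \<Phi>\<Lambda>: "\<Phi> \<phi> \<psi> \<theta> \<kappa> \<in> borel_measurable ?\<Lambda>"
    if "\<phi> \<in> borel_measurable M" "\<psi> \<in> borel_measurable M" for \<phi> \<psi> \<theta> \<kappa>
  proof -
    have "sets ?\<Lambda> = sets (M \<Otimes>\<^sub>M (M \<Otimes>\<^sub>M borel))" by (intro sets_pair_measure_cong) auto
    then show ?thesis using \<Phi>m[OF that] by (simp cong: measurable_cong_sets)
  qed
  have \<Phi>b: "\<bar>\<Phi> \<phi> \<psi> \<theta> \<kappa> (x, y, z)\<bar> \<le> (Gm + \<bar>\<kappa>\<bar>) * indicator {-Z..Z} z"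
    if "x \<in> space M" "y \<in> space M" "0 \<le> \<theta>" "\<theta> \<le> h" "\<bar>\<phi> x\<bar> \<le> 1" "\<bar>\<psi> y\<bar> \<le> 1" for x y z \<phi> \<psi> \<theta> \<kappa>
  proof -
    have "\<bar>\<Phi> \<phi> \<psi> \<theta> \<kappa> (x, y, z)\<bar> \<le> 1 * 1 * \<bar>G (z + \<hh> x - \<hh> y - \<theta>) + \<kappa> * \<xi> z\<bar>"
      unfolding \<Phi>_def abs_mult using that by (intro mult_mono) auto
    also have "\<dots> \<le> G (z + \<hh> x - \<hh> y - \<theta>) + \<bar>\<kappa>\<bar> * \<xi> z"
      using Gb(1) \<xi>b(1)[of z] abs_triangle_ineq[of "G (z + \<hh> x - \<hh> y - \<theta>)" "\<kappa> * \<xi> z"] by (simp add: abs_mult)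
    also have "\<dots> \<le> (Gm + \<bar>\<kappa>\<bar>) * \<xi> z" using G\<xi>[OF that(1-4)] by (simp add: distrib_right)
    also have "\<dots> \<le> (Gm + \<bar>\<kappa>\<bar>) * indicator {-Z..Z} z" using \<xi>b(3) Gm0 by (intro mult_left_mono) auto
    finally show ?thesis .
  qed
  have \<Phi>i: "integrable ?\<Lambda> (\<Phi> \<phi> \<psi> \<theta> \<kappa>)"
    if "\<phi> \<in> borel_measurable M" "\<psi> \<in> borel_measurable M" "\<And>x. x \<in> space M \<Longrightarrow> \<bar>\<phi> x\<bar> \<le> 1" "\<And>x. x \<in> space M \<Longrightarrow> \<bar>\<psi> x\<bar> \<le> 1"
      "0 \<le> \<theta>" "\<theta> \<le> h" for \<phi> \<psi> \<theta> \<kappa>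
    by (rule integrable_triple[OF h \<Phi>\<Lambda>[OF that(1,2)] \<Phi>b]) (use that in auto)

  have llt_m: "llt_map f \<tau> \<hh> k w \<in> M \<rightarrow>\<^sub>M M \<Otimes>\<^sub>M (M \<Otimes>\<^sub>M borel)" for k w
    unfolding llt_map_def by measurable
  have E\<Phi>: "integral\<^sup>L (llt_measure M f \<tau> \<hh> k w) (\<Phi> \<phi> \<psi> \<theta> \<kappa>) = (\<integral>x. \<Phi> \<phi> \<psi> \<theta> \<kappa> (llt_map f \<tau> \<hh> k w x) \<partial>M)"
    if "\<phi> \<in> borel_measurable M" "\<psi> \<in> borel_measurable M" for \<phi> \<psi> \<theta> \<kappa> k w
    unfolding llt_measure_def by (rule integral_distr[OF llt_m \<Phi>m[OF that]])
  have E\<Phi>i: "integrable M (\<lambda>x. \<Phi> \<phi> \<psi> \<theta> \<kappa> (llt_map f \<tau> \<hh> k w x))"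
    if "\<phi> \<in> borel_measurable M" "\<psi> \<in> borel_measurable M" "\<And>x. x \<in> space M \<Longrightarrow> \<bar>\<phi> x\<bar> \<le> 1" "\<And>x. x \<in> space M \<Longrightarrow> \<bar>\<psi> x\<bar> \<le> 1"
      "0 \<le> \<theta>" "\<theta> \<le> h" for \<phi> \<psi> \<theta> \<kappa> k w
  proof (rule integrable_const_bound[where B = "Gm + \<bar>\<kappa>\<bar>"])
    show "(\<lambda>x. \<Phi> \<phi> \<psi> \<theta> \<kappa> (llt_map f \<tau> \<hh> k w x)) \<in> borel_measurable M"
      by (rule measurable_compose[OF llt_m \<Phi>m[OF that(1,2)]])
    show "AE x in M. norm (\<Phi> \<phi> \<psi> \<theta> \<kappa> (llt_map f \<tau> \<hh> k w x)) \<le> Gm + \<bar>\<kappa>\<bar>"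
    proof (rule AE_I2)
      fix x assume x: "x \<in> space M"
      let ?z = "S k x - \<hh> x + \<hh> ((f ^^ k) x) - w"
      have "\<bar>\<Phi> \<phi> \<psi> \<theta> \<kappa> (x, (f ^^ k) x, ?z)\<bar> \<le> (Gm + \<bar>\<kappa>\<bar>) * indicator {-Z..Z} ?z"
        by (rule \<Phi>b) (use x iter_space[OF x] that in auto)
      also have "\<dots> \<le> Gm + \<bar>\<kappa>\<bar>" using Gm0 by (auto simp: indicator_def)
      finally show "norm (\<Phi> \<phi> \<psi> \<theta> \<kappa> (llt_map f \<tau> \<hh> k w x)) \<le> Gm + \<bar>\<kappa>\<bar>" by (simp add: llt_map_def)
    qed
  qed

  have test: "llt_test_function T (\<Phi> \<phi> \<psi> \<theta> \<kappa>)"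
    if ct: "continuous_map T euclideanreal \<phi>" "continuous_map T euclideanreal \<psi>"
      and bd: "\<And>x. x \<in> space M \<Longrightarrow> \<bar>\<phi> x\<bar> \<le> 1" "\<And>x. x \<in> space M \<Longrightarrow> \<bar>\<psi> x\<bar> \<le> 1" and \<theta>: "0 \<le> \<theta>" "\<theta> \<le> h" for \<phi> \<psi> \<theta> \<kappa>
    unfolding llt_test_function_def
  proof (intro conjI exI[of _ "{-Z..Z}"] ballI allI impI)
    let ?TT = "prod_topology T (prod_topology T euclideanreal)"
    have p1: "continuous_map ?TT T fst" by (rule continuous_map_fst)
    have p2: "continuous_map ?TT T (\<lambda>p. fst (snd p))"
      using continuous_map_compose[OF continuous_map_snd continuous_map_fst, of T T euclideanreal] by (simp add: comp_def)
    have p3: "continuous_map ?TT euclideanreal (\<lambda>p. snd (snd p))"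
      using continuous_map_compose[OF continuous_map_snd continuous_map_snd, of T T euclideanreal] by (simp add: comp_def)
    have cG: "continuous_map euclideanreal euclideanreal G" using lp.cont[of UNIV] by simp
    have c\<xi>: "continuous_map euclideanreal euclideanreal \<xi>"
      unfolding \<xi>_def continuous_map_iff_continuous2 by (intro continuous_intros)
    have comp: "continuous_map ?TT euclideanreal (\<lambda>p. u (q p))"
      if "continuous_map ?TT Y q" "continuous_map Y euclideanreal u" for Y :: "'z topology" and q u
      using continuous_map_compose[OF that] by (simp add: comp_def)
    show "continuous_map ?TT euclideanreal (\<Phi> \<phi> \<psi> \<theta> \<kappa>)"
      unfolding \<Phi>_def
      by (intro continuous_map_real_mult continuous_map_add continuous_map_diff
          comp[OF p1 ct(1)] comp[OF p2 ct(2)] comp[OF _ cG] comp[OF p3 c\<xi>] comp[OF p1 \<hh>(1)] comp[OF p2 \<hh>(1)] p3)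
        auto
    show "bounded (\<Phi> \<phi> \<psi> \<theta> \<kappa> ` (topspace T \<times> topspace T \<times> UNIV))"
      unfolding bounded_iff
    proof (intro exI[of _ "Gm + \<bar>\<kappa>\<bar>"] ballI)
      fix r assume "r \<in> \<Phi> \<phi> \<psi> \<theta> \<kappa> ` (topspace T \<times> topspace T \<times> UNIV)"
      then obtain x y z where r: "r = \<Phi> \<phi> \<psi> \<theta> \<kappa> (x, y, z)" and xy: "x \<in> space M" "y \<in> space M" by (auto simp: sp)
      have "\<bar>\<Phi> \<phi> \<psi> \<theta> \<kappa> (x, y, z)\<bar> \<le> (Gm + \<bar>\<kappa>\<bar>) * indicator {-Z..Z} z" by (rule \<Phi>b) (use xy \<theta> bd in auto)
      also have "\<dots> \<le> Gm + \<bar>\<kappa>\<bar>" using Gm0 by (auto simp: indicator_def)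
      finally show "norm r \<le> Gm + \<bar>\<kappa>\<bar>" by (simp add: r)
    qed
    show "compact {-Z..Z}" by simp
    fix x y z assume "x \<in> topspace T" "y \<in> topspace T" and z: "z \<notin> {-Z..Z}"
    then have xy: "x \<in> space M" "y \<in> space M" by (auto simp: sp)
    have "\<bar>\<Phi> \<phi> \<psi> \<theta> \<kappa> (x, y, z)\<bar> \<le> (Gm + \<bar>\<kappa>\<bar>) * indicator {-Z..Z} z" by (rule \<Phi>b) (use xy \<theta> bd in auto)
    then show "\<Phi> \<phi> \<psi> \<theta> \<kappa> (x, y, z) = 0" using z by simp
  qed

  let ?iA = "indicator A :: 'a \<Rightarrow> real" and ?iB = "indicator B :: 'a \<Rightarrow> real"
  have im: "?iA \<in> borel_measurable M" "?iB \<in> borel_measurable M" using A B by auto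
  have i1: "\<bar>?iA x\<bar> \<le> 1" "\<bar>?iB x\<bar> \<le> 1" for x by (auto simp: indicator_def)
  interpret mm: pair_prob_space M M ..

  define q where "q p = \<hh> (fst p) - \<hh> (snd p)" for p
  have qm[measurable]: "q \<in> borel_measurable (M \<Otimes>\<^sub>M M)" unfolding q_def by measurable
  \<comment> \<open>For phases in \<open>{0..h}\<close> this is the limit integral of \<Phi> with
    the two indicators. Written through the periodization it makes sense for every real phase and is
    visibly periodic.\<close>
  define Ht where "Ht \<theta> = (\<integral>p. ?iA (fst p) * ?iB (snd p) * lp.S (q p - \<theta>) \<partial>(M \<Otimes>\<^sub>M M))" for \<theta>
  have Hti: "integrable (M \<Otimes>\<^sub>M M) (\<lambda>p. ?iA (fst p) * ?iB (snd p) * lp.S (q p - \<theta>))" for \<theta>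
  proof (rule mm.P.integrable_const_bound[where B = Sb])
    have "\<bar>?iA (fst p) * ?iB (snd p) * lp.S (q p - \<theta>)\<bar> \<le> 1 * 1 * Sb" for p
      unfolding abs_mult using i1 Sb by (intro mult_mono) auto
    then show "AE p in M \<Otimes>\<^sub>M M. norm (?iA (fst p) * ?iB (snd p) * lp.S (q p - \<theta>)) \<le> Sb" by simp
    show "(\<lambda>p. ?iA (fst p) * ?iB (snd p) * lp.S (q p - \<theta>)) \<in> borel_measurable (M \<Otimes>\<^sub>M M)"
      using A B by measurable
  qed
  have Htb: "\<bar>Ht \<theta>\<bar> \<le> Sb" for \<theta>
  proof -
    have "\<bar>?iA (fst p) * ?iB (snd p) * lp.S (q p - \<theta>)\<bar> \<le> 1 * 1 * Sb" for p
      unfolding abs_mult using i1 Sb by (intro mult_mono) auto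
    then have "\<bar>Ht \<theta>\<bar> \<le> (\<integral>p. Sb \<partial>(M \<Otimes>\<^sub>M M))"
      unfolding Ht_def by (intro abs_integral_le Hti) auto
    then show ?thesis by (simp add: mm.P.prob_space)
  qed
  have Htper: "Ht (\<theta> + h * of_int m) = Ht \<theta>" for \<theta> m
  proof -
    have "lp.S (q p - (\<theta> + h * of_int m)) = lp.S (q p - \<theta>)" for p
      using lp.S_shift[of "q p - \<theta>" "-m"] by (simp add: algebra_simps)
    then show ?thesis by (simp add: Ht_def)
  qed
  have Ht\<Lambda>: "integral\<^sup>L ?\<Lambda> (\<Phi> ?iA ?iB \<theta> 0) = Ht \<theta>" if \<theta>: "0 \<le> \<theta>" "\<theta> \<le> h" for \<theta>
  proof -
    have "integral\<^sup>L ?\<Lambda> (\<Phi> ?iA ?iB \<theta> 0) = (\<integral>p. (\<integral>z. \<Phi> ?iA ?iB \<theta> 0 (fst p, snd p, z) \<partial>lattice_measure h) \<partial>(M \<Otimes>\<^sub>M M))"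
      by (rule integral_triple[OF h \<Phi>\<Lambda>[OF im] \<Phi>b]) (use \<theta> i1 in auto)
    also have "\<dots> = Ht \<theta>"
      unfolding Ht_def by (intro Bochner_Integration.integral_cong refl) (simp add: \<Phi>_def lp.S_def q_def add_diff_eq)
    finally show ?thesis .
  qed

  \<comment> \<open>The phase of \<open>t\<close> relative to the coset
    \<open>s * k + h\<int>\<close>; periodicity of \<open>Ht\<close> makes its reduction modulo
    \<open>h\<close> immaterial.\<close>
  define H where "H k t = c * Ht (t - s * real k)" for k :: nat and t
  have Hb: "\<bar>H k t\<bar> \<le> c * Sb" for k t using Htb c by (simp add: H_def abs_mult)
  have avg: "\<exists>N\<ge>1. \<forall>k t. \<bar>(\<Sum>i<N. H (k + i) t) / real N - c * measure M A * measure M B * (a2 - a1) * (b2 - b1)\<bar> \<le> \<delta>"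
    if \<delta>: "\<delta> > 0" for \<delta>
  proof -
    obtain N where N: "N \<ge> 1" "\<And>v. \<bar>(\<Sum>i<N. lp.S (v + s * real i)) / real N - J\<bar> \<le> \<delta> / c"
      using lp.uniform_averages[OF irr J, of "\<delta> / c"] \<delta> c by auto
    show ?thesis
    proof (intro exI[of _ N] conjI N(1) allI)
      fix k t
      let ?w = "\<lambda>p. ?iA (fst p) * ?iB (snd p)"
      have wint: "integrable (M \<Otimes>\<^sub>M M) ?w"
      proof (rule mm.P.integrable_const_bound[where B = 1])
        show "AE p in M \<Otimes>\<^sub>M M. norm (?w p) \<le> 1" by (simp add: indicator_def)
        show "?w \<in> borel_measurable (M \<Otimes>\<^sub>M M)" using A B by measurable
      qed
      have wval: "(\<integral>p. ?w p \<partial>(M \<Otimes>\<^sub>M M)) = measure M A * measure M B"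
      proof -
        have "(\<integral>p. ?w p \<partial>(M \<Otimes>\<^sub>M M)) = (\<integral>x. ?iA x \<partial>M) * (\<integral>x. ?iB x \<partial>M)"
          by (rule integral_prod_fst[OF im i1])
        then show ?thesis using sets.sets_into_space[OF A] sets.sets_into_space[OF B] by (simp add: inf_absorb1)
      qed
      \<comment> \<open>Advancing \<open>k\<close> by \<open>i\<close> moves the phase by
        \<open>s * i\<close>, so blocks in \<open>k\<close> turn into the averages of
        \<open>uniform_averages\<close>, whose uniformity covers all \<open>p\<close>,
        \<open>k\<close> and \<open>t\<close>.\<close>
      define v where "v p = q p - (t - s * real k)" for p
      have "(\<Sum>i<N. Ht (t - s * real (k + i))) / real N = (\<integral>p. (\<Sum>i<N. ?w p * lp.S (q p - (t - s * real (k + i)))) / real N \<partial>(M \<Otimes>\<^sub>M M))"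
        unfolding Ht_def using Hti by (simp add: Bochner_Integration.integral_sum)
      also have "\<dots> = (\<integral>p. ?w p * ((\<Sum>i<N. lp.S (v p + s * real i)) / real N) \<partial>(M \<Otimes>\<^sub>M M))"
        by (intro Bochner_Integration.integral_cong refl) (simp add: sum_distrib_left v_def algebra_simps)
      finally have e1: "(\<Sum>i<N. Ht (t - s * real (k + i))) / real N = (\<integral>p. ?w p * ((\<Sum>i<N. lp.S (v p + s * real i)) / real N) \<partial>(M \<Otimes>\<^sub>M M))" .
      have i1': "integrable (M \<Otimes>\<^sub>M M) (\<lambda>p. ?w p * ((\<Sum>i<N. lp.S (v p + s * real i)) / real N))"
      proof (rule mm.P.integrable_const_bound[where B = "\<bar>J\<bar> + \<delta> / c"])
        have "\<bar>?w p * ((\<Sum>i<N. lp.S (v p + s * real i)) / real N)\<bar> \<le> 1 * (\<bar>J\<bar> + \<delta> / c)" for p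
          unfolding abs_mult[of "?w p"] using N(2)[of "v p"] by (intro mult_mono) (auto simp: indicator_def)
        then show "AE p in M \<Otimes>\<^sub>M M. norm (?w p * ((\<Sum>i<N. lp.S (v p + s * real i)) / real N)) \<le> \<bar>J\<bar> + \<delta> / c" by simp
        show "(\<lambda>p. ?w p * ((\<Sum>i<N. lp.S (v p + s * real i)) / real N)) \<in> borel_measurable (M \<Otimes>\<^sub>M M)"
          unfolding v_def using A B by measurable
      qed
      have i2': "integrable (M \<Otimes>\<^sub>M M) (\<lambda>p. ?w p * J)" using wint by (rule integrable_mult_left)
      have "\<bar>(\<Sum>i<N. Ht (t - s * real (k + i))) / real N - measure M A * measure M B * J\<bar>
          = \<bar>\<integral>p. ?w p * ((\<Sum>i<N. lp.S (v p + s * real i)) / real N) - ?w p * J \<partial>(M \<Otimes>\<^sub>M M)\<bar>"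
        unfolding e1 using i1' i2' wval by simp
      also have "\<dots> \<le> (\<integral>p. \<delta> / c \<partial>(M \<Otimes>\<^sub>M M))"
      proof (rule abs_integral_le)
        show "integrable (M \<Otimes>\<^sub>M M) (\<lambda>p. ?w p * ((\<Sum>i<N. lp.S (v p + s * real i)) / real N) - ?w p * J)"
          using i1' i2' by (rule Bochner_Integration.integrable_diff)
        fix p
        have "\<bar>?w p * ((\<Sum>i<N. lp.S (v p + s * real i)) / real N - J)\<bar> \<le> 1 * (\<delta> / c)"
          unfolding abs_mult[of "?w p"] using N(2)[of "v p"] by (intro mult_mono) (auto simp: indicator_def)
        then show "\<bar>?w p * ((\<Sum>i<N. lp.S (v p + s * real i)) / real N) - ?w p * J\<bar> \<le> \<delta> / c"
          by (simp only: right_diff_distrib mult_1)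
      qed simp
      also have "\<dots> = \<delta> / c" by (simp add: mm.P.prob_space)
      finally have "c * \<bar>(\<Sum>i<N. Ht (t - s * real (k + i))) / real N - measure M A * measure M B * J\<bar> \<le> c * (\<delta> / c)"
        using c by (intro mult_left_mono) auto
      moreover have "c * \<bar>(\<Sum>i<N. Ht (t - s * real (k + i))) / real N - measure M A * measure M B * J\<bar>
        = \<bar>c * ((\<Sum>i<N. Ht (t - s * real (k + i))) / real N - measure M A * measure M B * J)\<bar>"
        using c by (simp add: abs_mult)
      moreover have "c * ((\<Sum>i<N. Ht (t - s * real (k + i))) / real N - measure M A * measure M B * J)
        = (\<Sum>i<N. H (k + i) t) / real N - c * measure M A * measure M B * (a2 - a1) * (b2 - b1)"
        unfolding H_def sum_distrib_left[symmetric] J_def by (simp add: right_diff_distrib[of c] mult.assoc)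
      ultimately show "\<bar>(\<Sum>i<N. H (k + i) t) / real N - c * measure M A * measure M B * (a2 - a1) * (b2 - b1)\<bar> \<le> \<delta>"
        using c by simp
    qed
  qed
  have "local_limit \<rho> (passage_weight A B a1 a2 b1 b2) H"
    unfolding local_limit_def
  proof (intro allI impI)
    fix \<epsilon> \<delta> :: real assume \<epsilon>: "\<epsilon> > 0" and \<delta>: "\<delta> > 0"
    \<comment> \<open>\<open>D\<close> is the admissible gap between the limit integrals of the
      upper and the lower test function. Weighted by \<open>c * \<rho>\<close> it costs
      \<open>\<delta> / 4\<close>; the local limit theorem and the modulus of continuity of \<rho>
      cost \<open>\<delta> / 4\<close> each.\<close>
    define D where "D = \<delta> / (4 * (c * \<rho>b + 1))"
    have c\<rho>: "c * \<rho>b + 1 > 0" using c \<rho>b0 by (simp add: add_nonneg_pos)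
    have D: "D > 0" "c * \<rho>b * D \<le> \<delta> / 4"
    proof -
      define x where "x = c * \<rho>b + 1"
      have x: "x > 0" "c * \<rho>b \<le> x" using c\<rho> by (auto simp: x_def)
      have Dx: "D = \<delta> / (4 * x)" by (simp add: D_def x_def)
      show "D > 0" using \<delta> x by (simp add: Dx)
      then have "c * \<rho>b * D \<le> x * D" using x by (intro mult_right_mono) auto
      also have "\<dots> = \<delta> / 4" using x by (simp add: Dx)
      finally show "c * \<rho>b * D \<le> \<delta> / 4" .
    qed
    \<comment> \<open>The gap turns out to be at most \<open>(2 * e * Gm + 2 * \<eta>) * X\<close>:
      \<eta> comes from the phase, \<open>e\<close> from approximating each of the two sets. Each
      source receives \<open>D / 2\<close>.\<close>
    define \<eta> where "\<eta> = D / (4 * (X + 1))"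
    define e where "e = D / (4 * ((Gm + 1) * (X + 1)))"
    have \<eta>: "\<eta> > 0" and e: "e > 0" using D X0 Gm0 by (auto simp: \<eta>_def e_def)
    have gap: "(2 * e * Gm + 2 * \<eta>) * X \<le> D"
    proof -
      define x y where "x = X + 1" and "y = Gm + 1"
      have xy: "x > 0" "y > 0" "X \<le> x" "Gm \<le> y" using X0 Gm0 by (auto simp: x_def y_def)
      have ex: "e = D / (4 * (y * x))" "\<eta> = D / (4 * x)" by (auto simp: e_def \<eta>_def x_def y_def)
      have "(2 * e * Gm + 2 * \<eta>) * X \<le> (2 * e * y + 2 * \<eta>) * x"
        using xy e \<eta> X0 Gm0 by (intro mult_mono add_mono mult_left_mono) auto
      also have "\<dots> = D" using xy by (simp add: ex field_simps)
      finally show ?thesis .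
    qed
    obtain \<phi>A \<psi>A where cA: "continuous_map T euclideanreal \<phi>A" "continuous_map T euclideanreal \<psi>A"
      and bA: "\<And>x. x \<in> space M \<Longrightarrow> 0 \<le> \<phi>A x \<and> \<phi>A x \<le> indicator A x \<and> indicator A x \<le> \<psi>A x \<and> \<psi>A x \<le> 1"
      and eA: "integral\<^sup>L M \<psi>A - integral\<^sup>L M \<phi>A \<le> e"
      using continuous_approximation[OF bor reg A frA e] by metis
    obtain \<phi>B \<psi>B where cB: "continuous_map T euclideanreal \<phi>B" "continuous_map T euclideanreal \<psi>B"
      and bB: "\<And>x. x \<in> space M \<Longrightarrow> 0 \<le> \<phi>B x \<and> \<phi>B x \<le> indicator B x \<and> indicator B x \<le> \<psi>B x \<and> \<psi>B x \<le> 1"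
      and eB: "integral\<^sup>L M \<psi>B - integral\<^sup>L M \<phi>B \<le> e"
      using continuous_approximation[OF bor reg B frB e] by metis
    note mA[measurable] = continuous_map_borel_for[OF bor cA(1)] continuous_map_borel_for[OF bor cA(2)]
    note mB[measurable] = continuous_map_borel_for[OF bor cB(1)] continuous_map_borel_for[OF bor cB(2)]
    have ind01: "0 \<le> indicat_real E x" "indicat_real E x \<le> 1" for E :: "'a set" and x by (auto simp: indicator_def)
    have b1: "\<bar>\<phi>A x\<bar> \<le> 1" "\<bar>\<psi>A x\<bar> \<le> 1" "\<bar>\<phi>B x\<bar> \<le> 1" "\<bar>\<psi>B x\<bar> \<le> 1" if "x \<in> space M" for x
      using bA[OF that] bB[OF that] ind01[of A x] ind01[of B x] by (auto simp: abs_le_iff)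
    \<comment> \<open>Moving the phase from \<theta> to \<theta>' changes \<open>G\<close> by at
      most \<open>\<eta> * \<xi> z\<close>, which the last parameter of \<Phi> compensates. The set
      approximations point the same way because \<open>G\<close> is nonnegative at \<theta>.\<close>
    have sand: "\<Phi> \<phi>A \<phi>B \<theta>' (-\<eta>) (x, y, z) \<le> \<Phi> ?iA ?iB \<theta> 0 (x, y, z) \<and> \<Phi> ?iA ?iB \<theta> 0 (x, y, z) \<le> \<Phi> \<psi>A \<psi>B \<theta>' \<eta> (x, y, z)"
      if xy: "x \<in> space M" "y \<in> space M" and \<theta>: "0 \<le> \<theta>" "\<theta> \<le> h" "0 \<le> \<theta>'" "\<theta>' \<le> h" "\<bar>\<theta> - \<theta>'\<bar> \<le> \<eta>" for x y z \<theta> \<theta>'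
    proof -
      define G0 G1 where "G0 = G (z + \<hh> x - \<hh> y - \<theta>)" and "G1 = G (z + \<hh> x - \<hh> y - \<theta>')"
      have d: "\<bar>G0 - G1\<bar> \<le> \<eta> * \<xi> z" unfolding G0_def G1_def by (rule Gdiff[OF xy \<theta>])
      have G00: "G0 \<ge> 0" unfolding G0_def by (rule Gb)
      have bx: "0 \<le> \<phi>A x" "\<phi>A x \<le> ?iA x" "?iA x \<le> \<psi>A x" "0 \<le> \<phi>B y" "\<phi>B y \<le> ?iB y" "?iB y \<le> \<psi>B y"
        using bA[OF xy(1)] bB[OF xy(2)] by auto
      have p1: "\<phi>A x * \<phi>B y \<le> ?iA x * ?iB y" using bx by (intro mult_mono) auto
      have p2: "?iA x * ?iB y \<le> \<psi>A x * \<psi>B y" using bx ind01 by (intro mult_mono) (auto intro: order_trans)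
      have p0: "0 \<le> \<phi>A x * \<phi>B y" "0 \<le> \<psi>A x * \<psi>B y" using bx ind01[of A x] ind01[of B y] by (auto intro!: mult_nonneg_nonneg intro: order_trans)
      have "\<phi>A x * \<phi>B y * (G1 + - \<eta> * \<xi> z) \<le> \<phi>A x * \<phi>B y * G0"
        using d p0 by (intro mult_left_mono) auto
      also have "\<dots> \<le> ?iA x * ?iB y * G0" using p1 G00 by (rule mult_right_mono)
      finally have l: "\<phi>A x * \<phi>B y * (G1 + - \<eta> * \<xi> z) \<le> ?iA x * ?iB y * G0" .
      have "?iA x * ?iB y * G0 \<le> \<psi>A x * \<psi>B y * G0" using p2 G00 by (rule mult_right_mono)
      also have "\<dots> \<le> \<psi>A x * \<psi>B y * (G1 + \<eta> * \<xi> z)"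
        using d p0 by (intro mult_left_mono) auto
      finally have u: "?iA x * ?iB y * G0 \<le> \<psi>A x * \<psi>B y * (G1 + \<eta> * \<xi> z)" .
      show ?thesis using l u by (simp add: \<Phi>_def G0_def G1_def)
    qed
    have gapI: "integral\<^sup>L ?\<Lambda> (\<Phi> \<psi>A \<psi>B \<theta> \<eta>) - integral\<^sup>L ?\<Lambda> (\<Phi> \<phi>A \<phi>B \<theta> (-\<eta>)) \<le> D"
      if \<theta>: "0 \<le> \<theta>" "\<theta> \<le> h" for \<theta>
    proof -
      define uA uB where "uA x = \<psi>A x - \<phi>A x" and "uB x = \<psi>B x - \<phi>B x" for x
      have um[measurable]: "uA \<in> borel_measurable M" "uB \<in> borel_measurable M" unfolding uA_def uB_def by measurable
      have ub: "0 \<le> uA x" "uA x \<le> 1" "0 \<le> uB x" "uB x \<le> 1" if "x \<in> space M" for x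
        using bA[OF that] bB[OF that] by (auto simp: uA_def uB_def)
      \<comment> \<open>Majorant for the difference of the two test functions: the change of the
        product of the two weights is at most \<open>uA + uB\<close>, \<open>G\<close> is at most
        \<open>Gm * \<xi>\<close>, and the two corrections contribute
        \<open>2 * \<eta> * \<xi>\<close>.\<close>
      define \<Theta> where "\<Theta> p = ((uA (fst p) + uB (fst (snd p))) * Gm + 2 * \<eta>) * \<xi> (snd (snd p))" for p :: "'a \<times> 'a \<times> real"
      have \<Theta>m: "\<Theta> \<in> borel_measurable ?\<Lambda>" unfolding \<Theta>_def by measurable
      have \<Theta>b: "\<bar>\<Theta> (x, y, z)\<bar> \<le> (2 * Gm + 2 * \<eta>) * indicator {-Z..Z} z" if xy: "x \<in> space M" "y \<in> space M" for x y z
      proof -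
        have "0 \<le> (uA x + uB y) * Gm" using ub[OF xy(1)] ub[OF xy(2)] Gm0 by (intro mult_nonneg_nonneg) auto
        then have n0: "0 \<le> (uA x + uB y) * Gm + 2 * \<eta>" using \<eta> by linarith
        have "\<bar>\<Theta> (x, y, z)\<bar> = ((uA x + uB y) * Gm + 2 * \<eta>) * \<xi> z"
          using n0 \<xi>b(1)[of z] by (simp add: \<Theta>_def abs_mult)
        also have "\<dots> \<le> (2 * Gm + 2 * \<eta>) * indicator {-Z..Z} z"
          using ub[OF xy(1)] ub[OF xy(2)] Gm0 \<eta> \<xi>b by (intro mult_mono add_mono mult_right_mono) auto
        finally show ?thesis .
      qed
      have le: "\<Phi> \<psi>A \<psi>B \<theta> \<eta> p - \<Phi> \<phi>A \<phi>B \<theta> (-\<eta>) p \<le> \<Theta> p" if p: "p \<in> space ?\<Lambda>" for p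
      proof -
        obtain x y z where pe: "p = (x, y, z)" and xy: "x \<in> space M" "y \<in> space M" using p by (auto simp: space_pair_measure)
        define G1 where "G1 = G (z + \<hh> x - \<hh> y - \<theta>)"
        have G1: "0 \<le> G1" "G1 \<le> Gm * \<xi> z" unfolding G1_def using Gb G\<xi>[OF xy \<theta>] by auto
        define F1 F2 where "F1 = \<psi>A x * \<psi>B y" and "F2 = \<phi>A x * \<phi>B y"
        have bx: "0 \<le> \<phi>A x" "\<phi>A x \<le> \<psi>A x" "\<psi>A x \<le> 1" "0 \<le> \<phi>B y" "\<phi>B y \<le> \<psi>B y" "\<psi>B y \<le> 1"
          using bA[OF xy(1)] bB[OF xy(2)] by auto
        have F: "F1 \<le> 1" "F2 \<le> 1" unfolding F1_def F2_def using bx by (auto intro!: mult_le_one)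
        have "F1 - F2 = \<psi>A x * uB y + uA x * \<phi>B y" by (simp add: F1_def F2_def uA_def uB_def algebra_simps)
        also have "\<dots> \<le> 1 * uB y + uA x * 1" using bx ub[OF xy(1)] ub[OF xy(2)] by (intro add_mono mult_mono) auto
        finally have F12: "F1 - F2 \<le> uA x + uB y" by simp
        have "F1 * (G1 + \<eta> * \<xi> z) - F2 * (G1 + - \<eta> * \<xi> z) = (F1 - F2) * G1 + (F1 + F2) * (\<eta> * \<xi> z)"
          by (simp add: algebra_simps)
        also have "\<dots> \<le> (uA x + uB y) * (Gm * \<xi> z) + (1 + 1) * (\<eta> * \<xi> z)"
        proof (rule add_mono)
          have "(F1 - F2) * G1 \<le> (uA x + uB y) * G1" using F12 G1(1) by (rule mult_right_mono)
          also have "\<dots> \<le> (uA x + uB y) * (Gm * \<xi> z)" using G1(2) ub[OF xy(1)] ub[OF xy(2)] by (intro mult_left_mono) auto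
          finally show "(F1 - F2) * G1 \<le> (uA x + uB y) * (Gm * \<xi> z)" .
          show "(F1 + F2) * (\<eta> * \<xi> z) \<le> (1 + 1) * (\<eta> * \<xi> z)" using F \<eta> \<xi>b(1)[of z] by (intro mult_right_mono add_mono) auto
        qed
        finally show ?thesis by (simp add: pe \<Phi>_def \<Theta>_def F1_def F2_def G1_def algebra_simps)
      qed
      have iP: "integrable ?\<Lambda> (\<Phi> \<psi>A \<psi>B \<theta> \<eta>)" by (rule \<Phi>i) (use mA mB b1 \<theta> in auto)
      have iN: "integrable ?\<Lambda> (\<Phi> \<phi>A \<phi>B \<theta> (-\<eta>))" by (rule \<Phi>i) (use mA mB b1 \<theta> in auto)
      have "integral\<^sup>L ?\<Lambda> (\<Phi> \<psi>A \<psi>B \<theta> \<eta>) - integral\<^sup>L ?\<Lambda> (\<Phi> \<phi>A \<phi>B \<theta> (-\<eta>))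
          = (\<integral>p. \<Phi> \<psi>A \<psi>B \<theta> \<eta> p - \<Phi> \<phi>A \<phi>B \<theta> (-\<eta>) p \<partial>?\<Lambda>)"
        using iP iN by simp
      also have "\<dots> \<le> integral\<^sup>L ?\<Lambda> \<Theta>"
        using iP iN integrable_triple[OF h \<Theta>m \<Theta>b] le by (intro integral_mono Bochner_Integration.integrable_diff)
      also have "\<dots> = (\<integral>p. (\<integral>z. \<Theta> (fst p, snd p, z) \<partial>lattice_measure h) \<partial>(M \<Otimes>\<^sub>M M))"
        by (rule integral_triple[OF h \<Theta>m \<Theta>b])
      also have "\<dots> = (\<integral>p. (uA (fst p) * Gm + uB (snd p) * Gm + 2 * \<eta>) * X \<partial>(M \<Otimes>\<^sub>M M))"
        by (intro Bochner_Integration.integral_cong refl) (simp add: \<Theta>_def X_def distrib_right[of _ _ Gm])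
      also have "\<dots> = ((\<integral>p. uA (fst p) \<partial>(M \<Otimes>\<^sub>M M)) * Gm + (\<integral>p. uB (snd p) \<partial>(M \<Otimes>\<^sub>M M)) * Gm + 2 * \<eta>) * X"
      proof -
        have "integrable (M \<Otimes>\<^sub>M M) (\<lambda>p. uA (fst p))" "integrable (M \<Otimes>\<^sub>M M) (\<lambda>p. uB (snd p))"
          using ub by (auto intro!: mm.P.integrable_const_bound[where B = 1] AE_I2 simp: space_pair_measure)
        then show ?thesis by (simp add: mm.P.prob_space)
      qed
      also have "(\<integral>p. uA (fst p) \<partial>(M \<Otimes>\<^sub>M M)) = integral\<^sup>L M \<psi>A - integral\<^sup>L M \<phi>A"
      proof -
        have "(\<integral>p. uA (fst p) * 1 \<partial>(M \<Otimes>\<^sub>M M)) = (\<integral>x. uA x \<partial>M) * (\<integral>x. 1 \<partial>M)"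
          by (rule integral_prod_fst) (use um ub in auto)
        moreover have "integrable M \<psi>A" "integrable M \<phi>A"
          using b1 mA by (auto intro!: integrable_const_bound[where B = 1] AE_I2)
        ultimately show ?thesis by (simp add: prob_space uA_def)
      qed
      also have "(\<integral>p. uB (snd p) \<partial>(M \<Otimes>\<^sub>M M)) = integral\<^sup>L M \<psi>B - integral\<^sup>L M \<phi>B"
      proof -
        have "(\<integral>p. 1 * uB (snd p) \<partial>(M \<Otimes>\<^sub>M M)) = (\<integral>x. 1 \<partial>M) * (\<integral>x. uB x \<partial>M)"
          by (rule integral_prod_fst) (use um ub in auto)
        moreover have "integrable M \<psi>B" "integrable M \<phi>B"
          using b1 mB by (auto intro!: integrable_const_bound[where B = 1] AE_I2)
        ultimately show ?thesis by (simp add: prob_space uB_def)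
      qed
      also have "((integral\<^sup>L M \<psi>A - integral\<^sup>L M \<phi>A) * Gm + (integral\<^sup>L M \<psi>B - integral\<^sup>L M \<phi>B) * Gm + 2 * \<eta>) * X
          \<le> (e * Gm + e * Gm + 2 * \<eta>) * X"
        using eA eB Gm0 X0 \<eta> by (intro mult_right_mono add_mono) auto
      also have "\<dots> = (2 * e * Gm + 2 * \<eta>) * X" by simp
      finally show ?thesis using gap by linarith
    qed
    \<comment> \<open>The multiples of \<eta> in \<open>{0..h}\<close> form the net of phases. Only
      finitely many test functions arise, so one threshold for \<open>k\<close> serves them
      all.\<close>
    define Mn where "Mn = nat \<lfloor>h / \<eta>\<rfloor>"
    have net: "0 \<le> \<eta> * real i \<and> \<eta> * real i \<le> h" if "i \<le> Mn" for i
    proof -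
      have "h / \<eta> \<ge> 0" using h \<eta> by simp
      then have "real i \<le> h / \<eta>" using that unfolding Mn_def by linarith
      then show ?thesis using \<eta> by (simp add: field_simps)
    qed
    define \<delta>1 where "\<delta>1 = \<delta> / 4"
    have \<delta>1: "\<delta>1 > 0" using \<delta> by (simp add: \<delta>1_def)
    define \<delta>2 where "\<delta>2 = \<delta> / (4 * (c * Sb + 1))"
    have \<delta>2: "\<delta>2 > 0" "c * Sb * \<delta>2 \<le> \<delta> / 4"
    proof -
      define x where "x = c * Sb + 1"
      have x: "x > 0" "c * Sb \<le> x" using c Sb(1) by (auto simp: x_def add_nonneg_pos)
      have Dx: "\<delta>2 = \<delta> / (4 * x)" by (simp add: \<delta>2_def x_def)
      show "\<delta>2 > 0" using \<delta> x by (simp add: Dx)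
      then have "c * Sb * \<delta>2 \<le> x * \<delta>2" using x by (intro mult_right_mono) auto
      also have "\<dots> = \<delta> / 4" using x by (simp add: Dx)
      finally show "c * Sb * \<delta>2 \<le> \<delta> / 4" .
    qed
    have "uniformly_continuous_on {0..1/\<epsilon>} \<rho>"
      by (intro compact_uniformly_continuous continuous_on_subset[OF \<rho>c]) auto
    then obtain \<zeta> where \<zeta>: "\<zeta> > 0" "\<And>x y. x \<in> {0..1/\<epsilon>} \<Longrightarrow> y \<in> {0..1/\<epsilon>} \<Longrightarrow> dist y x < \<zeta> \<Longrightarrow> dist (\<rho> y) (\<rho> x) < \<delta>2"
      using \<delta>2(1) unfolding uniformly_continuous_on_def by blast
    define close where "close \<phi> k \<longleftrightarrow> (\<forall>v \<in> shifted_lattice s h k \<inter> {0..R (real k) / \<epsilon>}.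
         \<bar>R (real k) * integral\<^sup>L (llt_measure M f \<tau> \<hh> k v) \<phi>
           - c * \<rho> (v / R (real k)) * integral\<^sup>L ?\<Lambda> \<phi>\<bar> < \<delta>1)" for \<phi> k
    have ev1: "\<forall>\<^sub>F k in sequentially. \<forall>i\<in>{..Mn}. close (\<Phi> \<psi>A \<psi>B (\<eta> * real i) \<eta>) k \<and> close (\<Phi> \<phi>A \<phi>B (\<eta> * real i) (-\<eta>)) k"
      unfolding close_def
      using net b1 cA cB by (intro eventually_ball_finite ballI eventually_conj llt[OF _ \<epsilon> \<delta>1] test) auto
    have ev2: "\<forall>\<^sub>F k in sequentially. R (real k) \<ge> max 1 (2 * h / \<zeta>)"
      using R_seq unfolding filterlim_at_top by blast
    obtain K where K: "\<And>k. k \<ge> K \<Longrightarrow> (\<forall>i\<in>{..Mn}. close (\<Phi> \<psi>A \<psi>B (\<eta> * real i) \<eta>) k \<and> close (\<Phi> \<phi>A \<phi>B (\<eta> * real i) (-\<eta>)) k)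
        \<and> R (real k) \<ge> max 1 (2 * h / \<zeta>)"
      using eventually_conj[OF ev1 ev2] unfolding eventually_sequentially by blast
    have "\<bar>R (real k) * passage_weight A B a1 a2 b1 b2 k t - \<rho> (t / R (real k)) * H k t\<bar> \<le> \<delta>"
      if k: "k \<ge> K" and t: "t \<ge> h" "t \<le> R (real k) / \<epsilon>" for k t
    proof -
      define rk where "rk = R (real k)"
      have rk: "rk \<ge> 1" "2 * h / \<zeta> \<le> rk" using K[OF k] by (auto simp: rk_def)
      obtain m where m: "0 \<le> (t - s * real k) + h * of_int m" "(t - s * real k) + h * of_int m < h" using lp.reduce .
      define \<theta> where "\<theta> = (t - s * real k) + h * of_int m"
      \<comment> \<open>The largest point of the coset not exceeding \<open>t\<close>; the
        requirement \<open>t \<ge> h\<close> keeps it nonnegative, inside the range of uniform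
        convergence.\<close>
      define w where "w = t - \<theta>"
      have \<theta>: "0 \<le> \<theta>" "\<theta> \<le> h" using m by (auto simp: \<theta>_def)
      have w0: "0 \<le> w" "w \<le> t" using t(1) \<theta> by (auto simp: w_def)
      have "w = s * real k + h * of_int (-m)" by (simp add: w_def \<theta>_def)
      then have wl: "w \<in> shifted_lattice s h k" unfolding shifted_lattice_def by blast
      have wr: "w \<in> shifted_lattice s h k \<inter> {0..R (real k) / \<epsilon>}" using wl w0 t(2) by auto
      have HH: "H k t = c * Ht \<theta>" by (simp add: H_def \<theta>_def Htper)
      define i where "i = nat \<lfloor>\<theta> / \<eta>\<rfloor>"
      have "\<theta> / \<eta> \<ge> 0" using \<theta> \<eta> by simp
      then have i: "real i \<le> \<theta> / \<eta>" "\<theta> / \<eta> < real i + 1" unfolding i_def by linarith+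
      have iM: "i \<le> Mn" unfolding i_def Mn_def using \<theta> \<eta> by (intro nat_mono floor_mono divide_right_mono) auto
      define \<theta>' where "\<theta>' = \<eta> * real i"
      have \<theta>': "0 \<le> \<theta>'" "\<theta>' \<le> h" using net[OF iM] by (auto simp: \<theta>'_def)
      have "real i * \<eta> \<le> \<theta>" "\<theta> < (real i + 1) * \<eta>" using i \<eta> by (simp_all only: pos_le_divide_eq pos_divide_less_eq)
      then have near: "\<bar>\<theta> - \<theta>'\<bar> \<le> \<eta>" by (simp add: \<theta>'_def algebra_simps abs_le_iff)
      have clP: "\<bar>rk * integral\<^sup>L (llt_measure M f \<tau> \<hh> k w) (\<Phi> \<psi>A \<psi>B \<theta>' \<eta>) - c * \<rho> (w / rk) * integral\<^sup>L ?\<Lambda> (\<Phi> \<psi>A \<psi>B \<theta>' \<eta>)\<bar> < \<delta>1"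
        and clN: "\<bar>rk * integral\<^sup>L (llt_measure M f \<tau> \<hh> k w) (\<Phi> \<phi>A \<phi>B \<theta>' (-\<eta>)) - c * \<rho> (w / rk) * integral\<^sup>L ?\<Lambda> (\<Phi> \<phi>A \<phi>B \<theta>' (-\<eta>))\<bar> < \<delta>1"
        using K[OF k] iM wr unfolding close_def rk_def \<theta>'_def by blast+
      \<comment> \<open>The argument of \<open>G\<close> is \<open>S k x - w - \<theta>\<close>,
        which equals \<open>S k x - t\<close>.\<close>
      have pw: "passage_weight A B a1 a2 b1 b2 k t = (\<integral>x. \<Phi> ?iA ?iB \<theta> 0 (llt_map f \<tau> \<hh> k w x) \<partial>M)"
        unfolding passage_weight_def by (intro Bochner_Integration.integral_cong refl)
          (simp add: \<Phi>_def llt_map_def G_def w_def algebra_simps)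
      have ll: "llt_map f \<tau> \<hh> k w x = (x, (f ^^ k) x, S k x - \<hh> x + \<hh> ((f ^^ k) x) - w)" for x
        by (simp add: llt_map_def)
      have sandM: "\<Phi> \<phi>A \<phi>B \<theta>' (-\<eta>) (llt_map f \<tau> \<hh> k w x) \<le> \<Phi> ?iA ?iB \<theta> 0 (llt_map f \<tau> \<hh> k w x) \<and>
          \<Phi> ?iA ?iB \<theta> 0 (llt_map f \<tau> \<hh> k w x) \<le> \<Phi> \<psi>A \<psi>B \<theta>' \<eta> (llt_map f \<tau> \<hh> k w x)" if x: "x \<in> space M" for x
        unfolding ll by (rule sand[OF x iter_space[OF x] \<theta> \<theta>' near])
      have iM1: "integrable M (\<lambda>x. \<Phi> \<phi>A \<phi>B \<theta>' (-\<eta>) (llt_map f \<tau> \<hh> k w x))"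
        by (rule E\<Phi>i) (use mA mB b1 \<theta>' in auto)
      have iM2: "integrable M (\<lambda>x. \<Phi> ?iA ?iB \<theta> 0 (llt_map f \<tau> \<hh> k w x))"
        by (rule E\<Phi>i[OF im i1 \<theta>])
      have iM3: "integrable M (\<lambda>x. \<Phi> \<psi>A \<psi>B \<theta>' \<eta> (llt_map f \<tau> \<hh> k w x))"
        by (rule E\<Phi>i) (use mA mB b1 \<theta>' in auto)
      have pwl: "integral\<^sup>L (llt_measure M f \<tau> \<hh> k w) (\<Phi> \<phi>A \<phi>B \<theta>' (-\<eta>)) \<le> passage_weight A B a1 a2 b1 b2 k t"
        unfolding pw E\<Phi>[OF mA(1) mB(1)] using sandM by (intro integral_mono iM1 iM2) auto
      have pwu: "passage_weight A B a1 a2 b1 b2 k t \<le> integral\<^sup>L (llt_measure M f \<tau> \<hh> k w) (\<Phi> \<psi>A \<psi>B \<theta>' \<eta>)"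
        unfolding pw E\<Phi>[OF mA(2) mB(2)] using sandM by (intro integral_mono iM2 iM3) auto
      have iP: "integrable ?\<Lambda> (\<Phi> \<psi>A \<psi>B \<theta>' \<eta>)" by (rule \<Phi>i) (use mA mB b1 \<theta>' in auto)
      have iN: "integrable ?\<Lambda> (\<Phi> \<phi>A \<phi>B \<theta>' (-\<eta>))" by (rule \<Phi>i) (use mA mB b1 \<theta>' in auto)
      have i0: "integrable ?\<Lambda> (\<Phi> ?iA ?iB \<theta> 0)" by (rule \<Phi>i[OF im i1 \<theta>])
      have sandL: "\<Phi> \<phi>A \<phi>B \<theta>' (-\<eta>) p \<le> \<Phi> ?iA ?iB \<theta> 0 p \<and> \<Phi> ?iA ?iB \<theta> 0 p \<le> \<Phi> \<psi>A \<psi>B \<theta>' \<eta> p"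
        if p: "p \<in> space ?\<Lambda>" for p
      proof -
        obtain x y z where "p = (x, y, z)" "x \<in> space M" "y \<in> space M" using p by (auto simp: space_pair_measure)
        then show ?thesis using sand[OF _ _ \<theta> \<theta>' near] by blast
      qed
      have Il: "integral\<^sup>L ?\<Lambda> (\<Phi> \<phi>A \<phi>B \<theta>' (-\<eta>)) \<le> Ht \<theta>"
        unfolding Ht\<Lambda>[OF \<theta>, symmetric] using sandL by (intro integral_mono iN i0) auto
      have Iu: "Ht \<theta> \<le> integral\<^sup>L ?\<Lambda> (\<Phi> \<psi>A \<psi>B \<theta>' \<eta>)"
        unfolding Ht\<Lambda>[OF \<theta>, symmetric] using sandL by (intro integral_mono i0 iP) auto
      have gp: "integral\<^sup>L ?\<Lambda> (\<Phi> \<psi>A \<psi>B \<theta>' \<eta>) - integral\<^sup>L ?\<Lambda> (\<Phi> \<phi>A \<phi>B \<theta>' (-\<eta>)) \<le> D" by (rule gapI[OF \<theta>'])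
      define y where "y = c * \<rho> (w / rk)"
      have wrk: "w / rk \<ge> 0" using w0 rk(1) by simp
      have y: "0 \<le> y" "y \<le> c * \<rho>b" using \<rho>b[OF wrk] c by (auto simp: y_def)
      have yD: "y * D \<le> \<delta> / 4" using mult_right_mono[OF y(2), of D] D by linarith
      have rk0: "rk \<ge> 0" using rk(1) by simp
      have up: "rk * passage_weight A B a1 a2 b1 b2 k t \<le> y * Ht \<theta> + \<delta> / 4 + \<delta>1"
      proof -
        have "rk * passage_weight A B a1 a2 b1 b2 k t \<le> rk * integral\<^sup>L (llt_measure M f \<tau> \<hh> k w) (\<Phi> \<psi>A \<psi>B \<theta>' \<eta>)"
          by (rule mult_left_mono[OF pwu rk0])
        also have "\<dots> \<le> y * integral\<^sup>L ?\<Lambda> (\<Phi> \<psi>A \<psi>B \<theta>' \<eta>) + \<delta>1" using clP unfolding y_def by linarith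
        also have "y * integral\<^sup>L ?\<Lambda> (\<Phi> \<psi>A \<psi>B \<theta>' \<eta>) \<le> y * (Ht \<theta> + D)"
          using gp Il y(1) by (intro mult_left_mono) auto
        finally show ?thesis using yD by (simp add: distrib_left)
      qed
      have lo: "y * Ht \<theta> - \<delta> / 4 - \<delta>1 \<le> rk * passage_weight A B a1 a2 b1 b2 k t"
      proof -
        have "y * (Ht \<theta> - D) \<le> y * integral\<^sup>L ?\<Lambda> (\<Phi> \<phi>A \<phi>B \<theta>' (-\<eta>))"
          using gp Iu y(1) by (intro mult_left_mono) auto
        moreover have "y * integral\<^sup>L ?\<Lambda> (\<Phi> \<phi>A \<phi>B \<theta>' (-\<eta>)) - \<delta>1 \<le> rk * integral\<^sup>L (llt_measure M f \<tau> \<hh> k w) (\<Phi> \<phi>A \<phi>B \<theta>' (-\<eta>))"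
          using clN unfolding y_def by linarith
        moreover have "rk * integral\<^sup>L (llt_measure M f \<tau> \<hh> k w) (\<Phi> \<phi>A \<phi>B \<theta>' (-\<eta>)) \<le> rk * passage_weight A B a1 a2 b1 b2 k t"
          by (rule mult_left_mono[OF pwl rk0])
        ultimately show ?thesis using yD by (simp add: right_diff_distrib)
      qed
      have close\<rho>: "\<bar>y * Ht \<theta> - \<rho> (t / rk) * H k t\<bar> \<le> \<delta> / 4"
      proof -
        have "w / rk \<in> {0..1/\<epsilon>}" "t / rk \<in> {0..1/\<epsilon>}"
        proof -
          have "t / rk \<le> 1 / \<epsilon>" using t(2) rk(1) \<epsilon> by (simp add: rk_def field_simps)
          moreover have "w / rk \<le> t / rk" using w0 rk(1) by (intro divide_right_mono) auto
          ultimately show "w / rk \<in> {0..1/\<epsilon>}" "t / rk \<in> {0..1/\<epsilon>}" using w0 rk(1) by auto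
        qed
        moreover have "dist (w / rk) (t / rk) < \<zeta>"
        proof -
          have "dist (w / rk) (t / rk) = \<theta> / rk"
            using rk(1) \<theta>(1) by (simp add: dist_real_def diff_divide_distrib[symmetric] w_def)
          also have "\<dots> \<le> h / rk" using \<theta> rk(1) by (intro divide_right_mono) auto
          also have "\<dots> < \<zeta>"
          proof -
            have "2 * h \<le> rk * \<zeta>" using rk(2) \<zeta>(1) by (simp add: field_simps)
            then show ?thesis using rk(1) h by (simp add: divide_less_eq mult.commute)
          qed
          finally show ?thesis .
        qed
        ultimately have "dist (\<rho> (w / rk)) (\<rho> (t / rk)) < \<delta>2" by (intro \<zeta>(2))
        then have d: "\<bar>\<rho> (w / rk) - \<rho> (t / rk)\<bar> \<le> \<delta>2" by (simp add: dist_real_def)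
        have "y * Ht \<theta> - \<rho> (t / rk) * H k t = (\<rho> (w / rk) - \<rho> (t / rk)) * (c * Ht \<theta>)"
          by (simp add: y_def HH algebra_simps)
        then have "\<bar>y * Ht \<theta> - \<rho> (t / rk) * H k t\<bar> = \<bar>\<rho> (w / rk) - \<rho> (t / rk)\<bar> * (c * \<bar>Ht \<theta>\<bar>)"
          using c by (simp add: abs_mult)
        also have "\<dots> \<le> \<delta>2 * (c * Sb)"
          using d Htb[of \<theta>] c \<delta>2(1) by (intro mult_mono mult_left_mono) auto
        also have "\<dots> = c * Sb * \<delta>2" by (simp only: mult.commute)
        finally show ?thesis using \<delta>2(2) by linarith
      qed
      show ?thesis unfolding rk_def[symmetric] using up lo close\<rho> unfolding \<delta>1_def by linarith
    qed
    then show "\<exists>K t1. \<forall>k\<ge>K. \<forall>t\<ge>t1. t \<le> R (real k) / \<epsilon> \<longrightarrow>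
        \<bar>R (real k) * passage_weight A B a1 a2 b1 b2 k t - \<rho> (t / R (real k)) * H k t\<bar> \<le> \<delta>"
      by blast
  qed
  then show ?thesis using Hb avg by blast
qed

end

theorem theorem2p6:
  fixes M :: "'a measure" and T :: "'a topology" and f :: "'a \<Rightarrow> 'a" and \<tau> :: "'a \<Rightarrow> real"
    and L R \<rho> :: "real \<Rightarrow> real" and \<alpha> c a1 a2 b1 b2 :: real
    and \<X> :: "'a set set" and A B :: "'a set"
    and r :: nat and \<beta>1 \<beta>2 \<beta>3 :: "nat \<Rightarrow> real"
  assumes "prob_space M"
    and "measure_preserving_map M f"
    and "\<tau> \<in> borel_measurable M" and "\<And>x. x \<in> space M \<Longrightarrow> \<tau> x > 0"
    and "0 < \<alpha>" and "\<alpha> < 1" and "slowly_varying L"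
    and "(\<lambda>t. measure M {x\<in>space M. \<tau> x > t}) \<sim>[at_top] (\<lambda>t. L t / t powr \<alpha>)"
    and "regularly_varying (1 / \<alpha>) R" and "eventually_monotone R"
    and "((\<lambda>t. t * L (R t) / R t powr \<alpha>) \<longlongrightarrow> 1) at_top"
    and "irrational_obs M f \<tau>"
    and mllt:
      "(mllt_aperiodic M f \<tau> R \<X> c \<rho> \<and> A \<in> \<X> \<and> B \<in> \<X>) \<or>
       (mllt_periodic T M f \<tau> R c \<rho> \<and> cont_inner_regular T M \<and>
        A \<in> sets M \<and> B \<in> sets M \<and>
        measure M (T frontier_of A) = 0 \<and> measure M (T frontier_of B) = 0)"
    and "r \<ge> 1"
    and "\<And>j. j \<in> {1..r} \<Longrightarrow> \<beta>2 j + \<beta>3 j / \<alpha> < 1"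
    and "\<And>j. j \<in> {1..r} \<Longrightarrow> \<beta>1 j + \<beta>2 j * \<alpha> + \<beta>3 j = 1"
    and "\<And>l. l > 0 \<Longrightarrow> \<exists>C t0. t0 > 0 \<and> (\<forall>k\<ge>1. \<forall>t\<ge>t0.
           measure M {x\<in>space M. birkhoff_sum f \<tau> k x \<in> {t..t + l}}
             \<le> (\<Sum>j=1..r. C * l / (L t powr \<beta>2 j * t powr \<beta>1 j
                                    * real k powr \<beta>2 j * R (real k) powr \<beta>3 j)))"
    and "a1 \<le> a2" and "b1 \<le> b2"
    and "A \<times> {a1..a2} \<subseteq> susp_region M \<tau>" and "B \<times> {b1..b2} \<subseteq> susp_region M \<tau>"
  shows "let \<A> = susp_proj f \<tau> ` (A \<times> {a1..a2});
             \<B> = susp_proj f \<tau> ` (B \<times> {b1..b2});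
             \<nu> = measure (susp_measure M \<tau>);
             chat = c * \<alpha> * (LBINT z:{0<..}. \<rho> z / z powr \<alpha>)
         in ((\<lambda>t. L t * t powr (1 - \<alpha>) * \<nu> (\<A> \<inter> susp_preimage M f \<tau> t \<B>))
               \<longlongrightarrow> chat * measure M A * measure M B * (a2 - a1) * (b2 - b1)) at_top \<and>
            chat * measure M A * measure M B * (a2 - a1) * (b2 - b1) = chat * \<nu> \<A> * \<nu> \<B>"
proof -
  interpret prob_space M by fact
  interpret renewal_setting M f \<tau> L R \<alpha>
    by (unfold_locales; fact assms)
  have A: "A \<in> sets M" and B: "B \<in> sets M" and \<rho>: "bounded_cont_density \<rho>"
    using mllt by (auto simp: mllt_aperiodic_def mllt_periodic_def)
  define c0 where "c0 = c * measure M A * measure M B * (a2 - a1) * (b2 - b1)"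
  obtain H Hb where H: "\<And>k t. \<bar>H k t\<bar> \<le> Hb" "local_limit \<rho> (passage_weight A B a1 a2 b1 b2) H"
    "\<And>\<delta>. \<delta> > 0 \<Longrightarrow> \<exists>N\<ge>1. \<forall>k t. \<bar>(\<Sum>i<N. H (k + i) t) / real N - c0\<bar> \<le> \<delta>"
  proof (cases "mllt_aperiodic M f \<tau> R \<X> c \<rho> \<and> A \<in> \<X> \<and> B \<in> \<X>")
    case True
    show ?thesis
    \<comment> \<open>Nothing oscillates in this case, and blocks of length 1 are enough.\<close>
    proof (rule that[of "\<lambda>_ _. c0" "\<bar>c0\<bar>"])
      show "local_limit \<rho> (passage_weight A B a1 a2 b1 b2) (\<lambda>_ _. c0)"
        unfolding c0_def using True \<open>a1 \<le> a2\<close> \<open>b1 \<le> b2\<close> by (intro local_limit_aperiodic) auto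
      show "\<exists>N\<ge>1. \<forall>k t. \<bar>(\<Sum>i<N. c0) / real N - c0\<bar> \<le> \<delta>" if "\<delta> > 0" for \<delta>
        using that by (intro exI[of _ 1]) simp
    qed simp
  next
    case False
    with mllt have "mllt_periodic T M f \<tau> R c \<rho>" "cont_inner_regular T M"
      "measure M (T frontier_of A) = 0" "measure M (T frontier_of B) = 0" by auto
    from local_limit_periodic[OF this(1,2) A B this(3,4) \<open>a1 \<le> a2\<close> \<open>b1 \<le> b2\<close>]
    show ?thesis unfolding c0_def[symmetric] using that by metis
  qed
  have "((\<lambda>t. L t * t powr (1 - \<alpha>) * measure (susp_measure M \<tau>)
      (susp_proj f \<tau> ` (A \<times> {a1..a2}) \<inter> susp_preimage M f \<tau> t (susp_proj f \<tau> ` (B \<times> {b1..b2}))))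
    \<longlongrightarrow> c0 * (\<alpha> * (LBINT z:{0<..}. \<rho> z / z powr \<alpha>))) at_top"
    by (rule mixing_limit[where r = r and ?\<beta>1.0 = \<beta>1 and ?\<beta>2.0 = \<beta>2 and ?\<beta>3.0 = \<beta>3 and H = H and Hb = Hb])
      (fact A B \<rho> H assms)+
  moreover have "c0 * (\<alpha> * (LBINT z:{0<..}. \<rho> z / z powr \<alpha>))
    = c * \<alpha> * (LBINT z:{0<..}. \<rho> z / z powr \<alpha>) * measure M A * measure M B * (a2 - a1) * (b2 - b1)"
    by (simp only: c0_def mult_ac)
  moreover have "measure (susp_measure M \<tau>) (susp_proj f \<tau> ` (A \<times> {a1..a2})) = measure M A * (a2 - a1)"
    "measure (susp_measure M \<tau>) (susp_proj f \<tau> ` (B \<times> {b1..b2})) = measure M B * (b2 - b1)"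
    by (rule measure_susp_box; fact A B assms)+
  ultimately show ?thesis by (simp only: Let_def) (simp add: mult_ac)
qed

end
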